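(* Let $\nu_1,\nu_2$ be probability measures on $\mathbb{R}^d$, each absolutely continuous with respect to the Lebesgue measure with a finite second moment, and each satisfying at least one of the following conditions (for $\nu\in\{\nu_1,\nu_2\}$): (i) $\nu$ is $\beta$-semi-log-convex for some $\beta>0$ and $\kappa$-semi-log-concave for some $\kappa>0$, with $\mathrm{supp}(\nu)=\mathbb{R}^d$; (iii) $\nu=N(0,\sigma^2\mathbf{I}_d)*\rho$ with $\sigma>0$, where $\rho$ is a probability measure supported on a Euclidean ball of radius $R$ in $\mathbb{R}^d$; (iv) $\nu$ is $\beta$-semi-log-convex for some $\beta>0$, $\kappa$-semi-log-concave for some $\kappa\le0$, and $\frac{d\nu}{d\gamma_d}(x)$ is $L$-log-Lipschitz in $x$ for some $L\ge0$, with $\mathrm{supp}(\nu)=\mathbb{R}^d$. For $i=1,2$ let $(X_{i,t})_{t\in[0,1]}$ be the Gaussian interpolation flow and $(X_{i,t}^* )_{t\in[0,1]}$ its time-reversed flow for the target measure $\nu_i$, using the same $a_t$ and $b_t$ for both. Then the transport maps $X_{1,1}(x)$, $X_{1,1}^*(x)$, $X_{2,1}(x)$, $X_{2,1}^*(x)$ are Lipschitz continuous in $x$. Furthermore, $$X_{1,1}\circ X_{2,1}^*\circ X_{2,1}\circ X_{1,1}^*=\mathrm{id},$$ the identity map of $\mathbb{R}^d$.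
   Context: Fix functions $a_t,b_t$ of $t\in[0,1]$ (a dot denotes the time derivative) satisfying: $\dot a_t\le 0$, $\dot b_t\ge 0$, $a_0>0$, $b_0\ge 0$, $a_1=0$, $b_1=1$; $a_t>0$ and $b_t>0$ for all $t\in(0,1)$; $a_t,b_t\in C^2([0,1))$, $a_t^2\in C^1([0,1])$, $b_t\in C^1([0,1])$. Let $\gamma_d:=N(0,\mathbf{I}_d)$. For a target measure $\nu$, let $\mathsf{Z}\sim\gamma_d$ and $\mathsf{X}_1\sim\nu$ be independent, and $\mathsf{X}_t=a_t\mathsf{Z}+b_t\mathsf{X}_1$. The velocity field of $\nu$ is $v(t,x)=\mathbb{E}[\dot a_t\mathsf{Z}+\dot b_t\mathsf{X}_1\mid\mathsf{X}_t=x]$ for $t\in(0,1)$, $v(0,x)=\lim_{t\downarrow0}v(t,x)$, $v(1,x)=\lim_{t\uparrow1}v(t,x)$. The Gaussian interpolation flow for $\nu$ is the solution $X_t(x)$ of $\frac{d}{dt}X_t(x)=v(t,X_t(x))$, $X_0(x)=x$, $t\in[0,1]$; the time-reversed flow is the solution $X_t^*(x)$ of $\frac{d}{dt}X_t^*(x)=-v(1-t,X_t^*(x))$, $X_0^*(x)=x$, $t\in[0,1]$. A probability measure $\exp(-U)\,dx$ is $\kappa$-semi-log-concave ($\kappa\in\mathbb{R}$) if its support $\Omega\subseteq\mathbb{R}^d$ is convex and $U\in C^2(\Omega)$ satisfies $\nabla^2U(x)\succeq\kappa\mathbf{I}_d$ on $\Omega$; it is $\beta$-semi-log-convex ($\beta>0$)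 if its support $\Omega$ is convex and $U\in C^2(\Omega)$ satisfies $\nabla^2U(x)\preceq\beta\mathbf{I}_d$ on $\Omega$. A function $f:\mathbb{R}^d\to\mathbb{R}_+$ is $L$-log-Lipschitz if $\log f$ is $L$-Lipschitz. *)

theory Defs
  imports "HOL-Probability.Probability"
begin

section \<open>Regularity of functions of time\<close>

text \<open>The derivative is taken within the domain, so it is one-sided at a boundary point.\<close>

definition time_deriv :: "real set \<Rightarrow> (real \<Rightarrow> real) \<Rightarrow> real \<Rightarrow> real" where
  "time_deriv S f t = vector_derivative f (at t within S)"

definition C1_on :: "real set \<Rightarrow> (real \<Rightarrow> real) \<Rightarrow> bool" where
  "C1_on S f \<longleftrightarrow> f differentiable_on S \<and> continuous_on S (time_deriv S f)"

definition C2_on :: "real set \<Rightarrow> (real \<Rightarrow> real) \<Rightarrow> bool" where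
  "C2_on S f \<longleftrightarrow> f differentiable_on S \<and> C1_on S (time_deriv S f)"

text \<open>The function \<open>a\<close> need not be differentiable at time 1 (for example
  \<open>a t = sqrt (1 - t^2)\<close>), so its derivative is only constrained on \<open>{0..<1}\<close>.\<close>

definition interpolation_schedule :: "(real \<Rightarrow> real) \<Rightarrow> (real \<Rightarrow> real) \<Rightarrow> bool" where
  "interpolation_schedule a b \<longleftrightarrow>
     (\<forall>t\<in>{0..<1}. time_deriv {0..1} a t \<le> 0) \<and>
     (\<forall>t\<in>{0..1}. time_deriv {0..1} b t \<ge> 0) \<and>
     a 0 > 0 \<and> b 0 \<ge> 0 \<and> a 1 = 0 \<and> b 1 = 1 \<and>
     (\<forall>t\<in>{0<..<1}. a t > 0 \<and> b t > 0) \<and>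
     C2_on {0..<1} a \<and> C2_on {0..<1} b \<and>
     C1_on {0..1} (\<lambda>t. (a t)\<^sup>2) \<and> C1_on {0..1} b"

section \<open>Measures on Euclidean space\<close>

text \<open>The isotropic normal distribution with mean 0 and covariance \<open>\<sigma>\<^sup>2\<close> times the identity:
  its coordinates are independent with standard deviation \<open>\<sigma>\<close>.\<close>

definition gaussian :: "real \<Rightarrow> (real ^ 'n) measure" where
  "gaussian \<sigma> = density lborel (\<lambda>x. ennreal (\<Prod>i\<in>UNIV. normal_density 0 \<sigma> (x $ i)))"

abbreviation std_gaussian :: "(real ^ 'n) measure" where
  "std_gaussian \<equiv> gaussian 1"

definition borel_probability :: "(real ^ 'n) measure \<Rightarrow> bool" where
  "borel_probability \<nu> \<longleftrightarrow> prob_space \<nu> \<and> sets \<nu> = sets borel"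

definition measure_support :: "(real ^ 'n) measure \<Rightarrow> (real ^ 'n) set" where
  "measure_support \<nu> = {x. \<forall>S. open S \<and> x \<in> S \<longrightarrow> emeasure \<nu> S > 0}"

text \<open>\<open>U\<close> is twice continuously differentiable on \<open>S\<close> with Hessian matrix \<open>H\<close>.  Derivatives
  are taken within \<open>S\<close>; for a convex set with nonempty interior (such as the convex support of a
  measure that has a density) they are unique.\<close>

definition C2_with_hessian ::
    "(real ^ 'n) set \<Rightarrow> (real ^ 'n \<Rightarrow> real) \<Rightarrow> (real ^ 'n \<Rightarrow> real ^ 'n ^ 'n) \<Rightarrow> bool" where
  "C2_with_hessian S U H \<longleftrightarrow>
     (\<exists>G. (\<forall>x\<in>S. (U has_derivative (\<lambda>h. G x \<bullet> h)) (at x within S)) \<and>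
          (\<forall>x\<in>S. (G has_derivative (\<lambda>h. H x *v h)) (at x within S))) \<and>
     continuous_on S H"

definition loewner_le :: "real ^ 'n ^ 'n \<Rightarrow> real ^ 'n ^ 'n \<Rightarrow> bool" where
  "loewner_le A B \<longleftrightarrow> (\<forall>h. h \<bullet> (A *v h) \<le> h \<bullet> (B *v h))"

text \<open>\<open>mat c\<close> is \<open>c\<close> times the identity matrix.\<close>

definition semi_log_concave :: "real \<Rightarrow> (real ^ 'n) measure \<Rightarrow> bool" where
  "semi_log_concave \<kappa> \<nu> \<longleftrightarrow>
     convex (measure_support \<nu>) \<and>
     (\<exists>U H. \<nu> = density lborel (\<lambda>x. ennreal (indicator (measure_support \<nu>) x * exp (- U x))) \<and>
            C2_with_hessian (measure_support \<nu>) U H \<and>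
            (\<forall>x\<in>measure_support \<nu>. loewner_le (mat \<kappa>) (H x)))"

definition semi_log_convex :: "real \<Rightarrow> (real ^ 'n) measure \<Rightarrow> bool" where
  "semi_log_convex \<beta> \<nu> \<longleftrightarrow>
     convex (measure_support \<nu>) \<and>
     (\<exists>U H. \<nu> = density lborel (\<lambda>x. ennreal (indicator (measure_support \<nu>) x * exp (- U x))) \<and>
            C2_with_hessian (measure_support \<nu>) U H \<and>
            (\<forall>x\<in>measure_support \<nu>. loewner_le (H x) (mat \<beta>)))"

text \<open>A function with Lipschitz logarithm is nowhere zero; this must be said explicitly because
  \<open>ln 0 = 0\<close>.\<close>

definition log_lipschitz :: "real \<Rightarrow> (real ^ 'n \<Rightarrow> real) \<Rightarrow> bool" where
  "log_lipschitz L f \<longleftrightarrow> (\<forall>x. f x > 0) \<and> L-lipschitz_on UNIV (\<lambda>x. ln (f x))"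

definition strongly_log_concave_target :: "(real ^ 'n) measure \<Rightarrow> bool" where
  "strongly_log_concave_target \<nu> \<longleftrightarrow>
     (\<exists>\<beta>>0. semi_log_convex \<beta> \<nu>) \<and> (\<exists>\<kappa>>0. semi_log_concave \<kappa> \<nu>) \<and> measure_support \<nu> = UNIV"

definition gaussian_mixture_target :: "(real ^ 'n) measure \<Rightarrow> bool" where
  "gaussian_mixture_target \<nu> \<longleftrightarrow>
     (\<exists>\<sigma>>0. \<exists>\<rho> c R. borel_probability \<rho> \<and> measure_support \<rho> \<subseteq> cball c R \<and>
                    \<nu> = (gaussian \<sigma> \<star> \<rho>))"

text \<open>A Radon-Nikodym derivative is determined almost everywhere only, so the log-Lipschitz
  property is required of some version of it.\<close>

definition log_lipschitz_target :: "(real ^ 'n) measure \<Rightarrow> bool" where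
  "log_lipschitz_target \<nu> \<longleftrightarrow>
     (\<exists>\<beta>>0. semi_log_convex \<beta> \<nu>) \<and> (\<exists>\<kappa>\<le>0. semi_log_concave \<kappa> \<nu>) \<and>
     (\<exists>L\<ge>0. \<exists>f. log_lipschitz L f \<and>
        absolutely_continuous std_gaussian \<nu> \<and>
        (AE x in std_gaussian. RN_deriv std_gaussian \<nu> x = ennreal (f x))) \<and>
     measure_support \<nu> = UNIV"

definition admissible_target :: "(real ^ 'n) measure \<Rightarrow> bool" where
  "admissible_target \<nu> \<longleftrightarrow>
     borel_probability \<nu> \<and> absolutely_continuous lborel \<nu> \<and>
     integrable \<nu> (\<lambda>x. (norm x)\<^sup>2) \<and>
     (strongly_log_concave_target \<nu> \<or> gaussian_mixture_target \<nu> \<or> log_lipschitz_target \<nu>)"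

section \<open>Velocity field and flows\<close>

text \<open>\<open>regression M X Y x\<close> is the conditional expectation of \<open>Y\<close> given \<open>X = x\<close>.  Such a function of
  \<open>x\<close> is determined only up to null sets of the law of \<open>X\<close>; the continuous version is chosen, and
  it is unique when the law of \<open>X\<close> has full support.\<close>

definition regression ::
    "'w measure \<Rightarrow> ('w \<Rightarrow> real ^ 'n) \<Rightarrow> ('w \<Rightarrow> real ^ 'n) \<Rightarrow> real ^ 'n \<Rightarrow> real ^ 'n" where
  "regression M X Y =
     (THE g. continuous_on UNIV g \<and>
        (\<forall>i. AE w in M. g (X w) $ i =
           real_cond_exp M (vimage_algebra (space M) X borel) (\<lambda>w. Y w $ i) w))"

text \<open>The independent pair of the noise and a sample of the target is realised by the two
  coordinate projections of the product space.\<close>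

definition inner_velocity ::
    "(real \<Rightarrow> real) \<Rightarrow> (real \<Rightarrow> real) \<Rightarrow> (real ^ 'n) measure \<Rightarrow> real \<Rightarrow> real ^ 'n \<Rightarrow> real ^ 'n" where
  "inner_velocity a b \<nu> t =
     regression (std_gaussian \<Otimes>\<^sub>M \<nu>)
       (\<lambda>(z, y). a t *\<^sub>R z + b t *\<^sub>R y)
       (\<lambda>(z, y). time_deriv {0..1} a t *\<^sub>R z + time_deriv {0..1} b t *\<^sub>R y)"

definition velocity ::
    "(real \<Rightarrow> real) \<Rightarrow> (real \<Rightarrow> real) \<Rightarrow> (real ^ 'n) measure \<Rightarrow> real \<Rightarrow> real ^ 'n \<Rightarrow> real ^ 'n" where
  "velocity a b \<nu> t x =
     (if t = 0 then Lim (at_right 0) (\<lambda>s. inner_velocity a b \<nu> s x)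
      else if t = 1 then Lim (at_left 1) (\<lambda>s. inner_velocity a b \<nu> s x)
      else inner_velocity a b \<nu> t x)"

definition gaussian_interpolation_flow ::
    "(real \<Rightarrow> real) \<Rightarrow> (real \<Rightarrow> real) \<Rightarrow> (real ^ 'n) measure \<Rightarrow>
     (real \<Rightarrow> real ^ 'n \<Rightarrow> real ^ 'n) \<Rightarrow> bool" where
  "gaussian_interpolation_flow a b \<nu> X \<longleftrightarrow>
     (\<forall>x. X 0 x = x \<and>
        (\<forall>t\<in>{0..1}. ((\<lambda>s. X s x) has_vector_derivative velocity a b \<nu> t (X t x))
                       (at t within {0..1})))"

definition time_reversed_flow ::
    "(real \<Rightarrow> real) \<Rightarrow> (real \<Rightarrow> real) \<Rightarrow> (real ^ 'n) measure \<Rightarrow>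
     (real \<Rightarrow> real ^ 'n \<Rightarrow> real ^ 'n) \<Rightarrow> bool" where
  "time_reversed_flow a b \<nu> X \<longleftrightarrow>
     (\<forall>x. X 0 x = x \<and>
        (\<forall>t\<in>{0..1}. ((\<lambda>s. X s x) has_vector_derivative - velocity a b \<nu> (1 - t) (X t x))
                       (at t within {0..1})))"

definition lipschitz_map :: "(real ^ 'n \<Rightarrow> real ^ 'n) \<Rightarrow> bool" where
  "lipschitz_map T \<longleftrightarrow> (\<exists>C. C-lipschitz_on UNIV T)"

end

theory Submission
  imports Defs
begin

text \<open>It suffices that the velocity field is Lipschitz in space, uniformly over times in \<open>(0, 1)\<close>;
  Gronwall's inequality then yields the Lipschitz bounds, and uniqueness of solutions makes the
  time-1 maps of a flow and of its reversal inverse to each other.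

  The velocity is affine in \<open>x\<close> and in the posterior mean \<open>m(x) = E[X\<^sub>1 | X\<^sub>t = x]\<close>. Changing \<open>x\<close> tilts
  the posterior exponentially with parameter \<open>(b / a\<^sup>2) x\<close>, so the posterior expectation of an
  \<open>l\<close>-Lipschitz function is Lipschitz in \<open>x\<close> with constant about \<open>l (b / a\<^sup>2) T\<close>, where \<open>T\<close> bounds the
  trace of the posterior covariance. For a Gaussian mixture the problem reduces to the posterior
  of the mixing measure, with \<open>a\<^sup>2\<close> replaced by \<open>a\<^sup>2 + \<sigma>\<^sup>2 b\<^sup>2\<close>, which never vanishes. For a target \<open>exp (- U)\<close>,
  dilations of the posterior give \<open>T \<le> n / (\<kappa> + b\<^sup>2 / a\<^sup>2)\<close>, and a bound on \<open>T\<close> from the log-Lipschitz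
  condition away from time 1 if \<open>\<kappa> \<le> 0\<close>. Near time 1, where \<open>T\<close> is of order \<open>a\<^sup>2\<close>, one writes
  \<open>x - b m(x) = (a\<^sup>2 / b) E[\<nabla>U(X\<^sub>1) | X\<^sub>t = x]\<close>; the trace bound alone then suffices, so no
  sharp covariance inequality (Brascamp-Lieb, Cramer-Rao) is needed.\<close>

section \<open>Stability of flows\<close>

text \<open>The flows are given, so no solution has to be constructed, and any Lipschitz constant
  will do. A factor of the dimension may therefore be lost, which is why the trace of the covariance
  can replace its norm: for independent posterior samples \<open>y\<close> and \<open>z\<close>, the
  covariance of two Lipschitz functions is at most the product of their constants times half the
  mean square of \<open>norm (y - z)\<close>, and that half is the trace.

  The \<open>n\<close> in the trace bound is the derivative at \<open>r = 1\<close> of the Jacobian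
  \<open>r ^ n\<close> of a dilation by \<open>r\<close>. The identity behind it holds for every
  centre: centred at the posterior mean it bounds the trace, and varying the centre yields the
  formula for \<open>x - b m(x)\<close>.

  The main obstacle is time 1, where \<open>b / a\<^sup>2\<close> explodes and \<open>a'\<close> may
  too; a constant uniform in time has to come from exact cancellation of powers of \<open>a\<close>.
  A second one is that regressions and densities are determined almost everywhere only, while
  Gronwall's inequality needs every \<open>x\<close>. Strict positivity of the Gaussian kernel makes
  the continuous versions unique.\<close>

lemma flow_gap_bound:
  fixes X Y :: "real \<Rightarrow> 'a::real_inner"
  assumes cont: "continuous_on {0..1} X" "continuous_on {0..1} Y"
    and X: "\<And>t. t \<in> {0<..<1} \<Longrightarrow> (X has_vector_derivative w t (X t)) (at t)"
    and Y: "\<And>t. t \<in> {0<..<1} \<Longrightarrow> (Y has_vector_derivative w t (Y t)) (at t)"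
    and lip: "\<And>t. t \<in> {0<..<1} \<Longrightarrow> C-lipschitz_on UNIV (w t)"
  shows "dist (X 1) (Y 1) \<le> exp C * dist (X 0) (Y 0)"
proof -
  \<comment> \<open>The exponential weight turns Gronwall's inequality into monotonicity of
    \<open>f\<close>. Only derivatives at interior times and continuity at the ends enter, so the
    limits that define the velocity at times 0 and 1 need no study.\<close>
  define f where "f t = exp (- (2 * C) * t) * ((X t - Y t) \<bullet> (X t - Y t))" for t
  have "f 1 \<le> f 0"
  proof (rule DERIV_nonpos_imp_decreasing_open[of 0 1 f])
    show "continuous_on {0..1} f"
      unfolding f_def by (intro continuous_intros cont)
    fix t :: real assume t: "0 < t" "t < 1"
    define D where "D = w t (X t) - w t (Y t)"
    have d: "((\<lambda>t. X t - Y t) has_vector_derivative D) (at t)"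
      unfolding D_def using t by (intro derivative_intros X Y) auto
    have h: "((\<lambda>t. (X t - Y t) \<bullet> (X t - Y t)) has_real_derivative 2 * (D \<bullet> (X t - Y t))) (at t)"
      using has_derivative_inner[OF d[unfolded has_vector_derivative_def] d[unfolded has_vector_derivative_def]]
      unfolding has_field_derivative_def
      by (rule has_derivative_eq_rhs) (auto simp: inner_commute algebra_simps)
    have e: "((\<lambda>t. exp (- (2 * C) * t)) has_real_derivative exp (- (2 * C) * t) * - (2 * C)) (at t)"
      by (auto intro!: derivative_eq_intros)
    have "(f has_real_derivative
        exp (- (2 * C) * t) * (2 * (D \<bullet> (X t - Y t)) - 2 * C * ((X t - Y t) \<bullet> (X t - Y t)))) (at t)"
      using DERIV_mult[OF e h] unfolding f_def by (simp add: algebra_simps)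
    moreover have "D \<bullet> (X t - Y t) \<le> C * ((X t - Y t) \<bullet> (X t - Y t))"
    proof -
      have "D \<bullet> (X t - Y t) \<le> norm D * norm (X t - Y t)" by (rule norm_cauchy_schwarz)
      also have "\<dots> \<le> (C * norm (X t - Y t)) * norm (X t - Y t)"
        using lipschitz_onD[OF lip[of t], of "X t" "Y t"] t
        by (intro mult_right_mono) (auto simp: D_def dist_norm)
      finally show ?thesis by (simp add: power2_norm_eq_inner[symmetric] power2_eq_square)
    qed
    ultimately show "\<exists>y. (f has_real_derivative y) (at t) \<and> y \<le> 0"
      by (intro exI[of _ "exp (- (2 * C) * t) * (2 * (D \<bullet> (X t - Y t)) -
          2 * C * ((X t - Y t) \<bullet> (X t - Y t)))"] conjI) (auto intro!: mult_nonneg_nonpos)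
  qed simp
  then have "exp (- (2 * C)) * (dist (X 1) (Y 1))\<^sup>2 \<le> (dist (X 0) (Y 0))\<^sup>2"
    by (simp add: f_def dist_norm power2_norm_eq_inner)
  then have "(dist (X 1) (Y 1))\<^sup>2 \<le> (exp C * dist (X 0) (Y 0))\<^sup>2"
    by (simp add: power_mult_distrib exp_double[symmetric] exp_minus field_simps)
  then show ?thesis by (rule power2_le_imp_le) simp
qed

lemma time_reversal_derivative:
  assumes "\<And>t. t \<in> {0..1} \<Longrightarrow> (X has_vector_derivative w t) (at t within {0..1::real})"
  shows "\<And>t. t \<in> {0..1} \<Longrightarrow>
    ((\<lambda>s. X (1 - s)) has_vector_derivative - w (1 - t)) (at t within {0..1})"
proof -
  fix t :: real assume "t \<in> {0..1}"
  then have "(X has_vector_derivative w (1 - t)) (at (1 - t) within (\<lambda>s. 1 - s) ` {0..1})"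
    using assms[of "1 - t"] by simp
  moreover have "((\<lambda>s. 1 - s) has_vector_derivative -1) (at t within {0..1})"
    by (auto intro!: derivative_eq_intros)
  ultimately show "((\<lambda>s. X (1 - s)) has_vector_derivative - w (1 - t)) (at t within {0..1})"
    using vector_diff_chain_within[of "\<lambda>s. 1 - s" "-1" t "{0..1}" X "w (1 - t)"]
    by (simp add: o_def)
qed

lemma vector_derivative_unit_interval:
  assumes "\<And>t. t \<in> {0..1} \<Longrightarrow> (X has_vector_derivative w t) (at t within {0..1::real})"
  shows "continuous_on {0..1} X"
    and "\<And>t. t \<in> {0<..<1} \<Longrightarrow> (X has_vector_derivative w t) (at t)"
proof -
  show "continuous_on {0..1} X"
    using assms by (meson continuous_on_eq_continuous_within has_vector_derivative_continuous)
  fix t :: real assume "t \<in> {0<..<1}"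
  then show "(X has_vector_derivative w t) (at t)"
    using assms[of t] by (metis at_within_interior atLeastAtMost_iff greaterThanLessThan_iff
        interior_atLeastAtMost_real less_imp_le)
qed

lemma flow_map_properties:
  fixes \<nu> :: "(real ^ 'n) measure"
  assumes F: "gaussian_interpolation_flow a b \<nu> X" and R: "time_reversed_flow a b \<nu> Y"
    and lip: "\<And>t. t \<in> {0<..<1} \<Longrightarrow> C-lipschitz_on UNIV (velocity a b \<nu> t)"
  shows "lipschitz_map (X 1)" "lipschitz_map (Y 1)" "X 1 (Y 1 x) = x" "Y 1 (X 1 x) = x"
proof -
  let ?v = "velocity a b \<nu>"
  have rlip: "C-lipschitz_on UNIV (\<lambda>x. - ?v (1 - t) x)" if "t \<in> {0<..<1}" for t
    using lip[of "1 - t"] that by simp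
  have X0: "X 0 x = x" and Y0: "Y 0 x = x" for x
    using F R by (auto simp: gaussian_interpolation_flow_def time_reversed_flow_def)
  have Xd: "\<And>t. t \<in> {0..1} \<Longrightarrow>
      ((\<lambda>s. X s x) has_vector_derivative ?v t (X t x)) (at t within {0..1})" for x
    using F by (auto simp: gaussian_interpolation_flow_def)
  have Yd: "\<And>t. t \<in> {0..1} \<Longrightarrow>
      ((\<lambda>s. Y s x) has_vector_derivative - ?v (1 - t) (Y t x)) (at t within {0..1})" for x
    using R by (auto simp: time_reversed_flow_def)
  have XRd: "((\<lambda>s. X (1 - s) x) has_vector_derivative - ?v (1 - t) (X (1 - t) x)) (at t within {0..1})"
    if "t \<in> {0..1}" for x t
    using time_reversal_derivative[OF Xd that] by simp
  have YRd: "((\<lambda>s. Y (1 - s) x) has_vector_derivative ?v t (Y (1 - t) x)) (at t within {0..1})"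
    if "t \<in> {0..1}" for x t
    using time_reversal_derivative[OF Yd that] by simp
  note Xf = vector_derivative_unit_interval[OF Xd] and Yf = vector_derivative_unit_interval[OF Yd]
  note XRf = vector_derivative_unit_interval[OF XRd] and YRf = vector_derivative_unit_interval[OF YRd]
  have "(exp C)-lipschitz_on UNIV (X 1)"
    using flow_gap_bound[OF Xf(1) Xf(1) Xf(2) Xf(2) lip]
    by (intro lipschitz_onI) (auto simp: X0)
  then show "lipschitz_map (X 1)" by (auto simp: lipschitz_map_def)
  have "(exp C)-lipschitz_on UNIV (Y 1)"
    using flow_gap_bound[OF Yf(1) Yf(1), where C = C and w = "\<lambda>t x. - ?v (1 - t) x"] Yf(2) rlip
    by (intro lipschitz_onI) (auto simp: Y0)
  then show "lipschitz_map (Y 1)" by (auto simp: lipschitz_map_def)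
  \<comment> \<open>Read backwards in time, the path of \<open>Y\<close> from \<open>x\<close>
    solves the forward equation, starts at \<open>Y 1 x\<close> and ends at \<open>x\<close>. It
    starts together with the path of \<open>X\<close> from \<open>Y 1 x\<close>, so the gap bound
    forces equal end points.\<close>
  show "X 1 (Y 1 x) = x"
    using flow_gap_bound[OF Xf(1)[of "Y 1 x"] YRf(1)[of x] Xf(2) YRf(2) lip] by (simp add: X0 Y0)
  show "Y 1 (X 1 x) = x"
    using flow_gap_bound[OF Yf(1)[of "X 1 x"] XRf(1)[of x], where C = C and w = "\<lambda>t x. - ?v (1 - t) x"] Yf(2) XRf(2) rlip
    by (simp add: X0 Y0)
qed

section \<open>Posterior expectations under exponential tilts\<close>

text \<open>The trapezoidal rule overestimates the integral of the convex function \<open>exp\<close>.\<close>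

lemma abs_exp_diff_le:
  fixes u v :: real
  shows "\<bar>exp u - exp v\<bar> \<le> \<bar>u - v\<bar> * (exp u + exp v) / 2"
proof -
  have *: "exp d - 1 \<le> d * (exp d + 1) / 2" if "0 \<le> d" for d :: real
  proof -
    define f where "f d = d * (exp d + 1) / 2 - (exp d - 1)" for d :: real
    have "f 0 \<le> f d"
    proof (rule DERIV_nonneg_imp_nondecreasing[OF that])
      fix x :: real assume x: "0 \<le> x"
      have "(f has_real_derivative (1 - (1 - x) * exp x) / 2) (at x)"
        unfolding f_def by (auto intro!: derivative_eq_intros simp: field_simps)
      moreover have "(1 - x) * exp x \<le> exp (- x) * exp x"
        using exp_ge_add_one_self[of "- x"] by (intro mult_right_mono) auto
      then have "(1 - x) * exp x \<le> 1" by (simp add: exp_minus)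
      ultimately show "\<exists>y. (f has_real_derivative y) (at x) \<and> 0 \<le> y"
        by (intro exI[of _ "(1 - (1 - x) * exp x) / 2"]) auto
    qed
    then show ?thesis by (simp add: f_def)
  qed
  have **: "\<bar>exp u - exp v\<bar> \<le> \<bar>u - v\<bar> * (exp u + exp v) / 2" if "v \<le> u" for u v :: real
  proof -
    have "exp v * (exp (u - v) - 1) \<le> exp v * ((u - v) * (exp (u - v) + 1) / 2)"
      using *[of "u - v"] that by (intro mult_left_mono) auto
    moreover have "exp v * exp (u - v) = exp u" by (simp add: exp_diff)
    ultimately show ?thesis using that by (simp add: algebra_simps)
  qed
  show ?thesis using **[of u v] **[of v u] by (cases "v \<le> u") (auto simp: abs_minus_commute add.commute)
qed

text \<open>Each side of the bound is an integral over pairs \<open>(y, z)\<close>. Antisymmetrizing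
  \<open>p' y * p z\<close> in \<open>y\<close> and \<open>z\<close> leaves a difference of exponentials, to which
  \<open>abs_exp_diff_le\<close> applies; no derivative in the tilt parameter is taken.\<close>

lemma tilt_gap:
  fixes p p' g :: "'a::euclidean_space \<Rightarrow> real"
  assumes pos: "\<And>y. p y > 0" "\<And>y. p' y > 0"
    and int: "integrable M p" "integrable M p'"
      "integrable M (\<lambda>y. p y *\<^sub>R y)" "integrable M (\<lambda>y. p' y *\<^sub>R y)"
      "integrable M (\<lambda>y. p y * (norm y)\<^sup>2)" "integrable M (\<lambda>y. p' y * (norm y)\<^sup>2)"
      "integrable M (\<lambda>y. p y * g y)" "integrable M (\<lambda>y. p' y * g y)"
    and one: "(\<integral>y. p y \<partial>M) = 1" "(\<integral>y. p' y \<partial>M) = 1"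
    and lg: "\<And>y z. \<bar>g y - g z\<bar> \<le> l * norm (y - z)"
    and ld: "\<And>y z. \<bar>(ln (p' y) - ln (p y)) - (ln (p' z) - ln (p z))\<bar> \<le> d * norm (y - z)"
    and nn: "0 \<le> l" "0 \<le> d"
  shows "(\<integral>y. p' y * g y \<partial>M) - (\<integral>y. p y * g y \<partial>M)
    \<le> l * d / 2 * ((\<integral>y. p y * (norm y)\<^sup>2 \<partial>M) + (\<integral>y. p' y * (norm y)\<^sup>2 \<partial>M)
       - 2 * ((\<integral>y. p y *\<^sub>R y \<partial>M) \<bullet> (\<integral>y. p' y *\<^sub>R y \<partial>M)))"
proof -
  define m where "m = (\<integral>y. p y *\<^sub>R y \<partial>M)"
  define m' where "m' = (\<integral>y. p' y *\<^sub>R y \<partial>M)"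
  define S where "S = (\<integral>y. p y * (norm y)\<^sup>2 \<partial>M)"
  define S' where "S' = (\<integral>y. p' y * (norm y)\<^sup>2 \<partial>M)"
  define e where "e = (\<integral>y. p y * g y \<partial>M)"
  define e' where "e' = (\<integral>y. p' y * g y \<partial>M)"
  have ptw: "(g y - g z) * (p' y * p z - p' z * p y)
      \<le> l * d / 2 * (norm (y - z))\<^sup>2 * (p' y * p z + p' z * p y)" for y z
  proof -
    have ex: "p' y * p z = exp (ln (p' y) + ln (p z))" for y z using pos by (simp add: exp_add)
    have "\<bar>p' y * p z - p' z * p y\<bar> \<le> \<bar>(ln (p' y) + ln (p z)) - (ln (p' z) + ln (p y))\<bar> *
       (p' y * p z + p' z * p y) / 2"
      unfolding ex by (rule abs_exp_diff_le)
    also have "\<dots> \<le> (d * norm (y - z)) * (p' y * p z + p' z * p y) / 2"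
      using ld[of y z] pos by (intro divide_right_mono mult_right_mono)
        (auto simp: algebra_simps intro!: add_nonneg_nonneg mult_nonneg_nonneg less_imp_le[OF add_pos_pos])
    finally have A: "\<bar>p' y * p z - p' z * p y\<bar> \<le> (d * norm (y - z)) * (p' y * p z + p' z * p y) / 2" .
    have "(g y - g z) * (p' y * p z - p' z * p y) \<le> \<bar>g y - g z\<bar> * \<bar>p' y * p z - p' z * p y\<bar>"
      by (metis abs_ge_self abs_mult)
    also have "\<dots> \<le> (l * norm (y - z)) * ((d * norm (y - z)) * (p' y * p z + p' z * p y) / 2)"
      using A lg[of y z] nn by (intro mult_mono) auto
    finally show ?thesis by (simp add: power2_eq_square mult_ac)
  qed
  have n2: "(norm (y - z))\<^sup>2 = (norm y)\<^sup>2 - 2 * (z \<bullet> y) + (norm z)\<^sup>2" for y z :: 'a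
    by (simp add: power2_norm_eq_inner inner_diff inner_commute)
  have intm: "integrable M (\<lambda>y. p y * (z \<bullet> y))" "(\<integral>y. p y * (z \<bullet> y) \<partial>M) = z \<bullet> m"
    "integrable M (\<lambda>y. p' y * (z \<bullet> y))" "(\<integral>y. p' y * (z \<bullet> y) \<partial>M) = z \<bullet> m'" for z
    using integrable_inner_right[of z M, OF int(3)] integral_inner_right[of z M, OF int(3)]
      integrable_inner_right[of z M, OF int(4)] integral_inner_right[of z M, OF int(4)]
    by (auto simp: m_def m'_def)
  \<comment> \<open>The pairs are integrated one variable at a time, first \<open>y\<close> with
    \<open>z\<close> fixed. Each stage then involves only the zeroth, first and second moments of
    \<open>p\<close> and \<open>p'\<close> and their integrals against \<open>g\<close>, and no
    product measure is formed.\<close>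
  have inner_int: "p z * (e' - g z) - p' z * (e - g z)
      \<le> l * d / 2 * (p z * (S' - 2 * (z \<bullet> m') + (norm z)\<^sup>2) + p' z * (S - 2 * (z \<bullet> m) + (norm z)\<^sup>2))" for z
  proof -
    have "(\<integral>y. (g y - g z) * (p' y * p z - p' z * p y) \<partial>M)
       \<le> (\<integral>y. l * d / 2 * (norm (y - z))\<^sup>2 * (p' y * p z + p' z * p y) \<partial>M)"
    proof (rule integral_mono)
      have "integrable M (\<lambda>y. p z * (p' y * g y) - p z * g z * p' y - p' z * (p y * g y) + p' z * g z * p y)"
        using int by (intro Bochner_Integration.integrable_add Bochner_Integration.integrable_diff integrable_mult_right) auto
      then show "integrable M (\<lambda>y. (g y - g z) * (p' y * p z - p' z * p y))"
        by (rule Bochner_Integration.integrable_cong[THEN iffD1, rotated 2]) (auto simp: field_simps)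
      have "integrable M (\<lambda>y. l * d / 2 * (p z * (p' y * (norm y)\<^sup>2 - 2 * (p' y * (z \<bullet> y)) + (norm z)\<^sup>2 * p' y)
          + p' z * (p y * (norm y)\<^sup>2 - 2 * (p y * (z \<bullet> y)) + (norm z)\<^sup>2 * p y)))"
        using int intm by (intro Bochner_Integration.integrable_add Bochner_Integration.integrable_diff integrable_mult_right) auto
      then show "integrable M (\<lambda>y. l * d / 2 * (norm (y - z))\<^sup>2 * (p' y * p z + p' z * p y))"
        unfolding n2 by (rule Bochner_Integration.integrable_cong[THEN iffD1, rotated 2]) (auto simp: field_simps)
    qed (rule ptw)
    also have "(\<integral>y. (g y - g z) * (p' y * p z - p' z * p y) \<partial>M) =
        (\<integral>y. p z * (p' y * g y) - p z * g z * p' y - p' z * (p y * g y) + p' z * g z * p y \<partial>M)"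
      by (rule Bochner_Integration.integral_cong) (auto simp: algebra_simps)
    also have "\<dots> = p z * (e' - g z) - p' z * (e - g z)"
      using int one by (simp add: e_def e'_def) (simp add: algebra_simps)
    also have "(\<integral>y. l * d / 2 * (norm (y - z))\<^sup>2 * (p' y * p z + p' z * p y) \<partial>M) =
        (\<integral>y. l * d / 2 * (p z * (p' y * (norm y)\<^sup>2 - 2 * (p' y * (z \<bullet> y)) + (norm z)\<^sup>2 * p' y)
          + p' z * (p y * (norm y)\<^sup>2 - 2 * (p y * (z \<bullet> y)) + (norm z)\<^sup>2 * p y)) \<partial>M)"
      unfolding n2 by (rule Bochner_Integration.integral_cong) (auto simp: field_simps)
    also have "\<dots> = l * d / 2 * (p z * (S' - 2 * (z \<bullet> m') + (norm z)\<^sup>2) + p' z * (S - 2 * (z \<bullet> m) + (norm z)\<^sup>2))"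
      using int one intm by (simp add: S_def S'_def)
    finally show ?thesis .
  qed
  have "(\<integral>z. p z * (e' - g z) - p' z * (e - g z) \<partial>M)
      \<le> (\<integral>z. l * d / 2 * (p z * (S' - 2 * (z \<bullet> m') + (norm z)\<^sup>2) + p' z * (S - 2 * (z \<bullet> m) + (norm z)\<^sup>2)) \<partial>M)"
  proof (rule integral_mono)
    have "integrable M (\<lambda>z. e' * p z - p z * g z - (e * p' z - p' z * g z))"
      using int by (intro Bochner_Integration.integrable_add Bochner_Integration.integrable_diff integrable_mult_right) auto
    then show "integrable M (\<lambda>z. p z * (e' - g z) - p' z * (e - g z))"
      by (rule Bochner_Integration.integrable_cong[THEN iffD1, rotated 2]) (auto simp: algebra_simps)
    have "integrable M (\<lambda>z. l * d / 2 * ((S' * p z - 2 * (p z * (m' \<bullet> z)) + p z * (norm z)\<^sup>2)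
        + (S * p' z - 2 * (p' z * (m \<bullet> z)) + p' z * (norm z)\<^sup>2)))"
      using int intm by (intro Bochner_Integration.integrable_add Bochner_Integration.integrable_diff integrable_mult_right) auto
    then show "integrable M (\<lambda>z. l * d / 2 * (p z * (S' - 2 * (z \<bullet> m') + (norm z)\<^sup>2) + p' z * (S - 2 * (z \<bullet> m) + (norm z)\<^sup>2)))"
      by (rule Bochner_Integration.integrable_cong[THEN iffD1, rotated 2]) (auto simp: field_simps inner_commute)
  qed (rule inner_int)
  also have "(\<integral>z. p z * (e' - g z) - p' z * (e - g z) \<partial>M) =
      (\<integral>z. e' * p z - p z * g z - (e * p' z - p' z * g z) \<partial>M)"
    by (rule Bochner_Integration.integral_cong) (auto simp: algebra_simps)
  \<comment> \<open>Antisymmetrizing counts the difference twice. The right side carries the same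
    factor 2, so the half from the trapezoidal rule survives in the final constant.\<close>
  also have "\<dots> = 2 * (e' - e)"
    using int one by (simp add: e_def e'_def)
  also have "(\<integral>z. l * d / 2 * (p z * (S' - 2 * (z \<bullet> m') + (norm z)\<^sup>2) + p' z * (S - 2 * (z \<bullet> m) + (norm z)\<^sup>2)) \<partial>M)
      = (\<integral>z. l * d / 2 * ((S' * p z - 2 * (p z * (m' \<bullet> z)) + p z * (norm z)\<^sup>2)
        + (S * p' z - 2 * (p' z * (m \<bullet> z)) + p' z * (norm z)\<^sup>2)) \<partial>M)"
    by (rule Bochner_Integration.integral_cong) (auto simp: field_simps inner_commute)
  also have "\<dots> = l * d / 2 * (2 * (S + S' - 2 * (m \<bullet> m')))"
    using int one intm by (simp add: S_def S'_def) (simp add: inner_commute[of m'])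
  finally have "e' - e \<le> l * d / 2 * (S + S' - 2 * (m \<bullet> m'))" by (simp add: algebra_simps)
  then show ?thesis unfolding m_def m'_def S_def S'_def e_def e'_def .
qed

text \<open>The law of \<open>Y\<close> given \<open>sqrt q Z + b Y = x\<close>, for \<open>Y\<close> with law \<open>M\<close> and standard
  normal \<open>Z\<close>. The parameter \<open>q\<close> is \<open>a\<^sup>2\<close> for the target itself and \<open>a\<^sup>2 + \<sigma>\<^sup>2 b\<^sup>2\<close> for
  the mixing measure of a Gaussian mixture.\<close>

locale posterior =
  fixes M :: "'a::euclidean_space measure" and q b :: real
  assumes prob: "prob_space M" and sets_M [measurable_cong]: "sets M = sets borel"
    and second_moment: "integrable M (\<lambda>y. (norm y)\<^sup>2)"
    and q_pos: "q > 0" and b_pos: "b > 0"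
begin

interpretation M: prob_space M by (rule prob)

text \<open>The Gaussian likelihood of the observation \<open>x\<close> given the sample
  \<open>y\<close>, without its normalizing constant, which cancels in \<open>post\<close>. Dropping
  it gives \<open>kern_le1\<close>, so that any \<open>M\<close>-integrable function dominates its
  product with the kernel.\<close>

definition kern :: "'a \<Rightarrow> 'a \<Rightarrow> real" where
  "kern x y = exp (- (norm (x - b *\<^sub>R y))\<^sup>2 / (2 * q))"

definition mass :: "'a \<Rightarrow> real" where "mass x = (\<integral>y. kern x y \<partial>M)"

definition post :: "'a \<Rightarrow> 'a measure" where
  "post x = density M (\<lambda>y. ennreal (kern x y / mass x))"

lemma kern_pos [simp]: "kern x y > 0" and kern_le1: "kern x y \<le> 1"
  using q_pos by (auto simp: kern_def)

lemma kern_nonneg [simp]: "0 \<le> kern x y"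
  using kern_pos[of x y] by linarith

lemma kern_nz [simp]: "kern x y \<noteq> 0"
  using kern_pos[of x y] by linarith

lemma kern_measurable [measurable]:
  assumes "f \<in> borel_measurable N" "g \<in> borel_measurable N"
  shows "(\<lambda>w. kern (f w) (g w)) \<in> borel_measurable N"
  unfolding kern_def using assms by measurable

text \<open>Quadratic growth is the class that the second moment of \<open>M\<close> controls. It
  contains the Lipschitz functions, through \<open>lin_le_quad\<close>.\<close>

lemma integrable_quadratic_growth:
  fixes f :: "'a \<Rightarrow> 'b::{banach, second_countable_topology}"
  assumes [measurable]: "f \<in> borel_measurable borel" and "\<And>y. norm (f y) \<le> A + B * (norm y)\<^sup>2"
  shows "integrable M f"
proof (rule Bochner_Integration.integrable_bound)
  show "integrable M (\<lambda>y. A + B * (norm y)\<^sup>2)" using second_moment by auto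
  show "AE y in M. norm (f y) \<le> norm (A + B * (norm y)\<^sup>2)"
    using assms(2) by (intro AE_I2) (metis abs_ge_self order_trans real_norm_def)
qed auto

lemma integrable_kern_growth:
  fixes f :: "'a \<Rightarrow> 'b::{banach, second_countable_topology}"
  assumes [measurable]: "f \<in> borel_measurable borel" and "\<And>y. norm (f y) \<le> A + B * (norm y)\<^sup>2"
  shows "integrable M (\<lambda>y. kern x y *\<^sub>R f y)"
  using integrable_quadratic_growth[of f A B]
  by (rule Bochner_Integration.integrable_bound)
    (auto simp: assms kern_le1 mult_left_le_one_le)

lemma continuous_kern_integral:
  fixes f :: "'a \<Rightarrow> 'b::{banach, second_countable_topology}"
  assumes [measurable]: "f \<in> borel_measurable borel" and "\<And>y. norm (f y) \<le> A + B * (norm y)\<^sup>2"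
  shows "continuous_on UNIV (\<lambda>x. \<integral>y. kern x y *\<^sub>R f y \<partial>M)"
  unfolding continuous_on_sequentially
proof (intro allI ballI impI)
  fix u x assume "(\<forall>n. u n \<in> (UNIV::'a set)) \<and> u \<longlonglongrightarrow> x"
  then have u: "u \<longlonglongrightarrow> x" by simp
  have "(\<lambda>n. \<integral>y. kern (u n) y *\<^sub>R f y \<partial>M) \<longlonglongrightarrow> (\<integral>y. kern x y *\<^sub>R f y \<partial>M)"
  proof (rule integral_dominated_convergence[where w = "\<lambda>y. norm (f y)"])
    show "integrable M (\<lambda>y. norm (f y))" using integrable_quadratic_growth[OF assms] by auto
    show "AE y in M. (\<lambda>n. kern (u n) y *\<^sub>R f y) \<longlonglongrightarrow> kern x y *\<^sub>R f y"
      unfolding kern_def by (intro AE_I2 tendsto_intros u) (use q_pos in auto)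
    show "AE y in M. norm (kern (u n) y *\<^sub>R f y) \<le> norm (f y)" for n
      by (auto simp: kern_le1 mult_left_le_one_le)
  qed auto
  then show "((\<lambda>x. \<integral>y. kern x y *\<^sub>R f y \<partial>M) \<circ> u) \<longlonglongrightarrow> (\<integral>y. kern x y *\<^sub>R f y \<partial>M)"
    by (simp add: o_def)
qed

lemma integrable_kern: "integrable M (kern x)"
  using integrable_kern_growth[of "\<lambda>_. 1::real" 1 0] by simp

lemma mass_pos [simp]: "mass x > 0"
proof -
  have "mass x \<noteq> 0"
  proof
    assume "mass x = 0"
    then have "AE y in M. kern x y = 0"
      unfolding mass_def by (subst (asm) integral_nonneg_eq_0_iff_AE) (auto simp: integrable_kern)
    then have "AE y in M. False" by eventually_elim simp
    then show False by (simp add: M.AE_False)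
  qed
  moreover have "mass x \<ge> 0" unfolding mass_def by (auto intro!: integral_nonneg_AE)
  ultimately show ?thesis by simp
qed

lemma mass_nz [simp]: "mass x \<noteq> 0" using mass_pos[of x] by linarith

lemma sets_post [measurable_cong, simp]: "sets (post x) = sets borel"
  by (simp add: post_def sets_M)

lemma integrable_post_iff:
  fixes f :: "'a \<Rightarrow> 'b::{banach, second_countable_topology}"
  assumes [measurable]: "f \<in> borel_measurable borel"
  shows "integrable (post x) f \<longleftrightarrow> integrable M (\<lambda>y. (kern x y / mass x) *\<^sub>R f y)"
  unfolding post_def by (subst integrable_density) (auto intro!: AE_I2 less_imp_le[OF divide_pos_pos])

lemma integral_post:
  fixes f :: "'a \<Rightarrow> 'b::{banach, second_countable_topology}"
  assumes [measurable]: "f \<in> borel_measurable borel"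
  shows "integral\<^sup>L (post x) f = (\<integral>y. (kern x y / mass x) *\<^sub>R f y \<partial>M)"
  unfolding post_def by (subst integral_density) (auto intro!: AE_I2 less_imp_le[OF divide_pos_pos])

lemma integral_post':
  fixes f :: "'a \<Rightarrow> 'b::{banach, second_countable_topology}"
  assumes [measurable]: "f \<in> borel_measurable borel"
  shows "integral\<^sup>L (post x) f = (\<integral>y. kern x y *\<^sub>R f y \<partial>M) /\<^sub>R mass x"
  unfolding integral_post[OF assms]
  by (simp add: divide_inverse mult.commute[of _ "inverse _"] flip: scaleR_scaleR)

lemma integrable_post_growth:
  fixes f :: "'a \<Rightarrow> 'b::{banach, second_countable_topology}"
  assumes [measurable]: "f \<in> borel_measurable borel" and "\<And>y. norm (f y) \<le> A + B * (norm y)\<^sup>2"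
  shows "integrable (post x) f"
  using integrable_scaleR_right[OF integrable_kern_growth[OF assms], of "1 / mass x" x]
  by (subst integrable_post_iff) auto

lemma prob_space_post: "prob_space (post x)"
proof -
  have "(\<integral>y. kern x y / mass x \<partial>M) = 1" by (simp flip: mass_def)
  then have "(\<integral>\<^sup>+y. ennreal (kern x y / mass x) \<partial>M) = 1"
    by (subst nn_integral_eq_integral) (auto simp: integrable_kern less_imp_le[OF divide_pos_pos])
  then show ?thesis
    unfolding post_def by (intro prob_spaceI) (auto simp: emeasure_density nn_integral_set_ennreal[symmetric] cong: nn_integral_cong)
qed

definition mean :: "'a \<Rightarrow> 'a" where "mean x = (\<integral>y. y \<partial>post x)"

text \<open>The trace of the covariance matrix of \<open>post x\<close>.\<close>

definition var :: "'a \<Rightarrow> real" where "var x = (\<integral>y. (norm (y - mean x))\<^sup>2 \<partial>post x)"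

lemma lin_le_quad: "r \<le> 1 + r\<^sup>2" for r :: real
proof -
  have "0 \<le> (r - 1)\<^sup>2 + r\<^sup>2 + 1" by simp
  then show ?thesis by (simp add: power2_eq_square algebra_simps)
qed

lemma affine_growth_le:
  assumes "r \<le> A + B * s" "0 \<le> (A::real)" "0 \<le> B"
  shows "r \<le> (A + B) + B * s\<^sup>2"
  using assms(1) mult_left_mono[OF lin_le_quad[of s] assms(3)] assms(2) by (simp add: algebra_simps)

lemma integrable_id_post: "integrable (post x) (\<lambda>y. y)"
  by (rule integrable_post_growth[of _ 1 1]) (auto intro: lin_le_quad)

lemma integrable_sq_post: "integrable (post x) (\<lambda>y. (norm y)\<^sup>2)"
  by (rule integrable_post_growth[of _ 0 1]) auto

lemma integrable_sq_diff_post: "integrable (post x) (\<lambda>y. (norm (y - c))\<^sup>2)"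
  and integral_sq_diff_post: "(\<integral>y. (norm (y - c))\<^sup>2 \<partial>post x) = (\<integral>y. (norm y)\<^sup>2 \<partial>post x) - 2 * (c \<bullet> mean x) + (norm c)\<^sup>2"
proof -
  interpret P: prob_space "post x" by (rule prob_space_post)
  have *: "(norm (y - c))\<^sup>2 = (norm y)\<^sup>2 - 2 * (c \<bullet> y) + (norm c)\<^sup>2" for y
    by (simp add: power2_norm_eq_inner inner_diff inner_commute)
  note i = integrable_sq_post[of x] integrable_inner_right[of c "post x", OF integrable_id_post]
  show "integrable (post x) (\<lambda>y. (norm (y - c))\<^sup>2)"
    unfolding * using i by auto
  show "(\<integral>y. (norm (y - c))\<^sup>2 \<partial>post x) = (\<integral>y. (norm y)\<^sup>2 \<partial>post x) - 2 * (c \<bullet> mean x) + (norm c)\<^sup>2"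
    unfolding * using i integral_inner_right[of c "post x", OF integrable_id_post]
    by (simp add: mean_def P.prob_space)
qed

lemma var_eq: "var x = (\<integral>y. (norm y)\<^sup>2 \<partial>post x) - (norm (mean x))\<^sup>2"
  unfolding var_def integral_sq_diff_post by (simp add: power2_norm_eq_inner)

text \<open>The mean minimizes the mean square distance. This permits a more convenient centre: that
  of the ball for mixtures, that of an approximating Gaussian for log-Lipschitz targets.\<close>

lemma var_le: "var x \<le> (\<integral>y. (norm (y - c))\<^sup>2 \<partial>post x)"
proof -
  have "0 \<le> (norm (mean x - c))\<^sup>2" by simp
  then show ?thesis unfolding var_eq integral_sq_diff_post
    by (simp add: power2_norm_eq_inner inner_diff inner_commute)
qed

lemma continuous_post_integral:
  fixes f :: "'a \<Rightarrow> 'b::{banach, second_countable_topology}"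
  assumes [measurable]: "f \<in> borel_measurable borel" and "\<And>y. norm (f y) \<le> A + B * (norm y)\<^sup>2"
  shows "continuous_on UNIV (\<lambda>x. integral\<^sup>L (post x) f)"
proof -
  have "continuous_on UNIV mass"
    unfolding mass_def using continuous_kern_integral[of "\<lambda>_. 1::real" 1 0] by simp
  then show ?thesis
    unfolding integral_post'[OF assms(1)]
    by (intro continuous_intros continuous_kern_integral[OF assms]) auto
qed

lemma continuous_mean: "continuous_on UNIV mean"
  unfolding mean_def by (rule continuous_post_integral[of _ 1 1]) (auto intro: lin_le_quad)

lemma lipschitz_growth:
  fixes G :: "'a \<Rightarrow> 'b::real_normed_vector"
  assumes "l-lipschitz_on UNIV G"
  shows "norm (G y) \<le> (norm (G 0) + l) + l * (norm y)\<^sup>2"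
proof (rule affine_growth_le)
  show "norm (G y) \<le> norm (G 0) + l * norm y"
    using lipschitz_onD[OF assms, of y 0] norm_triangle_sub[of "G y" "G 0"] by (simp add: dist_norm)
qed (use lipschitz_on_nonneg[OF assms] in auto)

lemma lipschitz_measurable: "l-lipschitz_on UNIV G \<Longrightarrow> G \<in> borel_measurable borel"
  using lipschitz_on_continuous_on borel_measurable_continuous_onI by blast

lemma integrable_lipschitz_post:
  fixes G :: "'a \<Rightarrow> 'b::{banach, second_countable_topology}"
  shows "l-lipschitz_on UNIV G \<Longrightarrow> integrable (post x) G"
  using lipschitz_growth lipschitz_measurable integrable_post_growth by blast

text \<open>Moving the observation from \<open>x\<close> to \<open>x'\<close> multiplies the
  posterior density by the exponential of a linear function of \<open>y\<close> with slope
  \<open>(b / q) *\<^sub>R (x' - x)\<close>, up to a constant, so \<open>tilt_gap\<close> applies.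
  The last factor is the mean of the squared distance between independent samples of
  \<open>post x\<close> and \<open>post x'\<close>.\<close>

lemma post_integral_gap:
  fixes G :: "'a \<Rightarrow> 'b::euclidean_space"
  assumes G: "l-lipschitz_on UNIV G"
  shows "norm (integral\<^sup>L (post x') G - integral\<^sup>L (post x) G)
    \<le> l * (b / q * norm (x' - x)) / 2 * (var x + var x' + (norm (mean x' - mean x))\<^sup>2)"
proof -
  define p where "p x y = kern x y / mass x" for x y
  have l0: "l \<ge> 0" using lipschitz_on_nonneg[OF G] .
  have real_gap: "integral\<^sup>L (post x') g - integral\<^sup>L (post x) g
    \<le> l * (b / q * norm (x' - x)) / 2 * (var x + var x' + (norm (mean x' - mean x))\<^sup>2)"
    if g: "l-lipschitz_on UNIV g" for g :: "'a \<Rightarrow> real"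
  proof -
    have gm [measurable]: "g \<in> borel_measurable borel" by (rule lipschitz_measurable[OF g])
    have "(\<integral>y. p x' y * g y \<partial>M) - (\<integral>y. p x y * g y \<partial>M)
      \<le> l * (b / q * norm (x' - x)) / 2 * ((\<integral>y. p x y * (norm y)\<^sup>2 \<partial>M) + (\<integral>y. p x' y * (norm y)\<^sup>2 \<partial>M)
       - 2 * ((\<integral>y. p x y *\<^sub>R y \<partial>M) \<bullet> (\<integral>y. p x' y *\<^sub>R y \<partial>M)))"
    proof (rule tilt_gap)
      show "p x y > 0" for x y by (simp add: p_def)
      show "p x y > 0" for x y by (simp add: p_def)
      have i: "integrable M (p x)" "(\<integral>y. p x y \<partial>M) = 1" for x
        using integrable_kern[of x] by (auto simp: p_def[abs_def] simp flip: mass_def)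
      show "integrable M (p x)" "(\<integral>y. p x y \<partial>M) = 1" "integrable M (p x')" "(\<integral>y. p x' y \<partial>M) = 1"
        using i by auto
      have j: "integrable M (\<lambda>y. p x y *\<^sub>R y)" for x
        using integrable_id_post[of x] by (subst (asm) integrable_post_iff) (auto simp: p_def)
      show "integrable M (\<lambda>y. p x y *\<^sub>R y)" "integrable M (\<lambda>y. p x' y *\<^sub>R y)" using j by auto
      have k: "integrable M (\<lambda>y. p x y * (norm y)\<^sup>2)" for x
        using integrable_sq_post[of x] by (subst (asm) integrable_post_iff) (auto simp: p_def)
      show "integrable M (\<lambda>y. p x y * (norm y)\<^sup>2)" "integrable M (\<lambda>y. p x' y * (norm y)\<^sup>2)" using k by auto
      have n: "integrable M (\<lambda>y. p x y * g y)" for x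
        using integrable_lipschitz_post[OF g, of x] by (subst (asm) integrable_post_iff) (auto simp: p_def)
      show "integrable M (\<lambda>y. p x y * g y)" "integrable M (\<lambda>y. p x' y * g y)" using n by auto
      show "\<bar>g y - g z\<bar> \<le> l * norm (y - z)" for y z
        using lipschitz_onD[OF g, of y z] by (simp add: dist_norm)
      show "0 \<le> l" by fact
      show "0 \<le> b / q * norm (x' - x)" using q_pos b_pos by simp
      fix y z
      have lnp: "ln (p x y) = - (norm (x - b *\<^sub>R y))\<^sup>2 / (2 * q) - ln (mass x)" for x y
        by (simp add: p_def ln_div) (simp add: kern_def)
      have "(ln (p x' y) - ln (p x y)) - (ln (p x' z) - ln (p x z)) = b / q * ((x' - x) \<bullet> (y - z))"
        unfolding lnp using q_pos
        by (simp add: power2_norm_eq_inner inner_diff inner_commute field_simps)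
      then show "\<bar>(ln (p x' y) - ln (p x y)) - (ln (p x' z) - ln (p x z))\<bar> \<le> b / q * norm (x' - x) * norm (y - z)"
        using Cauchy_Schwarz_ineq2[of "x' - x" "y - z"] q_pos b_pos
        by (simp add: abs_mult mult.assoc) (simp add: divide_right_mono mult_left_mono)
    qed
    also have "(\<integral>y. p x' y * g y \<partial>M) = integral\<^sup>L (post x') g"
      by (subst integral_post) (auto simp: p_def)
    also have "(\<integral>y. p x y * g y \<partial>M) = integral\<^sup>L (post x) g"
      by (subst integral_post) (auto simp: p_def)
    also have "(\<integral>y. p x y *\<^sub>R y \<partial>M) = mean x"
      unfolding mean_def by (subst integral_post) (auto simp: p_def)
    also have "(\<integral>y. p x' y *\<^sub>R y \<partial>M) = mean x'"
      unfolding mean_def by (subst integral_post) (auto simp: p_def)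
    also have "(\<integral>y. p x y * (norm y)\<^sup>2 \<partial>M) = (\<integral>y. (norm y)\<^sup>2 \<partial>post x)"
      by (subst integral_post) (auto simp: p_def)
    also have "(\<integral>y. p x' y * (norm y)\<^sup>2 \<partial>M) = (\<integral>y. (norm y)\<^sup>2 \<partial>post x')"
      by (subst integral_post) (auto simp: p_def)
    also have "(\<integral>y. (norm y)\<^sup>2 \<partial>post x) + (\<integral>y. (norm y)\<^sup>2 \<partial>post x') - 2 * (mean x \<bullet> mean x')
        = var x + var x' + (norm (mean x' - mean x))\<^sup>2"
      unfolding var_eq by (simp add: power2_norm_eq_inner inner_diff inner_commute)
    finally show ?thesis .
  qed
  define D where "D = integral\<^sup>L (post x') G - integral\<^sup>L (post x) G"
  \<comment> \<open>Pairing \<open>G\<close> with the unit vector in the direction of the gap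
    \<open>D\<close> reduces to real functions without a dimensional factor. If \<open>D = 0\<close>
    then \<open>sgn D = 0\<close> and nothing is lost.\<close>
  have "1-lipschitz_on UNIV (\<lambda>v. sgn D \<bullet> v)"
  proof (rule lipschitz_onI)
    show "dist (sgn D \<bullet> v) (sgn D \<bullet> w) \<le> 1 * dist v w" for v w
      using Cauchy_Schwarz_ineq2[of "sgn D" "v - w"] 
      by (cases "D = 0") (auto simp: dist_norm norm_sgn inner_diff_right)
  qed simp
  from lipschitz_on_compose2[OF G lipschitz_on_subset[OF this]]
  have "l-lipschitz_on UNIV (\<lambda>y. sgn D \<bullet> G y)" by simp
  from real_gap[OF this] have "sgn D \<bullet> D
     \<le> l * (b / q * norm (x' - x)) / 2 * (var x + var x' + (norm (mean x' - mean x))\<^sup>2)"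
    by (simp add: integrable_lipschitz_post[OF G] D_def inner_diff_right)
  moreover have "sgn D \<bullet> D = norm D"
    by (cases "D = 0") (simp_all add: sgn_div_norm power2_eq_square flip: power2_norm_eq_inner)
  ultimately show ?thesis by (simp add: D_def)
qed

end

text \<open>Closeness is measured through \<open>h\<close>, so the scale on which the local bound
  holds may shrink from place to place. On a single segment \<open>h\<close> is uniformly
  continuous; cutting it into \<open>n\<close> equal pieces and adding the local bounds gives back
  the full length, with the same constant \<open>C\<close>.\<close>

lemma lipschitz_from_local:
  fixes f :: "'a::real_normed_vector \<Rightarrow> 'b::metric_space" and h :: "'a \<Rightarrow> 'c::real_normed_vector"
  assumes h: "continuous_on UNIV h" and e: "e > 0" and C: "C \<ge> 0"
    and loc: "\<And>x y. norm (h x - h y) \<le> e \<Longrightarrow> dist (f x) (f y) \<le> C * dist x y"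
  shows "C-lipschitz_on UNIV f"
proof (rule lipschitz_onI)
  fix x y :: 'a
  define g where "g s = x + s *\<^sub>R (y - x)" for s :: real
  have "uniformly_continuous_on {0..1} (\<lambda>s. h (g s))"
    unfolding g_def by (intro compact_uniformly_continuous continuous_on_compose2[OF h] continuous_intros) auto
  then obtain d where d: "d > 0" "\<And>s t. s \<in> {0..1} \<Longrightarrow> t \<in> {0..1} \<Longrightarrow> dist t s < d \<Longrightarrow> dist (h (g t)) (h (g s)) < e"
    unfolding uniformly_continuous_on_def using e by metis
  obtain n :: nat where n: "n > 0" "1 / real n < d"
    using d(1) by (metis nat_approx_posE of_nat_0_less_iff zero_less_Suc)
  have step: "dist (f (g (real i / n))) (f (g (real (Suc i) / n))) \<le> C * (dist x y / n)" if "i < n" for i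
  proof -
    have "dist (g (real i / n)) (g (real (Suc i) / n)) = dist x y / n"
    proof -
      have "g (real (Suc i) / n) - g (real i / n) = (1 / n) *\<^sub>R (y - x)"
        by (simp add: g_def add_divide_distrib algebra_simps)
      then show ?thesis using n by (metis dist_commute dist_norm norm_scaleR real_norm_def abs_of_nonneg zero_le_divide_1_iff of_nat_0_le_iff divide_inverse mult.commute inverse_eq_divide)
    qed
    moreover have "dist (h (g (real i / n))) (h (g (real (Suc i) / n))) < e"
      using that n by (intro d(2)) (auto simp: dist_real_def field_simps)
    ultimately show ?thesis using loc[of "g (real i / n)" "g (real (Suc i) / n)"] by (simp add: dist_norm)
  qed
  have "dist (f (g 0)) (f (g (real k / n))) \<le> real k * (C * (dist x y / n))" if "k \<le> n" for k
    using that
  proof (induction k)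
    case (Suc k)
    then have "dist (f (g 0)) (f (g (real (Suc k) / n))) \<le>
        real k * (C * (dist x y / n)) + C * (dist x y / n)"
      using step[of k] dist_triangle[of "f (g 0)" "f (g (real (Suc k) / n))" "f (g (real k / n))"] by linarith
    then show ?case using n by (simp add: field_simps)
  qed simp
  from this[of n] show "dist (f x) (f y) \<le> C * dist x y"
    using n by (simp add: g_def)
qed (rule C)

context posterior
begin

text \<open>The term \<open>(norm (mean x' - mean x))\<^sup>2\<close> of \<open>post_integral_gap\<close> is negligible on short
  segments because \<open>mean\<close> is continuous, hence the arbitrarily small \<open>e\<close>. It may not be
  fixed to 1: near time 1 the variance bound \<open>T\<close> is of order \<open>q\<close>, and this cancels
  the factor \<open>1 / q\<close>.\<close>

lemma post_integral_lipschitz: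
  fixes G :: "'a \<Rightarrow> 'b::euclidean_space"
  assumes G: "l-lipschitz_on UNIV G" and T: "\<And>x. var x \<le> T" and e: "e > 0" and T0: "T \<ge> 0"
  shows "(l * (b / q) * (T + e))-lipschitz_on UNIV (\<lambda>x. integral\<^sup>L (post x) G)"
proof (rule lipschitz_from_local[OF continuous_mean])
  \<comment> \<open>With this threshold the squared gap of means is at most \<open>2 * e\<close>, so
    the sum in \<open>post_integral_gap\<close> is at most \<open>2 * (T + e)\<close>, and its
    factor one half cancels.\<close>
  show "sqrt (2 * e) > 0" using e by simp
  show "0 \<le> l * (b / q) * (T + e)"
    using lipschitz_on_nonneg[OF G] e T0 b_pos q_pos by simp
  fix x y assume "norm (mean x - mean y) \<le> sqrt (2 * e)"
  then have "(norm (mean x - mean y))\<^sup>2 \<le> 2 * e" using e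
    by (metis norm_ge_zero power_mono real_sqrt_pow2 less_imp_le mult_pos_pos zero_less_numeral)
  then have "var y + var x + (norm (mean x - mean y))\<^sup>2 \<le> 2 * (T + e)" using T[of x] T[of y] by simp
  then have "l * (b / q * norm (x - y)) / 2 * (var y + var x + (norm (mean x - mean y))\<^sup>2)
      \<le> l * (b / q * norm (x - y)) / 2 * (2 * (T + e))"
    using lipschitz_on_nonneg[OF G] b_pos q_pos by (intro mult_left_mono) auto
  also have "\<dots> = l * (b / q) * (T + e) * dist x y" using q_pos by (simp add: dist_norm field_simps)
  finally show "dist (integral\<^sup>L (post x) G) (integral\<^sup>L (post y) G) \<le> l * (b / q) * (T + e) * dist x y"
    using post_integral_gap[OF G, of x y] by (simp add: dist_norm)
qed

end

section \<open>Potentials with bounded Hessian\<close>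

lemma lborel_integral_affine:
  fixes f :: "'a::euclidean_space \<Rightarrow> 'b::{banach, second_countable_topology}"
  assumes f: "integrable lborel f" and k: "k \<noteq> 0"
  shows "integrable lborel (\<lambda>x. f (t + k *\<^sub>R x))"
    and "(\<integral>x. f x \<partial>lborel) = (\<bar>k\<bar> ^ DIM('a)) *\<^sub>R (\<integral>x. f (t + k *\<^sub>R x) \<partial>lborel)"
proof -
  have [measurable]: "f \<in> borel_measurable borel"
    using f borel_measurable_integrable by fastforce
  have i: "integrable (density (distr lborel borel (\<lambda>x. t + k *\<^sub>R x)) (\<lambda>_. \<bar>k\<bar> ^ DIM('a))) f"
    using f lborel_affine[OF k, of t] by simp
  then have "integrable lborel (\<lambda>x. (\<bar>k\<bar> ^ DIM('a)) *\<^sub>R f (t + k *\<^sub>R x))"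
    by (subst (asm) integrable_density) (auto simp: integrable_distr_eq)
  from integrable_scaleR_right[OF this, of "inverse (\<bar>k\<bar> ^ DIM('a))"]
  show "integrable lborel (\<lambda>x. f (t + k *\<^sub>R x))" using k by simp
  show "(\<integral>x. f x \<partial>lborel) = (\<bar>k\<bar> ^ DIM('a)) *\<^sub>R (\<integral>x. f (t + k *\<^sub>R x) \<partial>lborel)"
    by (subst lborel_affine[OF k, of t]) (simp add: integral_density integral_distr)
qed

text \<open>Comparing the integral of \<open>exp (- V)\<close> with its image under dilations about \<open>c\<close> and
  using \<open>exp u \<ge> 1 + u\<close> gives a function of the dilation factor with a maximum at 1; its critical
  point equation is an integration by parts that needs no boundary terms.\<close>

lemma dilation_identity:
  fixes V :: "'a::euclidean_space \<Rightarrow> real" and G :: "'a \<Rightarrow> 'a"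
  assumes up: "\<And>y h. V (y + h) \<le> V y + G y \<bullet> h + B / 2 * (norm h)\<^sup>2"
    and int: "integrable lborel (\<lambda>y. exp (- V y))"
      "integrable lborel (\<lambda>y. exp (- V y) * (G y \<bullet> (y - c)))"
      "integrable lborel (\<lambda>y. exp (- V y) * (norm (y - c))\<^sup>2)"
  shows "(\<integral>y. exp (- V y) * (G y \<bullet> (y - c)) \<partial>lborel) = DIM('a) * (\<integral>y. exp (- V y) \<partial>lborel)"
proof -
  let ?n = "DIM('a)"
  define Z where "Z = (\<integral>y. exp (- V y) \<partial>lborel)"
  define J where "J = (\<integral>y. exp (- V y) * (G y \<bullet> (y - c)) \<partial>lborel)"
  define Q where "Q = (\<integral>y. exp (- V y) * (norm (y - c))\<^sup>2 \<partial>lborel)"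
  \<comment> \<open>The power is the Jacobian of the dilation about \<open>c\<close> by the factor
    \<open>1 + e\<close>, and the bracket is a lower bound for the dilated integral. The product is
    therefore at most \<open>Z\<close>, its value at \<open>e = 0\<close>; the quadratic term does
    not affect the derivative there.\<close>
  define f where "f e = (1 + e) ^ ?n * (Z - e * J - B / 2 * e\<^sup>2 * Q)" for e
  have "f e \<le> f 0" if e: "\<bar>0 - e\<bar> < 1" for e
  proof -
    have ptw: "exp (- V y) - e * (exp (- V y) * (G y \<bullet> (y - c))) - B / 2 * e\<^sup>2 * (exp (- V y) * (norm (y - c))\<^sup>2)
        \<le> exp (- V (- (e *\<^sub>R c) + (1 + e) *\<^sub>R y))" for y
    proof -
      define u where "u = e * (G y \<bullet> (y - c)) + B / 2 * e\<^sup>2 * (norm (y - c))\<^sup>2"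
      have "V (y + e *\<^sub>R (y - c)) \<le> V y + u"
        using up[of y "e *\<^sub>R (y - c)"] by (simp add: u_def power_mult_distrib mult.assoc)
      moreover have "- (e *\<^sub>R c) + (1 + e) *\<^sub>R y = y + e *\<^sub>R (y - c)" by (simp add: algebra_simps)
      ultimately have "exp (- V y) * exp (- u) \<le> exp (- V (- (e *\<^sub>R c) + (1 + e) *\<^sub>R y))"
        by (simp flip: exp_add)
      moreover have "exp (- V y) * (1 - u) \<le> exp (- V y) * exp (- u)"
        using exp_ge_add_one_self[of "- u"] by (intro mult_left_mono) auto
      ultimately show ?thesis by (simp add: u_def algebra_simps)
    qed
    have k: "1 + e \<noteq> 0" using e by auto
    note aff = lborel_integral_affine[OF int(1) k, of "- (e *\<^sub>R c)"]
    have "Z - e * J - B / 2 * e\<^sup>2 * Q = (\<integral>y. exp (- V y) - e * (exp (- V y) * (G y \<bullet> (y - c)))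
        - B / 2 * e\<^sup>2 * (exp (- V y) * (norm (y - c))\<^sup>2) \<partial>lborel)"
      using int by (simp add: Z_def J_def Q_def)
    also have "\<dots> \<le> (\<integral>y. exp (- V (- (e *\<^sub>R c) + (1 + e) *\<^sub>R y)) \<partial>lborel)"
      by (rule integral_mono)
        (intro Bochner_Integration.integrable_diff integrable_mult_right int aff(1) ptw)+
    finally have "(1 + e) ^ ?n * (Z - e * J - B / 2 * e\<^sup>2 * Q)
       \<le> (1 + e) ^ ?n * (\<integral>y. exp (- V (- (e *\<^sub>R c) + (1 + e) *\<^sub>R y)) \<partial>lborel)"
      using e by (intro mult_left_mono) auto
    also have "\<dots> = Z" unfolding Z_def using aff(2) e by simp
    finally show ?thesis by (simp add: f_def)
  qed
  moreover have "(f has_real_derivative ?n * Z - J) (at 0)"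
    unfolding f_def by (auto intro!: derivative_eq_intros)
  ultimately have "?n * Z - J = 0"
    by (intro DERIV_local_max[of f _ 0 1]) auto
  then show ?thesis by (simp add: J_def Z_def)
qed

text \<open>Two-sided Hessian bounds in integrated form. In this form adding a quadratic function
  simply shifts both constants, and the inequalities can be used without returning to second
  derivatives.\<close>

definition quad_bounds :: "real \<Rightarrow> real \<Rightarrow> ('a::real_inner \<Rightarrow> real) \<Rightarrow> ('a \<Rightarrow> 'a) \<Rightarrow> bool" where
  "quad_bounds \<kappa> \<beta> U G \<longleftrightarrow> (\<forall>y h. U y + G y \<bullet> h + \<kappa> / 2 * (norm h)\<^sup>2 \<le> U (y + h) \<and>
      U (y + h) \<le> U y + G y \<bullet> h + \<beta> / 2 * (norm h)\<^sup>2)"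

lemma quad_bounds_monotone:
  assumes "quad_bounds \<kappa> \<beta> U G"
  shows "\<kappa> * (norm (y - z))\<^sup>2 \<le> (G y - G z) \<bullet> (y - z)"
proof -
  have "U y + G y \<bullet> (z - y) + \<kappa> / 2 * (norm (z - y))\<^sup>2 \<le> U (y + (z - y))"
    "U z + G z \<bullet> (y - z) + \<kappa> / 2 * (norm (y - z))\<^sup>2 \<le> U (z + (y - z))"
    using assms unfolding quad_bounds_def by blast+
  then show ?thesis by (simp add: norm_minus_commute inner_diff algebra_simps)
qed

text \<open>The Baillon-Haddad argument. It avoids the symmetry of the Hessian, on which a bound of
  its operator norm by its quadratic form would rest.\<close>

lemma convex_smooth_gradient_lipschitz:
  assumes W: "quad_bounds 0 B W G" and B: "B > 0"
  shows "B-lipschitz_on UNIV G"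
proof (rule lipschitz_onI)
  have coco: "W x + G x \<bullet> (y - x) + (norm (G y - G x))\<^sup>2 / (2 * B) \<le> W y" for x y
  proof -
    define g where "g = G y - G x"
    have lo: "W u + G u \<bullet> h \<le> W (u + h)" and up: "W (u + h) \<le> W u + G u \<bullet> h + B / 2 * (norm h)\<^sup>2" for u h
      using W unfolding quad_bounds_def by auto
    \<comment> \<open>The function \<open>W - G x \<bullet> _\<close> is convex with its minimum at
      \<open>x\<close> and gradient \<open>g\<close> at \<open>y\<close>. The point \<open>z\<close>
      is one gradient step from \<open>y\<close> of size \<open>1 / B\<close>, the minimizer of the
      quadratic upper bound at \<open>y\<close>.\<close>
    define z where "z = y - (1 / B) *\<^sub>R g"
    have "W x + G x \<bullet> (z - x) \<le> W z" using lo[of x "z - x"] by simp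
    moreover have "G x \<bullet> (z - x) = G x \<bullet> (y - x) - G x \<bullet> g / B"
      by (simp add: z_def inner_diff_right)
    moreover have "W z \<le> W y + G y \<bullet> (- ((1 / B) *\<^sub>R g)) + B / 2 * (norm (- ((1 / B) *\<^sub>R g)))\<^sup>2"
      using up[of y "- ((1 / B) *\<^sub>R g)"] by (simp only: z_def diff_conv_add_uminus)
    moreover have "G y \<bullet> (- ((1 / B) *\<^sub>R g)) = - (G y \<bullet> g / B)" by simp
    moreover have "B / 2 * (norm (- ((1 / B) *\<^sub>R g)))\<^sup>2 = (norm g)\<^sup>2 / (2 * B)"
      using B by (simp add: power_mult_distrib power2_eq_square)
    moreover have "G y \<bullet> g / B - G x \<bullet> g / B = (norm g)\<^sup>2 / B"
      unfolding diff_divide_distrib[symmetric] inner_diff_left[symmetric] g_def[symmetric]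
      by (simp add: power2_norm_eq_inner)
    moreover have "(norm g)\<^sup>2 / B = (norm g)\<^sup>2 / (2 * B) + (norm g)\<^sup>2 / (2 * B)" by simp
    ultimately have "W x + G x \<bullet> (y - x) + (norm g)\<^sup>2 / (2 * B) \<le> W y"
      by linarith
    then show ?thesis by (simp only: g_def)
  qed
  fix x y
  have "(norm (G x - G y))\<^sup>2 / B \<le> (G x - G y) \<bullet> (x - y)"
  proof -
    have "(G x - G y) \<bullet> (x - y) = - (G x \<bullet> (y - x)) - G y \<bullet> (x - y)" by (simp add: inner_diff)
    moreover have "(norm (G x - G y))\<^sup>2 / B = (norm (G y - G x))\<^sup>2 / (2 * B) + (norm (G x - G y))\<^sup>2 / (2 * B)"
      by (simp add: norm_minus_commute[of "G y"])
    ultimately show ?thesis using coco[of x y] coco[of y x] by linarith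
  qed
  also have "\<dots> \<le> norm (G x - G y) * norm (x - y)" by (rule norm_cauchy_schwarz)
  finally have "norm (G x - G y) * norm (G x - G y) \<le> norm (G x - G y) * (B * norm (x - y))"
    using B by (simp add: field_simps power2_eq_square)
  then show "dist (G x) (G y) \<le> B * dist x y"
    using B by (cases "G x = G y") (auto simp: dist_norm)
qed (use B in simp)

text \<open>Subtracting \<open>\<kappa> / 2 * (norm y)\<^sup>2\<close> makes the potential convex,
  whatever the sign of \<open>\<kappa>\<close>, and reduces to the convex case; the linear map that
  was subtracted from the gradient is added back afterwards.\<close>

lemma quad_bounds_lipschitz:
  fixes U :: "'a::real_inner \<Rightarrow> real"
  assumes "quad_bounds \<kappa> \<beta> U G"
  obtains l where "l-lipschitz_on UNIV G"
proof -
  \<comment> \<open>The maximum keeps \<open>B\<close> positive even if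
    \<open>\<beta> = \<kappa>\<close>, since the convex case divides by \<open>B\<close>.\<close>
  define B where "B = max 1 (\<beta> - \<kappa>)"
  have "quad_bounds 0 B (\<lambda>y. U y - \<kappa> / 2 * (norm y)\<^sup>2) (\<lambda>y. G y - \<kappa> *\<^sub>R y)"
    unfolding quad_bounds_def
  proof (intro allI conjI)
    fix y h
    have U: "U y + G y \<bullet> h + \<kappa> / 2 * (norm h)\<^sup>2 \<le> U (y + h)"
      "U (y + h) \<le> U y + G y \<bullet> h + \<beta> / 2 * (norm h)\<^sup>2"
      using assms unfolding quad_bounds_def by auto
    have n: "\<kappa> / 2 * (norm (y + h))\<^sup>2 = \<kappa> / 2 * (norm y)\<^sup>2 + \<kappa> * (y \<bullet> h) + \<kappa> / 2 * (norm h)\<^sup>2"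
      by (simp add: power2_norm_eq_inner inner_add inner_commute field_simps)
    show "U y - \<kappa> / 2 * (norm y)\<^sup>2 + (G y - \<kappa> *\<^sub>R y) \<bullet> h + 0 / 2 * (norm h)\<^sup>2
        \<le> U (y + h) - \<kappa> / 2 * (norm (y + h))\<^sup>2"
      unfolding n using U by (simp add: inner_diff_left)
    have "\<beta> / 2 * (norm h)\<^sup>2 \<le> B / 2 * (norm h)\<^sup>2 + \<kappa> / 2 * (norm h)\<^sup>2"
      unfolding distrib_right[symmetric] by (rule mult_right_mono) (auto simp: B_def)
    then show "U (y + h) - \<kappa> / 2 * (norm (y + h))\<^sup>2
        \<le> U y - \<kappa> / 2 * (norm y)\<^sup>2 + (G y - \<kappa> *\<^sub>R y) \<bullet> h + B / 2 * (norm h)\<^sup>2"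
      unfolding n using U by (simp add: inner_diff_left)
  qed
  from convex_smooth_gradient_lipschitz[OF this]
  have "B-lipschitz_on UNIV (\<lambda>y. G y - \<kappa> *\<^sub>R y)" by (simp add: B_def)
  moreover have "\<bar>\<kappa>\<bar>-lipschitz_on UNIV (\<lambda>y::'a. \<kappa> *\<^sub>R y)"
    by (rule lipschitz_onI) (simp_all add: dist_norm flip: scaleR_diff_right)
  ultimately have "(B + \<bar>\<kappa>\<bar>)-lipschitz_on UNIV (\<lambda>y. (G y - \<kappa> *\<^sub>R y) + \<kappa> *\<^sub>R y)"
    by (rule lipschitz_on_add)
  then show thesis by (intro that) simp
qed

lemma second_order_upper:
  fixes f :: "real \<Rightarrow> real"
  assumes f: "\<And>s. (f has_real_derivative f' s) (at s)"
    and f': "\<And>s. (f' has_real_derivative f'' s) (at s)" and le: "\<And>s. f'' s \<le> c"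
  shows "f 1 \<le> f 0 + f' 0 + c / 2"
proof -
  define g where "g s = c / 2 * s\<^sup>2 + s * f' 0 - f s" for s
  define g' where "g' s = c * s + f' 0 - f' s" for s
  have d: "(g has_real_derivative g' s) (at s)" for s
    unfolding g_def g'_def using f by (auto intro!: derivative_eq_intros)
  have d': "(g' has_real_derivative c - f'' s) (at s)" for s
    unfolding g'_def using f' by (auto intro!: derivative_eq_intros)
  have g'_nn: "0 \<le> g' s" if "0 \<le> s" for s
  proof -
    have "g' 0 \<le> g' s"
      by (rule DERIV_nonneg_imp_nondecreasing[OF that]) (use d' le in \<open>force\<close>)
    then show ?thesis by (simp add: g'_def)
  qed
  have "g 0 \<le> g 1"
    by (rule DERIV_nonneg_imp_nondecreasing) (use d g'_nn in auto)
  then show ?thesis by (simp add: g_def)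
qed

text \<open>Along a segment the second derivative of \<open>U\<close> is the quadratic form of the
  Hessian in the direction \<open>h\<close>, exactly what the Loewner order bounds. The lower half
  is the upper half for \<open>- U\<close>.\<close>

lemma quad_bounds_from_hessian:
  fixes U :: "real ^ 'n \<Rightarrow> real"
  assumes U: "\<And>x. (U has_derivative (\<lambda>h. G x \<bullet> h)) (at x)"
    and G: "\<And>x. (G has_derivative (\<lambda>h. H x *v h)) (at x)"
    and H: "\<And>x. loewner_le (mat \<kappa>) (H x)" "\<And>x. loewner_le (H x) (mat \<beta>)"
  shows "quad_bounds \<kappa> \<beta> U G"
  unfolding quad_bounds_def
proof (intro allI)
  fix y h :: "real ^ 'n"
  have line: "((\<lambda>s. y + s *\<^sub>R h) has_derivative (\<lambda>r. r *\<^sub>R h)) (at s)" for s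
    by (auto intro!: derivative_eq_intros)
  have f: "((\<lambda>s. U (y + s *\<^sub>R h)) has_real_derivative G (y + s *\<^sub>R h) \<bullet> h) (at s)" for s
    unfolding has_field_derivative_def using has_derivative_compose[OF line U]
    by (rule has_derivative_eq_rhs) (auto simp: fun_eq_iff)
  have f': "((\<lambda>s. G (y + s *\<^sub>R h) \<bullet> h) has_real_derivative h \<bullet> (H (y + s *\<^sub>R h) *v h)) (at s)" for s
    unfolding has_field_derivative_def
    using has_derivative_inner_left[OF has_derivative_compose[OF line G], of h s]
    by (rule has_derivative_eq_rhs) (auto simp: fun_eq_iff matrix_vector_mult_scaleR inner_commute)
  have "(mat c :: real^'n^'n) *v h = c *\<^sub>R h" for c
    by (simp add: vec_eq_iff matrix_vector_mult_def mat_def if_distrib if_distribR cong: if_cong)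
  then have m: "h \<bullet> ((mat c :: real^'n^'n) *v h) = c * (norm h)\<^sup>2" for c
    by (simp add: power2_norm_eq_inner)
  have "U (y + h) \<le> U y + G y \<bullet> h + \<beta> * (norm h)\<^sup>2 / 2"
    using second_order_upper[OF f f', of "\<beta> * (norm h)\<^sup>2"] H(2) by (simp add: loewner_le_def m[symmetric])
  moreover have "- U (y + h) \<le> - U y + - (G y \<bullet> h) + (- (\<kappa> * (norm h)\<^sup>2)) / 2"
    using second_order_upper[OF DERIV_minus[OF f] DERIV_minus[OF f'], of "- (\<kappa> * (norm h)\<^sup>2)"] H(1)
    by (simp add: loewner_le_def m[symmetric])
  ultimately show "U y + G y \<bullet> h + \<kappa> / 2 * (norm h)\<^sup>2 \<le> U (y + h) \<and>
      U (y + h) \<le> U y + G y \<bullet> h + \<beta> / 2 * (norm h)\<^sup>2"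
    by simp
qed

section \<open>Posterior of a target with density \<open>exp (- U)\<close>: gradient identity and
  variance bounds\<close>

locale potential_posterior = posterior M q b for M :: "'a::euclidean_space measure" and q b +
  fixes U :: "'a \<Rightarrow> real" and G :: "'a \<Rightarrow> 'a" and \<kappa> \<beta> l :: real
  assumes M_eq: "M = density lborel (\<lambda>y. ennreal (exp (- U y)))"
    and U_bounds: "quad_bounds \<kappa> \<beta> U G"
    and G_lip: "l-lipschitz_on UNIV G"
    and U_meas [measurable]: "U \<in> borel_measurable borel"
begin

lemma G_meas [measurable]: "G \<in> borel_measurable borel"
  by (rule lipschitz_measurable[OF G_lip])

lemma post_eq_lborel:
  fixes f :: "'a \<Rightarrow> real"
  assumes meas [measurable]: "f \<in> borel_measurable borel"
  shows "integrable (post x) f \<longleftrightarrow> integrable lborel (\<lambda>y. exp (- (U y + (norm (x - b *\<^sub>R y))\<^sup>2 / (2 * q))) * f y)"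
    and "integral\<^sup>L (post x) f = (\<integral>y. exp (- (U y + (norm (x - b *\<^sub>R y))\<^sup>2 / (2 * q))) * f y \<partial>lborel) / mass x"
proof -
  have e: "exp (- U y) *\<^sub>R ((kern x y / mass x) *\<^sub>R f y) =
      exp (- (U y + (norm (x - b *\<^sub>R y))\<^sup>2 / (2 * q))) * f y / mass x" for y
    by (simp add: kern_def exp_diff exp_minus field_simps)
  have M: "integrable M g \<longleftrightarrow> integrable lborel (\<lambda>y. exp (- U y) *\<^sub>R g y)"
    "integral\<^sup>L M g = (\<integral>y. exp (- U y) *\<^sub>R g y \<partial>lborel)"
    if [measurable]: "g \<in> borel_measurable borel" for g :: "'a \<Rightarrow> real"
    unfolding M_eq by (simp_all add: integrable_density integral_density)
  show "integrable (post x) f \<longleftrightarrow> integrable lborel (\<lambda>y. exp (- (U y + (norm (x - b *\<^sub>R y))\<^sup>2 / (2 * q))) * f y)"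
    unfolding integrable_post_iff[OF meas] by (subst M, measurable, unfold e, unfold divide_inverse[of _ "mass x"], simp)
  show "integral\<^sup>L (post x) f = (\<integral>y. exp (- (U y + (norm (x - b *\<^sub>R y))\<^sup>2 / (2 * q))) * f y \<partial>lborel) / mass x"
    unfolding integral_post[OF meas] by (subst M, measurable, unfold e, simp)
qed

lemma integrable_lipschitz_prod:
  assumes F: "k-lipschitz_on UNIV F"
  shows "integrable (post x) (\<lambda>y. F y \<bullet> (y - c))"
proof (rule Bochner_Integration.integrable_bound)
  have [measurable]: "F \<in> borel_measurable borel" by (rule lipschitz_measurable[OF F])
  show "(\<lambda>y. F y \<bullet> (y - c)) \<in> borel_measurable (post x)" by measurable
  show "integrable (post x) (\<lambda>y. (norm (F 0) + k * norm c + (1 + k)) * (1 + (norm (y - c))\<^sup>2))"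
    using integrable_sq_diff_post[of x c] prob_space_post[of x]
    by (auto intro!: integrable_mult_right Bochner_Integration.integrable_add simp: prob_space.finite_measure finite_measure.integrable_const)
  show "AE y in post x. norm (F y \<bullet> (y - c)) \<le> norm ((norm (F 0) + k * norm c + (1 + k)) * (1 + (norm (y - c))\<^sup>2))"
  proof (rule AE_I2)
    fix y
    define r where "r = norm (y - c)"
    have k0: "0 \<le> k" by (rule lipschitz_on_nonneg[OF F])
    have r: "0 \<le> r" "r \<le> 1 + r\<^sup>2" using lin_le_quad by (auto simp: r_def)
    have "norm (F y) \<le> norm (F 0) + k * norm y"
      using lipschitz_onD[OF F, of y 0] norm_triangle_sub[of "F y" "F 0"] by (simp add: dist_norm)
    moreover have "k * norm y \<le> k * (norm c + r)"
      using norm_triangle_sub[of y c] k0 by (intro mult_left_mono) (auto simp: r_def)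
    ultimately have Fy: "norm (F y) \<le> (norm (F 0) + k * norm c) + k * r" by (simp add: algebra_simps)
    have "norm (F y \<bullet> (y - c)) \<le> norm (F y) * r"
      using Cauchy_Schwarz_ineq2[of "F y" "y - c"] by (simp add: r_def)
    also have "\<dots> \<le> ((norm (F 0) + k * norm c) + k * r) * r" using Fy r by (intro mult_right_mono) auto
    also have "\<dots> = (norm (F 0) + k * norm c) * r + k * r\<^sup>2" by (simp add: power2_eq_square algebra_simps)
    also have "\<dots> \<le> (norm (F 0) + k * norm c) * (1 + r\<^sup>2) + (1 + k) * (1 + r\<^sup>2)"
      using r k0 by (intro add_mono mult_left_mono mult_mono) auto
    also have "\<dots> = (norm (F 0) + k * norm c + (1 + k)) * (1 + r\<^sup>2)" by (simp add: algebra_simps)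
    finally show "norm (F y \<bullet> (y - c)) \<le> norm ((norm (F 0) + k * norm c + (1 + k)) * (1 + (norm (y - c))\<^sup>2))"
      by (simp add: r_def)
  qed
qed

text \<open>The gradient in \<open>y\<close> of the negative log-density of \<open>post x\<close>,
  that is, of \<open>U y + (norm (x - b *\<^sub>R y))\<^sup>2 / (2 * q)\<close>.\<close>

definition G_post :: "'a \<Rightarrow> 'a \<Rightarrow> 'a" where
  "G_post x y = G y - (b / q) *\<^sub>R (x - b *\<^sub>R y)"

text \<open>The likelihood contributes an exact quadratic in \<open>y\<close> with Hessian
  \<open>b\<^sup>2 / q\<close> times the identity. This added convexity is what makes the posterior
  concentrate near time 1.\<close>

lemma quad_bounds_post:
  "quad_bounds (\<kappa> + b\<^sup>2 / q) (\<beta> + b\<^sup>2 / q) (\<lambda>y. U y + (norm (x - b *\<^sub>R y))\<^sup>2 / (2 * q)) (G_post x)"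
proof -
  have n: "(norm (x - b *\<^sub>R (y + h)))\<^sup>2 / (2 * q) =
      (norm (x - b *\<^sub>R y))\<^sup>2 / (2 * q) - ((b / q) *\<^sub>R (x - b *\<^sub>R y)) \<bullet> h + b\<^sup>2 / q / 2 * (norm h)\<^sup>2" for y h
  proof -
    have "(norm (x - b *\<^sub>R (y + h)))\<^sup>2 = (norm ((x - b *\<^sub>R y) - b *\<^sub>R h))\<^sup>2" by (simp add: algebra_simps)
    also have "\<dots> = (norm (x - b *\<^sub>R y))\<^sup>2 - 2 * b * ((x - b *\<^sub>R y) \<bullet> h) + b\<^sup>2 * (norm h)\<^sup>2"
      unfolding power2_norm_eq_inner inner_diff_left[of _ _ "_ - _"] inner_diff_right[of "x - b *\<^sub>R y"] inner_diff_right[of "b *\<^sub>R h"]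
      by (simp add: inner_commute power2_eq_square inner_diff algebra_simps)
    finally have "(norm (x - b *\<^sub>R (y + h)))\<^sup>2 / (2 * q) =
        ((norm (x - b *\<^sub>R y))\<^sup>2 - 2 * b * ((x - b *\<^sub>R y) \<bullet> h) + b\<^sup>2 * (norm h)\<^sup>2) / (2 * q)" by simp
    also have "\<dots> = (norm (x - b *\<^sub>R y))\<^sup>2 / (2 * q) - b / q * ((x - b *\<^sub>R y) \<bullet> h) + b\<^sup>2 / q / 2 * (norm h)\<^sup>2"
      using q_pos by (simp add: add_divide_distrib diff_divide_distrib)
    finally show ?thesis by simp
  qed
  show ?thesis
    using U_bounds unfolding quad_bounds_def n G_post_def
    by (simp add: inner_diff_left add_divide_distrib distrib_right add.assoc)
qed

lemma G_post_lipschitz: "(l + b / q * b)-lipschitz_on UNIV (G_post x)"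
proof (rule lipschitz_onI)
  fix y z
  have "G_post x y - G_post x z = (G y - G z) + (b / q * b) *\<^sub>R (y - z)"
    by (simp add: G_post_def algebra_simps)
  then have "norm (G_post x y - G_post x z) \<le> norm (G y - G z) + (b / q * b) * norm (y - z)"
    using norm_triangle_ineq[of "G y - G z" "(b / q * b) *\<^sub>R (y - z)"] b_pos q_pos by simp
  then show "dist (G_post x y) (G_post x z) \<le> (l + b / q * b) * dist y z"
    using lipschitz_onD[OF G_lip, of y z] by (simp add: dist_norm algebra_simps)
qed (use lipschitz_on_nonneg[OF G_lip] b_pos q_pos in simp)

text \<open>This is \<open>dilation_identity\<close> for the posterior potential, divided by
  \<open>mass x\<close>. That the centre \<open>c\<close> is arbitrary is essential: the right side
  does not depend on it.\<close>

lemma post_dilation: "(\<integral>y. G_post x y \<bullet> (y - c) \<partial>post x) = DIM('a)"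
proof -
  interpret P: prob_space "post x" by (rule prob_space_post)
  have [measurable]: "G_post x \<in> borel_measurable borel"
    by (rule lipschitz_measurable[OF G_post_lipschitz])
  let ?V = "\<lambda>y. U y + (norm (x - b *\<^sub>R y))\<^sup>2 / (2 * q)"
  have one: "integrable (post x) (\<lambda>_. 1::real)" by simp
  have "(\<integral>y. exp (- ?V y) * (G_post x y \<bullet> (y - c)) \<partial>lborel) = DIM('a) * (\<integral>y. exp (- ?V y) \<partial>lborel)"
  proof (rule dilation_identity)
    show "?V (y + h) \<le> ?V y + G_post x y \<bullet> h + (\<beta> + b\<^sup>2 / q) / 2 * (norm h)\<^sup>2" for y h
      using quad_bounds_post[of x] unfolding quad_bounds_def by blast
    show "integrable lborel (\<lambda>y. exp (- ?V y))"
      using one by (subst (asm) post_eq_lborel) auto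
    show "integrable lborel (\<lambda>y. exp (- ?V y) * (G_post x y \<bullet> (y - c)))"
      using integrable_lipschitz_prod[OF G_post_lipschitz, of x x c] by (subst (asm) post_eq_lborel) auto
    show "integrable lborel (\<lambda>y. exp (- ?V y) * (norm (y - c))\<^sup>2)"
      using integrable_sq_diff_post[of x c] by (subst (asm) post_eq_lborel) auto
  qed
  moreover have "(\<integral>y. exp (- ?V y) \<partial>lborel) / mass x = (\<integral>y. 1 \<partial>post x)"
    by (subst post_eq_lborel) auto
  then have "(\<integral>y. exp (- ?V y) \<partial>lborel) / mass x = 1"
    by (simp only: Bochner_Integration.lebesgue_integral_const P.prob_space) simp
  then have "(\<integral>y. exp (- ?V y) \<partial>lborel) = mass x"
    by (metis divide_eq_1_iff)
  ultimately show ?thesis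
    by (subst post_eq_lborel) auto
qed

text \<open>Subtracting \<open>post_dilation\<close> for two centres shows that the posterior mean
  of \<open>G_post x\<close> is orthogonal to their difference. Taking that mean itself,
  \<open>w\<close>, as the difference gives \<open>w \<bullet> w = 0\<close>; spelling out
  \<open>G_post\<close> then relates the mean of \<open>G\<close> to the residual of the
  observation.\<close>

lemma integral_G_post: "(\<integral>y. G y \<partial>post x) = (b / q) *\<^sub>R (x - b *\<^sub>R mean x)"
proof -
  interpret P: prob_space "post x" by (rule prob_space_post)
  define w where "w = (\<integral>y. G_post x y \<partial>post x)"
  note i = integrable_lipschitz_post[OF G_post_lipschitz, of x x]
  have "0 = (\<integral>y. G_post x y \<bullet> (y - 0) \<partial>post x) - (\<integral>y. G_post x y \<bullet> (y - w) \<partial>post x)"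
    unfolding post_dilation by simp
  also have "\<dots> = (\<integral>y. G_post x y \<bullet> (y - 0) - G_post x y \<bullet> (y - w) \<partial>post x)"
    by (rule Bochner_Integration.integral_diff[symmetric]) (rule integrable_lipschitz_prod[OF G_post_lipschitz])+
  also have "\<dots> = (\<integral>y. G_post x y \<bullet> w \<partial>post x)"
    by (simp add: inner_diff_right)
  also have "\<dots> = w \<bullet> w" using i by (simp add: w_def)
  finally have "w = 0" by simp
  then show ?thesis
    unfolding w_def G_post_def using integrable_lipschitz_post[OF G_lip, of x] integrable_id_post[of x]
    by (simp add: P.prob_space flip: mean_def)
qed

text \<open>Strong monotonicity of \<open>G_post x\<close>, applied at \<open>y\<close> and the
  posterior mean and integrated, is bounded by the dilation identity. The value of
  \<open>G_post x\<close> at the mean drops out because \<open>y - mean x\<close> has integral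
  0.\<close>

lemma var_le_of_convex:
  assumes K: "\<kappa> + b\<^sup>2 / q > 0"
  shows "var x \<le> DIM('a) / (\<kappa> + b\<^sup>2 / q)"
proof -
  interpret P: prob_space "post x" by (rule prob_space_post)
  let ?K = "\<kappa> + b\<^sup>2 / q" and ?m = "mean x"
  have "?K * var x = (\<integral>y. ?K * (norm (y - ?m))\<^sup>2 \<partial>post x)" by (simp add: var_def)
  also have "\<dots> \<le> (\<integral>y. G_post x y \<bullet> (y - ?m) - G_post x ?m \<bullet> (y - ?m) \<partial>post x)"
  proof (rule integral_mono)
    show "integrable (post x) (\<lambda>y. ?K * (norm (y - ?m))\<^sup>2)"
      using integrable_sq_diff_post by simp
    show "integrable (post x) (\<lambda>y. G_post x y \<bullet> (y - ?m) - G_post x ?m \<bullet> (y - ?m))"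
      using integrable_lipschitz_prod[OF G_post_lipschitz, of x x] integrable_id_post[of x] by simp
    show "?K * (norm (y - ?m))\<^sup>2 \<le> G_post x y \<bullet> (y - ?m) - G_post x ?m \<bullet> (y - ?m)" for y
      using quad_bounds_monotone[OF quad_bounds_post, of y ?m x] by (simp add: inner_diff_left)
  qed
  also have "\<dots> = DIM('a) - G_post x ?m \<bullet> (\<integral>y. y - ?m \<partial>post x)"
    using integrable_lipschitz_prod[OF G_post_lipschitz, of x x] integrable_id_post[of x]
    by (simp add: post_dilation)
  also have "(\<integral>y. y - ?m \<partial>post x) = 0"
    using integrable_id_post[of x] by (simp add: P.prob_space flip: mean_def)
  finally show ?thesis using K by (simp add: field_simps)
qed

text \<open>The gradient of the standard Gaussian potential is the identity, so \<open>L\<close>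
  bounds the deviation of \<open>G\<close> from the Gaussian case. The posterior gradient is thus
  within \<open>L\<close> of \<open>K *\<^sub>R (y - c)\<close>, and the dilation identity centred
  at \<open>c\<close> together with Young's inequality bounds the second moment about
  \<open>c\<close>.\<close>

lemma var_le_of_log_lipschitz:
  fixes L :: real
  assumes L: "\<And>y. norm (G y - y) \<le> L"
  shows "var x \<le> 2 * DIM('a) + L\<^sup>2"
proof -
  interpret P: prob_space "post x" by (rule prob_space_post)
  define K where "K = 1 + b\<^sup>2 / q"
  have K1: "K \<ge> 1" using q_pos by (simp add: K_def)
  \<comment> \<open>The posterior mean if the target were the standard Gaussian. Only
    \<open>K \<ge> 1\<close> is used of the precision \<open>K\<close>, so the bound depends on
    neither \<open>b\<close> nor \<open>q\<close>.\<close>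
  define c where "c = (b / q / K) *\<^sub>R x"
  have G_post: "G_post x y = K *\<^sub>R (y - c) + (G y - y)" for y
  proof -
    have "K *\<^sub>R c = (b / q) *\<^sub>R x" using K1 by (simp add: c_def)
    then show ?thesis
      by (simp add: G_post_def scaleR_diff_right) (simp add: K_def algebra_simps power2_eq_square)
  qed
  have "(\<integral>y. (norm (y - c))\<^sup>2 / 2 - L\<^sup>2 / 2 \<partial>post x) \<le> (\<integral>y. G_post x y \<bullet> (y - c) \<partial>post x)"
  proof (rule integral_mono)
    show "integrable (post x) (\<lambda>y. (norm (y - c))\<^sup>2 / 2 - L\<^sup>2 / 2)"
      using integrable_sq_diff_post[of x c] by simp
    show "integrable (post x) (\<lambda>y. G_post x y \<bullet> (y - c))"
      by (rule integrable_lipschitz_prod[OF G_post_lipschitz])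
    fix y
    define r where "r = norm (y - c)"
    have "\<bar>(G y - y) \<bullet> (y - c)\<bar> \<le> L * r"
      using Cauchy_Schwarz_ineq2[of "G y - y" "y - c"] mult_right_mono[OF L[of y], of r] by (simp add: r_def)
    moreover have "L * r \<le> L\<^sup>2 / 2 + r\<^sup>2 / 2"
    proof -
      have "0 \<le> (L - r)\<^sup>2" by simp
      then show ?thesis by (simp add: power2_diff)
    qed
    moreover have "1 * r\<^sup>2 \<le> K * r\<^sup>2" using K1 by (intro mult_right_mono) auto
    moreover have "G_post x y \<bullet> (y - c) = K * r\<^sup>2 + (G y - y) \<bullet> (y - c)"
      unfolding G_post inner_add_left by (simp add: r_def power2_norm_eq_inner)
    ultimately show "(norm (y - c))\<^sup>2 / 2 - L\<^sup>2 / 2 \<le> G_post x y \<bullet> (y - c)"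
      unfolding r_def[symmetric] by linarith
  qed
  then have "(\<integral>y. (norm (y - c))\<^sup>2 \<partial>post x) / 2 - L\<^sup>2 / 2 \<le> DIM('a)"
    using integrable_sq_diff_post[of x c] by (simp add: post_dilation P.prob_space)
  then show ?thesis using var_le[of x c] by simp
qed

end

section \<open>Gaussian measures and the velocity field\<close>

lemma Basis_vec_real: "(Basis :: (real ^ 'n) set) = range (\<lambda>i. axis i 1)"
  by (auto simp: Basis_vec_def)

lemma prod_components_eq_prod_Basis:
  fixes x :: "real ^ 'n"
  shows "(\<Prod>i\<in>UNIV. f (x $ i)) = (\<Prod>b\<in>Basis. f (x \<bullet> b))"
proof -
  have "inj (\<lambda>i::'n. axis i (1::real))" by (auto simp: inj_on_def axis_eq_axis)
  then show ?thesis by (simp add: Basis_vec_real prod.reindex inner_axis)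
qed

definition gaussian_constant :: "real \<Rightarrow> nat \<Rightarrow> real" where
  "gaussian_constant \<sigma> n = (1 / sqrt (2 * pi * \<sigma>\<^sup>2)) ^ n"

lemma gaussian_constant_pos: "\<sigma> > 0 \<Longrightarrow> gaussian_constant \<sigma> n > 0"
  by (simp add: gaussian_constant_def)

lemma gaussian_density_eq:
  fixes x :: "real ^ 'n"
  shows "(\<Prod>i\<in>UNIV. normal_density 0 \<sigma> (x $ i)) =
    gaussian_constant \<sigma> CARD('n) * exp (- (norm x)\<^sup>2 / (2 * \<sigma>\<^sup>2))"
proof -
  have "(\<Prod>i\<in>UNIV. normal_density 0 \<sigma> (x $ i)) =
     gaussian_constant \<sigma> CARD('n) * exp (\<Sum>i\<in>UNIV. - (x $ i)\<^sup>2 / (2 * \<sigma>\<^sup>2))"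
    by (simp add: normal_density_def gaussian_constant_def prod.distrib exp_sum power_one_over prod_dividef)
  also have "(\<Sum>i\<in>UNIV. - (x $ i)\<^sup>2 / (2 * \<sigma>\<^sup>2)) = - (norm x)\<^sup>2 / (2 * \<sigma>\<^sup>2)"
    unfolding sum_divide_distrib[symmetric] sum_negf power2_norm_eq_inner inner_vec_def
    by (simp add: power2_eq_square)
  finally show ?thesis .
qed

lemma gaussian_eq:
  "(gaussian \<sigma> :: (real ^ 'n) measure) =
    density lborel (\<lambda>x. ennreal (gaussian_constant \<sigma> CARD('n) * exp (- (norm x)\<^sup>2 / (2 * \<sigma>\<^sup>2))))"
  unfolding gaussian_def gaussian_density_eq ..

lemma sets_gaussian [simp, measurable_cong]: "sets (gaussian \<sigma>) = sets borel"
  by (simp add: gaussian_def)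

lemma space_gaussian [simp]: "space (gaussian \<sigma>) = UNIV"
  by (simp add: gaussian_def)

lemma prob_space_gaussian:
  assumes "\<sigma> > 0"
  shows "prob_space (gaussian \<sigma> :: (real ^ 'n) measure)"
proof
  have "emeasure (gaussian \<sigma> :: (real ^ 'n) measure) (space (gaussian \<sigma>)) =
      (\<integral>\<^sup>+x. (\<Prod>b\<in>Basis. ennreal (normal_density 0 \<sigma> (x \<bullet> b))) \<partial>(lborel :: (real ^ 'n) measure))"
    unfolding gaussian_def by (simp add: emeasure_density prod_components_eq_prod_Basis prod_ennreal)
  also have "\<dots> = (\<Prod>b\<in>(Basis :: (real ^ 'n) set). (\<integral>\<^sup>+x. ennreal (normal_density 0 \<sigma> x) \<partial>lborel))"
    by (rule nn_integral_lborel_prod) auto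
  also have "(\<integral>\<^sup>+x. ennreal (normal_density 0 \<sigma> x) \<partial>lborel) = 1"
    using prob_space.emeasure_space_1[OF prob_space_normal_density[OF assms, of 0]]
    by (simp add: emeasure_density)
  finally show "emeasure (gaussian \<sigma> :: (real ^ 'n) measure) (space (gaussian \<sigma>)) = 1" by simp
qed

lemma integrable_exp_norm_sq:
  assumes "s > 0"
  shows "integrable lborel (\<lambda>x::real^'n. exp (- (norm x)\<^sup>2 / s))"
proof -
  define \<sigma> where "\<sigma> = sqrt (s / 2)"
  have \<sigma>: "\<sigma> > 0" "2 * \<sigma>\<^sup>2 = s" using assms by (auto simp: \<sigma>_def)
  interpret prob_space "gaussian \<sigma> :: (real ^ 'n) measure" by (rule prob_space_gaussian[OF \<sigma>(1)])
  have "integrable (gaussian \<sigma>) (\<lambda>x::real^'n. 1::real)" by simp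
  then have "integrable lborel (\<lambda>x::real^'n. gaussian_constant \<sigma> CARD('n) * exp (- (norm x)\<^sup>2 / s))"
    unfolding gaussian_eq \<sigma> using gaussian_constant_pos[OF \<sigma>(1), of "CARD('n)"]
    by (subst (asm) integrable_density) (auto intro!: AE_I2 mult_nonneg_nonneg)
  then show ?thesis using gaussian_constant_pos[OF \<sigma>(1), of "CARD('n)"] by simp
qed

lemma integrable_sq_exp_norm_sq:
  assumes s: "s > 0"
  shows "integrable lborel (\<lambda>x::real^'n. (norm x)\<^sup>2 * exp (- (norm x)\<^sup>2 / s))"
proof (rule Bochner_Integration.integrable_bound)
  show "integrable lborel (\<lambda>x::real^'n. 2 * s * exp (- (norm x)\<^sup>2 / (2 * s)))"
    using integrable_exp_norm_sq[of "2 * s"] s by simp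
  show "AE x in lborel. norm ((norm x)\<^sup>2 * exp (- (norm x)\<^sup>2 / s)) \<le> norm (2 * s * exp (- (norm (x::real^'n))\<^sup>2 / (2 * s)))"
  proof (rule AE_I2)
    fix x :: "real ^ 'n"
    define u where "u = (norm x)\<^sup>2 / (2 * s)"
    have "u * exp (- (2 * u)) \<le> exp u * exp (- (2 * u))"
      by (intro mult_right_mono) (use exp_ge_add_one_self[of u] in linarith, simp)
    also have "\<dots> = exp (- u)" by (simp flip: exp_add)
    finally have "2 * s * (u * exp (- (2 * u))) \<le> 2 * s * exp (- u)" using s by simp
    moreover have "(norm x)\<^sup>2 = 2 * s * u" "(norm x)\<^sup>2 / s = 2 * u" "0 \<le> u" using s by (auto simp: u_def)
    ultimately show "norm ((norm x)\<^sup>2 * exp (- (norm x)\<^sup>2 / s)) \<le> norm (2 * s * exp (- (norm x)\<^sup>2 / (2 * s)))"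
      using s by (simp add: u_def[symmetric] abs_mult)
  qed
qed auto

lemma gaussian_second_moment:
  assumes "\<sigma> > 0"
  shows "integrable (gaussian \<sigma>) (\<lambda>x::real^'n. (norm x)\<^sup>2)"
  unfolding gaussian_eq using gaussian_constant_pos[OF assms, of "CARD('n)"]
    integrable_mult_right[OF integrable_sq_exp_norm_sq[of "2 * \<sigma>\<^sup>2", where 'n='n], of "gaussian_constant \<sigma> CARD('n)"] assms
  by (subst integrable_density) (auto intro!: AE_I2 mult_nonneg_nonneg simp: mult_ac)

text \<open>The set of disagreement is open and null, hence empty. This turns almost-everywhere
  identities of regressions, potentials and densities into identities at every point.\<close>

lemma continuous_AE_lborel_eq:
  fixes f g :: "'a::euclidean_space \<Rightarrow> 'b::t2_space"
  assumes "continuous_on UNIV f" "continuous_on UNIV g" "AE x in lborel. f x = g x"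
  shows "f = g"
proof (rule ccontr)
  assume "f \<noteq> g"
  define S where "S = {x. f x \<noteq> g x}"
  have "open S" unfolding S_def using assms by (intro open_Collect_neq)
  moreover have "S \<noteq> {}" using \<open>f \<noteq> g\<close> by (auto simp: S_def)
  moreover have "negligible S"
  proof -
    have "S \<in> null_sets lborel"
      using \<open>open S\<close> assms(3) by (subst AE_iff_null_sets) (auto simp: S_def)
    then show ?thesis by (simp add: negligible_iff_null_sets null_sets_completionI)
  qed
  ultimately show False using open_not_negligible by blast
qed

lemma vec_component_measurable [measurable (raw)]:
  fixes f :: "'w \<Rightarrow> real ^ 'n"
  shows "f \<in> borel_measurable M \<Longrightarrow> (\<lambda>x. f x $ i) \<in> borel_measurable M"
  using borel_measurable_inner[of f M "\<lambda>_. axis i 1"] by (simp add: inner_axis)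

section \<open>Identification of the regression with the posterior mean\<close>

locale noisy_observation =
  fixes \<nu> :: "(real ^ 'n) measure" and a b :: real
  assumes prob: "prob_space \<nu>" and sets_nu [measurable_cong]: "sets \<nu> = sets borel"
    and second_moment: "integrable \<nu> (\<lambda>y. (norm y)\<^sup>2)"
    and a_pos: "a > 0" and b_pos: "b > 0"
begin

sublocale posterior \<nu> "a\<^sup>2" b
  by (intro posterior.intro prob sets_nu second_moment b_pos zero_less_power a_pos)

interpretation N: prob_space \<nu> by (rule prob)
interpretation G: prob_space "std_gaussian :: (real ^ 'n) measure" by (rule prob_space_gaussian) simp
interpretation GN: pair_prob_space "std_gaussian :: (real ^ 'n) measure" \<nu> ..
interpretation LN: pair_sigma_finite "lborel :: (real ^ 'n) measure" \<nu> ..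

definition observe :: "(real ^ 'n) \<times> (real ^ 'n) \<Rightarrow> real ^ 'n" where
  "observe = (\<lambda>(z, y). a *\<^sub>R z + b *\<^sub>R y)"

lemma observe_measurable [measurable]: "observe \<in> borel_measurable (std_gaussian \<Otimes>\<^sub>M \<nu>)"
  unfolding observe_def by measurable

text \<open>The constant left out of \<open>kern\<close>: \<open>norm_const * kern x y\<close> is
  the normal density at \<open>x\<close> with mean \<open>b *\<^sub>R y\<close> and covariance
  \<open>a\<^sup>2\<close> times the identity.\<close>

definition norm_const :: real where "norm_const = gaussian_constant 1 CARD('n) / a ^ CARD('n)"

lemma norm_const_pos: "norm_const > 0"
  using gaussian_constant_pos[of 1] a_pos by (simp add: norm_const_def)

lemma nn_integral_observe:
  assumes [measurable]: "f \<in> borel_measurable borel"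
  shows "(\<integral>\<^sup>+z. f (a *\<^sub>R z + b *\<^sub>R y) \<partial>std_gaussian) = (\<integral>\<^sup>+x. ennreal (norm_const * kern x y) * f x \<partial>lborel)"
proof -
  have a: "a \<noteq> 0" using a_pos by simp
  have k: "norm_const * kern (b *\<^sub>R y + a *\<^sub>R z) y * a ^ CARD('n) =
      gaussian_constant 1 CARD('n) * exp (- (norm z)\<^sup>2 / 2)" for z
    using a_pos by (simp add: norm_const_def kern_def power_mult_distrib)
  have "(\<integral>\<^sup>+x. ennreal (norm_const * kern x y) * f x \<partial>lborel) =
      (\<integral>\<^sup>+z. ennreal (a ^ CARD('n)) * (ennreal (norm_const * kern (b *\<^sub>R y + a *\<^sub>R z) y) * f (b *\<^sub>R y + a *\<^sub>R z)) \<partial>lborel)"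
    using a_pos by (subst lborel_affine[OF a, of "b *\<^sub>R y"]) (simp add: nn_integral_density nn_integral_distr)
  also have "\<dots> = (\<integral>\<^sup>+z. ennreal (gaussian_constant 1 CARD('n) * exp (- (norm z)\<^sup>2 / 2)) * f (a *\<^sub>R z + b *\<^sub>R y) \<partial>lborel)"
  proof (rule nn_integral_cong)
    fix z
    have "ennreal (a ^ CARD('n)) * ennreal (norm_const * kern (b *\<^sub>R y + a *\<^sub>R z) y) =
        ennreal (gaussian_constant 1 CARD('n) * exp (- (norm z)\<^sup>2 / 2))"
      unfolding k[symmetric] using a_pos norm_const_pos
      by (subst ennreal_mult'[symmetric]) (auto simp: mult.commute)
    then show "ennreal (a ^ CARD('n)) * (ennreal (norm_const * kern (b *\<^sub>R y + a *\<^sub>R z) y) * f (b *\<^sub>R y + a *\<^sub>R z)) =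
        ennreal (gaussian_constant 1 CARD('n) * exp (- (norm z)\<^sup>2 / 2)) * f (a *\<^sub>R z + b *\<^sub>R y)"
      by (simp add: add.commute flip: mult.assoc)
  qed
  also have "\<dots> = (\<integral>\<^sup>+z. f (a *\<^sub>R z + b *\<^sub>R y) \<partial>std_gaussian)"
    unfolding gaussian_eq by (subst nn_integral_density) auto
  finally show ?thesis ..
qed

text \<open>Replacing the noise coordinate by the observation gives a density with respect to a
  product measure. Conditioning on the observation then amounts to integrating over \<open>y\<close>
  with \<open>x\<close> fixed.\<close>

lemma joint_law:
  "distr (std_gaussian \<Otimes>\<^sub>M \<nu>) (lborel \<Otimes>\<^sub>M \<nu>) (\<lambda>w. (observe w, snd w)) =
    density (lborel \<Otimes>\<^sub>M \<nu>) (\<lambda>(x, y). ennreal (norm_const * kern x y))"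
proof (rule measure_eqI)
  fix A assume "A \<in> sets (distr (std_gaussian \<Otimes>\<^sub>M \<nu>) (lborel \<Otimes>\<^sub>M \<nu>) (\<lambda>w. (observe w, snd w)))"
  then have A [measurable]: "A \<in> sets (lborel \<Otimes>\<^sub>M \<nu>)" by simp
  have [measurable]: "(\<lambda>w. (observe w, snd w)) \<in> std_gaussian \<Otimes>\<^sub>M \<nu> \<rightarrow>\<^sub>M lborel \<Otimes>\<^sub>M \<nu>"
    by measurable
  have A' [measurable]: "(\<lambda>x. indicator A (x, y) :: ennreal) \<in> borel_measurable borel" if "y \<in> space \<nu>" for y
    using measurable_compose[OF measurable_Pair2'[OF that, of lborel] borel_measurable_indicator[OF A]]
    by simp
  have "emeasure (distr (std_gaussian \<Otimes>\<^sub>M \<nu>) (lborel \<Otimes>\<^sub>M \<nu>) (\<lambda>w. (observe w, snd w))) A =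
      (\<integral>\<^sup>+w. indicator A w \<partial>distr (std_gaussian \<Otimes>\<^sub>M \<nu>) (lborel \<Otimes>\<^sub>M \<nu>) (\<lambda>w. (observe w, snd w)))"
    by (rule nn_integral_indicator[symmetric]) (simp only: sets_distr A)
  also have "\<dots> = (\<integral>\<^sup>+w. indicator A (observe w, snd w) \<partial>(std_gaussian \<Otimes>\<^sub>M \<nu>))"
    by (rule nn_integral_distr) auto
  also have "\<dots> = (\<integral>\<^sup>+y. (\<integral>\<^sup>+z. indicator A (a *\<^sub>R z + b *\<^sub>R y, y) \<partial>std_gaussian) \<partial>\<nu>)"
    by (subst GN.nn_integral_snd[symmetric]) (auto simp: observe_def)
  also have "\<dots> = (\<integral>\<^sup>+y. (\<integral>\<^sup>+x. ennreal (norm_const * kern x y) * indicator A (x, y) \<partial>lborel) \<partial>\<nu>)"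
    by (intro nn_integral_cong nn_integral_observe A')
  also have "\<dots> = (\<integral>\<^sup>+w. (case w of (x, y) \<Rightarrow> ennreal (norm_const * kern x y)) * indicator A w \<partial>(lborel \<Otimes>\<^sub>M \<nu>))"
    by (subst LN.nn_integral_snd[symmetric]) auto
  also have "\<dots> = emeasure (density (lborel \<Otimes>\<^sub>M \<nu>) (\<lambda>(x, y). ennreal (norm_const * kern x y))) A"
    by (rule emeasure_density[symmetric]) measurable
  finally show "emeasure (distr (std_gaussian \<Otimes>\<^sub>M \<nu>) (lborel \<Otimes>\<^sub>M \<nu>) (\<lambda>w. (observe w, snd w))) A =
    emeasure (density (lborel \<Otimes>\<^sub>M \<nu>) (\<lambda>(x, y). ennreal (norm_const * kern x y))) A" .
qed simp

lemma joint_integrable_iff: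
  fixes h :: "(real ^ 'n) \<times> (real ^ 'n) \<Rightarrow> real"
  assumes [measurable]: "h \<in> borel_measurable (lborel \<Otimes>\<^sub>M \<nu>)"
  shows "integrable (std_gaussian \<Otimes>\<^sub>M \<nu>) (\<lambda>w. h (observe w, snd w)) \<longleftrightarrow>
    integrable (lborel \<Otimes>\<^sub>M \<nu>) (\<lambda>(x, y). norm_const * kern x y * h (x, y))"
proof -
  have "integrable (std_gaussian \<Otimes>\<^sub>M \<nu>) (\<lambda>w. h (observe w, snd w)) \<longleftrightarrow>
      integrable (distr (std_gaussian \<Otimes>\<^sub>M \<nu>) (lborel \<Otimes>\<^sub>M \<nu>) (\<lambda>w. (observe w, snd w))) h"
    by (subst integrable_distr_eq) auto
  also have "\<dots> \<longleftrightarrow> integrable (lborel \<Otimes>\<^sub>M \<nu>) (\<lambda>w. (case w of (x, y) \<Rightarrow> norm_const * kern x y) *\<^sub>R h w)"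
    unfolding joint_law using norm_const_pos by (subst integrable_density[symmetric]) (auto simp: split_beta')
  finally show ?thesis by (simp add: split_beta')
qed

lemma joint_integral:
  fixes h :: "(real ^ 'n) \<times> (real ^ 'n) \<Rightarrow> real"
  assumes [measurable]: "h \<in> borel_measurable (lborel \<Otimes>\<^sub>M \<nu>)"
  shows "(\<integral>w. h (observe w, snd w) \<partial>(std_gaussian \<Otimes>\<^sub>M \<nu>)) =
    (\<integral>(x, y). norm_const * kern x y * h (x, y) \<partial>(lborel \<Otimes>\<^sub>M \<nu>))"
proof -
  have "(\<integral>w. h (observe w, snd w) \<partial>(std_gaussian \<Otimes>\<^sub>M \<nu>)) =
      integral\<^sup>L (distr (std_gaussian \<Otimes>\<^sub>M \<nu>) (lborel \<Otimes>\<^sub>M \<nu>) (\<lambda>w. (observe w, snd w))) h"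
    by (subst integral_distr) auto
  also have "\<dots> = (\<integral>w. (case w of (x, y) \<Rightarrow> norm_const * kern x y) *\<^sub>R h w \<partial>(lborel \<Otimes>\<^sub>M \<nu>))"
    unfolding joint_law using norm_const_pos by (subst integral_density[symmetric]) (auto simp: split_beta')
  finally show ?thesis by (simp add: split_beta')
qed

text \<open>The joint density is strictly positive, so an almost sure statement about the
  observation holds for Lebesgue almost every \<open>x\<close>; continuity does the rest. The
  description by \<open>THE\<close> in \<open>regression\<close> rests on this.\<close>

lemma regression_unique:
  assumes f: "continuous_on UNIV f" and g: "continuous_on UNIV g"
    and eq: "AE w in std_gaussian \<Otimes>\<^sub>M \<nu>. f (observe w) = (g (observe w) :: real ^ 'n)"
  shows "f = g"
proof -
  have [measurable]: "f \<in> borel_measurable borel" "g \<in> borel_measurable borel"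
    by (rule borel_measurable_continuous_onI[OF f] borel_measurable_continuous_onI[OF g])+
  have T: "(\<lambda>w. (observe w, snd w)) \<in> std_gaussian \<Otimes>\<^sub>M \<nu> \<rightarrow>\<^sub>M lborel \<Otimes>\<^sub>M \<nu>"
    by measurable
  define C where "C = {x. f x = g x}"
  have [measurable]: "C \<in> sets borel"
    unfolding C_def using f g by (intro borel_closed closed_Collect_eq)
  have S: "{w \<in> space (lborel \<Otimes>\<^sub>M \<nu>). fst w \<in> C} \<in> sets (lborel \<Otimes>\<^sub>M \<nu>)"
    by measurable
  have k: "(\<lambda>(x, y). ennreal (norm_const * kern x y)) \<in> borel_measurable (lborel \<Otimes>\<^sub>M \<nu>)"
    by measurable
  have "AE w in std_gaussian \<Otimes>\<^sub>M \<nu>. observe w \<in> C"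
    using eq by (simp only: C_def mem_Collect_eq)
  then have "AE w in distr (std_gaussian \<Otimes>\<^sub>M \<nu>) (lborel \<Otimes>\<^sub>M \<nu>) (\<lambda>w. (observe w, snd w)). fst w \<in> C"
    by (simp only: AE_distr_iff[OF T S] fst_conv)
  then have ae: "AE w in lborel \<Otimes>\<^sub>M \<nu>. fst w \<in> C"
    unfolding joint_law AE_density[OF k]
    by (rule AE_mp) (use norm_const_pos in \<open>simp add: split_beta'\<close>)
  have "AE x in lborel. f x = g x"
    using LN.AE_pair[OF ae] by eventually_elim (simp add: C_def)
  then show ?thesis by (rule continuous_AE_lborel_eq[OF f g])
qed

text \<open>Given \<open>observe (z, y) = x\<close>, the noise is \<open>z = (x - b y) / a\<close>,
  so the regressed quantity becomes affine in \<open>y\<close> and its conditional expectation is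
  obtained by inserting the posterior mean. Continuity of \<open>mean\<close> singles out this
  version.\<close>

lemma regression_affine:
  "regression (std_gaussian \<Otimes>\<^sub>M \<nu>) observe (\<lambda>(z, y). c *\<^sub>R z + d *\<^sub>R y) =
    (\<lambda>x. (c / a) *\<^sub>R (x - b *\<^sub>R mean x) + d *\<^sub>R mean x)"
proof -
  let ?M = "(std_gaussian :: (real ^ 'n) measure) \<Otimes>\<^sub>M \<nu>" and ?Y = "\<lambda>(z, y). c *\<^sub>R z + d *\<^sub>R y"
  define F where "F = vimage_algebra (space ?M) observe borel"
  define g where "g x = (c / a) *\<^sub>R (x - b *\<^sub>R mean x) + d *\<^sub>R mean x" for x
  have g_cont: "continuous_on UNIV g"
    unfolding g_def by (intro continuous_intros continuous_mean)
  have g_meas [measurable]: "g \<in> borel_measurable borel"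
    by (rule borel_measurable_continuous_onI[OF g_cont])
  have subalg: "subalgebra ?M F"
    unfolding F_def subalgebra_def using sets_image_in_sets[OF refl observe_measurable] by simp
  have obs_F: "observe \<in> F \<rightarrow>\<^sub>M borel" unfolding F_def by (rule measurable_vimage_algebra1) simp
  interpret F: finite_measure_subalgebra ?M F
    using subalg by unfold_locales
  have ce: "AE w in ?M. real_cond_exp ?M F (\<lambda>w. ?Y w $ i) w = g (observe w) $ i" for i
  proof (rule F.real_cond_exp_charact)
    define h :: "(real ^ 'n) \<times> (real ^ 'n) \<Rightarrow> real" where "h = (\<lambda>(x, y). ((c / a) *\<^sub>R (x - b *\<^sub>R y) + d *\<^sub>R y) $ i)"
    have h_meas [measurable]: "h \<in> borel_measurable (lborel \<Otimes>\<^sub>M \<nu>)"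
      unfolding h_def by measurable
    have Y: "?Y w $ i = h (observe w, snd w)" for w
      using a_pos by (simp add: h_def observe_def split_beta' )
    have intY: "integrable ?M (\<lambda>w. ?Y w $ i)"
    proof -
      have iG: "integrable std_gaussian (\<lambda>z::real^'n. z)"
      proof (rule Bochner_Integration.integrable_bound)
        show "integrable std_gaussian (\<lambda>z::real^'n. 1 + (norm z)\<^sup>2)"
          using gaussian_second_moment[of 1] by auto
        show "AE z in std_gaussian. norm (z::real^'n) \<le> norm (1 + (norm z)\<^sup>2)"
          using lin_le_quad by (intro AE_I2) auto
      qed auto
      have iN: "integrable \<nu> (\<lambda>y. y)" 
        by (rule integrable_quadratic_growth[of _ 1 1]) (auto intro: lin_le_quad)
      have "integrable ?M (\<lambda>w. fst w)"
        by (rule GN.Fubini_integrable) (auto simp: iG N.prob_space intro!: integrable_norm)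
      moreover have "integrable ?M (\<lambda>w. snd w)"
        by (rule GN.Fubini_integrable) (auto simp: iN)
      ultimately have "integrable ?M (\<lambda>w. (c *\<^sub>R fst w + d *\<^sub>R snd w) \<bullet> axis i 1)" by auto
      then show ?thesis by (simp add: split_beta' inner_axis)
    qed
    then show "integrable ?M (\<lambda>w. ?Y w $ i)" .
    have inth: "integrable (lborel \<Otimes>\<^sub>M \<nu>) (\<lambda>(x, y). norm_const * kern x y * h (x, y))"
      using intY unfolding Y by (simp add: joint_integrable_iff)
    have kern_h: "(\<integral>y. norm_const * kern x y * h (x, y) \<partial>\<nu>) = norm_const * (mass x * g x $ i)" for x
    proof -
      have i1: "integrable \<nu> (\<lambda>y. kern x y *\<^sub>R y)"
        by (rule integrable_kern_growth[of _ 1 1]) (auto intro: lin_le_quad)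
      define u where "u = (c / a) *\<^sub>R x"
      define e where "e = d - c / a * b"
      have "(\<integral>y. norm_const * kern x y * h (x, y) \<partial>\<nu>) =
        (\<integral>y. norm_const * ((kern x y *\<^sub>R u + e *\<^sub>R (kern x y *\<^sub>R y)) \<bullet> axis i 1) \<partial>\<nu>)"
        by (rule Bochner_Integration.integral_cong) (auto simp: h_def inner_axis u_def e_def algebra_simps)
      also have "\<dots> = norm_const * ((mass x *\<^sub>R u + e *\<^sub>R (\<integral>y. kern x y *\<^sub>R y \<partial>\<nu>)) \<bullet> axis i 1)"
        using i1 integrable_kern[of x] by (simp add: mass_def del: scaleR_scaleR)
      also have "(\<integral>y. kern x y *\<^sub>R y \<partial>\<nu>) = mass x *\<^sub>R mean x"
        unfolding mean_def by (subst integral_post') auto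
      finally show ?thesis by (simp add: g_def inner_axis u_def e_def algebra_simps)
    qed
    have intg: "integrable (lborel \<Otimes>\<^sub>M \<nu>) (\<lambda>(x, y). norm_const * kern x y * g x $ i)"
    proof (rule LN.Fubini_integrable)
      show "(\<lambda>(x, y). norm_const * kern x y * g x $ i) \<in> borel_measurable (lborel \<Otimes>\<^sub>M \<nu>)" by measurable
      show "AE x in lborel. integrable \<nu> (\<lambda>y. case (x, y) of (x, y) \<Rightarrow> norm_const * kern x y * g x $ i)"
        using integrable_kern by simp
      \<comment> \<open>Since \<open>g x\<close> is constant in \<open>y\<close> and the kernel is
        positive, the inner integral of the absolute value equals that of \<open>h\<close> in
        absolute value. Integrability of \<open>g\<close> is thus inherited from \<open>h\<close>,
        with no separate moment estimate.\<close>
      have "(\<integral>y. norm (case (x, y) of (x, y) \<Rightarrow> norm_const * kern x y * g x $ i) \<partial>\<nu>) =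
          norm (\<integral>y. norm_const * kern x y * h (x, y) \<partial>\<nu>)" for x
      proof -
        have "(\<integral>y. norm (norm_const * kern x y * g x $ i) \<partial>\<nu>) = (\<integral>y. norm_const * \<bar>g x $ i\<bar> * kern x y \<partial>\<nu>)"
          using norm_const_pos by (intro Bochner_Integration.integral_cong) (auto simp: abs_mult)
        also have "\<dots> = norm_const * \<bar>g x $ i\<bar> * mass x" by (simp add: mass_def)
        finally show ?thesis unfolding kern_h using norm_const_pos by (simp add: abs_mult abs_of_pos[OF mass_pos])
      qed
      moreover have "integrable lborel (\<lambda>x. norm (\<integral>y. norm_const * kern x y * h (x, y) \<partial>\<nu>))"
        using LN.integrable_fst'[OF inth] by (intro integrable_norm) simp
      ultimately show "integrable lborel (\<lambda>x. \<integral>y. norm (case (x, y) of (x, y) \<Rightarrow> norm_const * kern x y * g x $ i) \<partial>\<nu>)"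
        by simp
    qed
    then show "integrable ?M (\<lambda>w. g (observe w) $ i)"
      using joint_integrable_iff[of "\<lambda>w. g (fst w) $ i"] by simp
    show "(\<lambda>w. g (observe w) $ i) \<in> borel_measurable F"
      using obs_F by measurable
    \<comment> \<open>Events of the observation are preimages of Borel sets \<open>B\<close>, so
      their indicators depend on \<open>x\<close> alone and leave the inner integral over
      \<open>y\<close>, where \<open>kern_h\<close> exchanges \<open>h\<close> for
      \<open>g\<close>.\<close>
    fix A assume "A \<in> sets F"
    then obtain B where B [measurable]: "B \<in> sets borel" and A: "A = observe -` B \<inter> space ?M"
      unfolding F_def by (subst (asm) sets_vimage_algebra2) auto
    have "(\<integral>w\<in>A. ?Y w $ i \<partial>?M) = (\<integral>w. (\<lambda>w. indicator B (fst w) * h w) (observe w, snd w) \<partial>?M)"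
      unfolding set_lebesgue_integral_def A Y
      by (rule Bochner_Integration.integral_cong) (auto simp: indicator_def)
    also have "\<dots> = (\<integral>(x, y). norm_const * kern x y * (indicator B x * h (x, y)) \<partial>(lborel \<Otimes>\<^sub>M \<nu>))"
      by (subst joint_integral) auto
    also have "\<dots> = (\<integral>x. (\<integral>y. norm_const * kern x y * (indicator B x * h (x, y)) \<partial>\<nu>) \<partial>lborel)"
    proof -
      have "integrable (lborel \<Otimes>\<^sub>M \<nu>) (\<lambda>w. indicator (B \<times> space \<nu>) w *\<^sub>R (case w of (x, y) \<Rightarrow> norm_const * kern x y * h (x, y)))"
        by (intro integrable_mult_indicator inth) auto
      then have "integrable (lborel \<Otimes>\<^sub>M \<nu>) (\<lambda>(x, y). norm_const * kern x y * (indicator B x * h (x, y)))"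
        by (rule Bochner_Integration.integrable_cong[THEN iffD1, rotated 2])
          (auto simp: space_pair_measure indicator_def)
      from LN.integral_fst'[OF this] show ?thesis by simp
    qed
    also have "\<dots> = (\<integral>x. indicator B x * (norm_const * (mass x * g x $ i)) \<partial>lborel)"
      by (simp add: mult.left_commute[of _ "indicator B _"] flip: kern_h)
    also have "\<dots> = (\<integral>x. (\<integral>y. norm_const * kern x y * (indicator B x * g x $ i) \<partial>\<nu>) \<partial>lborel)"
      by (simp add: mass_def mult_ac)
    also have "\<dots> = (\<integral>(x, y). norm_const * kern x y * (indicator B x * g x $ i) \<partial>(lborel \<Otimes>\<^sub>M \<nu>))"
    proof -
      have "integrable (lborel \<Otimes>\<^sub>M \<nu>) (\<lambda>w. indicator (B \<times> space \<nu>) w *\<^sub>R (case w of (x, y) \<Rightarrow> norm_const * kern x y * g x $ i))"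
        by (intro integrable_mult_indicator intg) auto
      then have "integrable (lborel \<Otimes>\<^sub>M \<nu>) (\<lambda>(x, y). norm_const * kern x y * (indicator B x * g x $ i))"
        by (rule Bochner_Integration.integrable_cong[THEN iffD1, rotated 2])
          (auto simp: space_pair_measure indicator_def)
      from LN.integral_fst'[OF this] show ?thesis by simp
    qed
    also have "\<dots> = (\<integral>w. (\<lambda>w. indicator B (fst w) * g (fst w) $ i) (observe w, snd w) \<partial>?M)"
      by (subst joint_integral) auto
    also have "\<dots> = (\<integral>w\<in>A. g (observe w) $ i \<partial>?M)"
      unfolding set_lebesgue_integral_def A
      by (rule Bochner_Integration.integral_cong) (auto simp: indicator_def)
    finally show "(\<integral>w\<in>A. ?Y w $ i \<partial>?M) = (\<integral>w\<in>A. g (observe w) $ i \<partial>?M)" .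
  qed
  have "regression ?M observe ?Y = g"
    unfolding regression_def
  proof (rule the_equality)
    show "continuous_on UNIV g \<and> (\<forall>i. AE w in ?M. g (observe w) $ i =
        real_cond_exp ?M (vimage_algebra (space ?M) observe borel) (\<lambda>w. ?Y w $ i) w)"
      using g_cont ce unfolding F_def by (auto elim!: AE_mp simp: eq_commute)
    fix f assume f: "continuous_on UNIV f \<and> (\<forall>i. AE w in ?M. f (observe w) $ i =
        real_cond_exp ?M (vimage_algebra (space ?M) observe borel) (\<lambda>w. ?Y w $ i) w)"
    have "AE w in ?M. f (observe w) $ i = g (observe w) $ i" for i
      using f[THEN conjunct2, rule_format, of i] ce[of i] unfolding F_def by eventually_elim simp
    then have "AE w in ?M. \<forall>i. f (observe w) $ i = g (observe w) $ i"
      by (simp add: AE_all_countable)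
    then have "AE w in ?M. f (observe w) = g (observe w)"
      by (simp add: vec_eq_iff)
    then show "f = g" using f g_cont by (intro regression_unique) auto
  qed
  then show ?thesis by (simp add: g_def[abs_def])
qed

end

section \<open>Bounds on the schedule, and the velocity away from time 1\<close>

lemma time_deriv_interior:
  assumes "(f has_real_derivative D) (at t)" "t \<in> interior S"
  shows "time_deriv S f t = D"
  using vector_derivative_at[OF assms(1)[unfolded has_real_derivative_iff_has_vector_derivative]]
  unfolding time_deriv_def at_within_interior[OF assms(2)] .

lemma bounded_on_compact_interval:
  fixes f :: "real \<Rightarrow> real"
  assumes "continuous_on {u..v} f"
  obtains M where "M > 0" "\<And>t. t \<in> {u..v} \<Longrightarrow> \<bar>f t\<bar> \<le> M"
proof -
  have "compact (f ` {u..v})" using assms by (intro compact_continuous_image) auto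
  then obtain M where "M > 0" "\<And>y. y \<in> f ` {u..v} \<Longrightarrow> norm y \<le> M"
    using compact_imp_bounded bounded_pos by metis
  then show thesis by (intro that[of M]) auto
qed

lemma bounded_below_on_compact_interval:
  fixes f :: "real \<Rightarrow> real"
  assumes "continuous_on {u..v} f" "\<And>t. t \<in> {u..v} \<Longrightarrow> f t > 0"
  obtains m where "m > 0" "\<And>t. t \<in> {u..v} \<Longrightarrow> m \<le> f t"
proof (cases "u \<le> v")
  case True
  then obtain s where "s \<in> {u..v}" "\<And>t. t \<in> {u..v} \<Longrightarrow> f s \<le> f t"
    using continuous_attains_inf[of "{u..v}" f] assms(1) by auto
  then show thesis using assms(2) by (intro that[of "f s"]) auto
qed (use that[of 1] in auto)

locale schedule =
  fixes a b :: "real \<Rightarrow> real"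
  assumes sched: "interpolation_schedule a b"
begin

abbreviation a' :: "real \<Rightarrow> real" where "a' \<equiv> time_deriv {0..1} a"
abbreviation b' :: "real \<Rightarrow> real" where "b' \<equiv> time_deriv {0..1} b"

lemma a_positive: "t \<in> {0..<1} \<Longrightarrow> a t > 0"
  using sched unfolding interpolation_schedule_def by (cases "t = 0") auto

lemma b_positive: "t \<in> {0<..1} \<Longrightarrow> b t > 0"
  using sched unfolding interpolation_schedule_def by (cases "t = 1") auto

lemma a_1: "a 1 = 0" and b_1: "b 1 = 1"
  using sched unfolding interpolation_schedule_def by auto

lemma b_cont: "continuous_on {0..1} b"
  using sched unfolding interpolation_schedule_def C1_on_def by (intro differentiable_imp_continuous_on) auto

text \<open>The differentiability assumptions on \<open>a\<close> stop short of time 1. Continuity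
  there comes from that of \<open>a\<^sup>2\<close>, whose nonnegative root is
  \<open>a\<close>.\<close>

lemma a_cont: "continuous_on {0..1} a"
proof -
  have "continuous_on {0..1} (\<lambda>t. sqrt ((a t)\<^sup>2))"
    using sched unfolding interpolation_schedule_def C1_on_def
    by (intro continuous_on_real_sqrt differentiable_imp_continuous_on) auto
  moreover have "sqrt ((a t)\<^sup>2) = a t" if "t \<in> {0..1}" for t
    using that a_positive[of t] a_1 by (cases "t = 1") auto
  ultimately show ?thesis by (rule continuous_on_eq)
qed

lemma a_deriv:
  assumes t: "t \<in> {0<..<1}"
  shows "(a has_real_derivative a' t) (at t)"
proof -
  have d: "a differentiable (at t within {0..<1})"
    using sched t unfolding interpolation_schedule_def C2_on_def differentiable_on_def by auto
  have i: "t \<in> interior {0..<1}" "t \<in> interior {0..1}"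
    using t by (auto simp: interior_atLeastAtMost_real interior_atLeastLessThan)
  have "a differentiable (at t)" using d unfolding at_within_interior[OF i(1)] .
  then obtain D where D: "(a has_real_derivative D) (at t)" by (auto simp: real_differentiable_def)
  with time_deriv_interior[OF D i(2)] show ?thesis by simp
qed

lemma a'_bounded_early:
  assumes "t0 < 1"
  obtains M where "M > 0" "\<And>t. t \<in> {0<..t0} \<Longrightarrow> \<bar>a' t\<bar> \<le> M"
proof -
  have "continuous_on {0..<1} (time_deriv {0..<1} a)"
    using sched unfolding interpolation_schedule_def C2_on_def C1_on_def
    by (intro differentiable_imp_continuous_on) auto
  then have "continuous_on {0..t0} (time_deriv {0..<1} a)"
    by (rule continuous_on_subset) (use assms in auto)
  then obtain M where M: "M > 0" "\<And>t. t \<in> {0..t0} \<Longrightarrow> \<bar>time_deriv {0..<1} a t\<bar> \<le> M"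
    using bounded_on_compact_interval by blast
  show thesis
  proof (rule that[OF M(1)])
    fix t assume t: "t \<in> {0<..t0}"
    have "time_deriv {0..<1} a t = a' t"
      using t assms by (intro time_deriv_interior a_deriv) (auto simp: interior_atLeastLessThan)
    then show "\<bar>a' t\<bar> \<le> M" using M(2)[of t] t by simp
  qed
qed

text \<open>Up to time 1 the derivative of \<open>a\<close> itself may be unbounded, as for
  \<open>sqrt (1 - t\<^sup>2)\<close>; the product \<open>a * a'\<close> is half the derivative of
  \<open>a\<^sup>2\<close> and stays bounded.\<close>

lemma schedule_bounds:
  obtains M where "M > 0" "\<And>t. t \<in> {0..1} \<Longrightarrow> \<bar>a t\<bar> \<le> M" "\<And>t. t \<in> {0..1} \<Longrightarrow> \<bar>b t\<bar> \<le> M"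
    "\<And>t. t \<in> {0..1} \<Longrightarrow> \<bar>b' t\<bar> \<le> M" "\<And>t. t \<in> {0<..<1} \<Longrightarrow> \<bar>a t * a' t\<bar> \<le> M"
proof -
  obtain M1 where M1: "M1 > 0" "\<And>t. t \<in> {0..1} \<Longrightarrow> \<bar>a t\<bar> \<le> M1"
    using bounded_on_compact_interval[OF a_cont] by blast
  obtain M2 where M2: "M2 > 0" "\<And>t. t \<in> {0..1} \<Longrightarrow> \<bar>b t\<bar> \<le> M2"
    using bounded_on_compact_interval[OF b_cont] by blast
  have "continuous_on {0..1} b'" "continuous_on {0..1} (time_deriv {0..1} (\<lambda>t. (a t)\<^sup>2))"
    using sched unfolding interpolation_schedule_def C1_on_def by auto
  then obtain M3 M4 where M3: "M3 > 0" "\<And>t. t \<in> {0..1} \<Longrightarrow> \<bar>b' t\<bar> \<le> M3"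
    and M4: "M4 > 0" "\<And>t. t \<in> {0..1} \<Longrightarrow> \<bar>time_deriv {0..1} (\<lambda>t. (a t)\<^sup>2) t\<bar> \<le> M4"
    using bounded_on_compact_interval by metis
  have M4': "\<bar>a t * a' t\<bar> \<le> M4" if t: "t \<in> {0<..<1}" for t
  proof -
    have "((\<lambda>t. (a t)\<^sup>2) has_real_derivative 2 * (a t * a' t)) (at t)"
      using a_deriv[OF t] by (auto intro!: derivative_eq_intros)
    then have "time_deriv {0..1} (\<lambda>t. (a t)\<^sup>2) t = 2 * (a t * a' t)"
      by (rule time_deriv_interior) (use t in \<open>auto simp: interior_atLeastAtMost_real\<close>)
    then have "2 * \<bar>a t * a' t\<bar> \<le> M4" using M4(2)[of t] t by (simp add: abs_mult)
    then show ?thesis by linarith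
  qed
  show thesis
  proof (rule that[of "M1 + M2 + M3 + M4"])
    show "M1 + M2 + M3 + M4 > 0" using M1(1) M2(1) M3(1) M4(1) by linarith
    fix t :: real
    show "\<bar>a t\<bar> \<le> M1 + M2 + M3 + M4" if "t \<in> {0..1}"
      using M1(2)[OF that] M2(1) M3(1) M4(1) by linarith
    show "\<bar>b t\<bar> \<le> M1 + M2 + M3 + M4" if "t \<in> {0..1}"
      using M2(2)[OF that] M1(1) M3(1) M4(1) by linarith
    show "\<bar>b' t\<bar> \<le> M1 + M2 + M3 + M4" if "t \<in> {0..1}"
      using M3(2)[OF that] M1(1) M2(1) M4(1) by linarith
    show "\<bar>a t * a' t\<bar> \<le> M1 + M2 + M3 + M4" if "t \<in> {0<..<1}"
      using M4'[OF that] M1(1) M2(1) M3(1) by linarith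
  qed
qed

lemma noisy_observation_schedule:
  assumes "borel_probability \<nu>" "integrable \<nu> (\<lambda>y. (norm y)\<^sup>2)" "t \<in> {0<..<1}"
  shows "noisy_observation \<nu> (a t) (b t)"
  using assms unfolding borel_probability_def
  by (intro noisy_observation.intro a_positive b_positive) (simp_all only: greaterThanLessThan_iff greaterThanAtMost_iff atLeastLessThan_iff less_imp_le)

lemma velocity_eq:
  assumes N: "borel_probability \<nu>" "integrable \<nu> (\<lambda>y. (norm y)\<^sup>2)" and t: "t \<in> {0<..<1}"
  defines "m \<equiv> posterior.mean \<nu> ((a t)\<^sup>2) (b t)"
  shows "velocity a b \<nu> t x = (a' t / a t) *\<^sub>R (x - b t *\<^sub>R m x) + b' t *\<^sub>R m x"
proof -
  interpret noisy_observation \<nu> "a t" "b t" by (rule noisy_observation_schedule[OF N t])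
  show ?thesis
    using t regression_affine[of "a' t" "b' t"]
    unfolding velocity_def inner_velocity_def m_def observe_def by simp
qed

lemma lipschitz_affine_combination:
  fixes m :: "'a::real_normed_vector \<Rightarrow> 'a"
  assumes m: "k-lipschitz_on UNIV m" and p: "\<bar>p\<bar> \<le> P" and r: "\<bar>r\<bar> \<le> R" and k: "k \<le> K"
    and f: "\<And>x. f x = p *\<^sub>R x + r *\<^sub>R m x"
  shows "(P + R * K)-lipschitz_on UNIV f"
proof (rule lipschitz_onI)
  have K: "0 \<le> k" "0 \<le> K" using lipschitz_on_nonneg[OF m] k by auto
  show "0 \<le> P + R * K" using p r K by (auto intro!: add_nonneg_nonneg mult_nonneg_nonneg)
  fix x y
  have "f x - f y = p *\<^sub>R (x - y) + r *\<^sub>R (m x - m y)" by (simp add: f algebra_simps)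
  then have "norm (f x - f y) \<le> \<bar>p\<bar> * norm (x - y) + \<bar>r\<bar> * norm (m x - m y)"
    using norm_triangle_ineq[of "p *\<^sub>R (x - y)" "r *\<^sub>R (m x - m y)"] by simp
  also have "\<dots> \<le> P * norm (x - y) + R * (K * norm (x - y))"
  proof (intro add_mono mult_mono p r)
    have "norm (m x - m y) \<le> k * norm (x - y)" using lipschitz_onD[OF m, of x y] by (simp add: dist_norm)
    also have "\<dots> \<le> K * norm (x - y)" using k by (intro mult_right_mono) auto
    finally show "norm (m x - m y) \<le> K * norm (x - y)" .
  qed (use p r in auto)
  finally show "dist (f x) (f y) \<le> (P + R * K) * dist x y" by (simp add: dist_norm algebra_simps)
qed

text \<open>Up to \<open>t0 < 1\<close> the function \<open>a\<close> is bounded away from 0, so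
  \<open>a' / a\<close> and \<open>b / a\<^sup>2\<close> are bounded and any uniform variance bound
  suffices.\<close>

lemma velocity_lipschitz_early:
  fixes \<nu> :: "(real ^ 'n) measure"
  assumes N: "borel_probability \<nu>" "integrable \<nu> (\<lambda>y. (norm y)\<^sup>2)" and t0: "t0 < 1"
    and T: "\<And>t x. t \<in> {0<..t0} \<Longrightarrow> posterior.var \<nu> ((a t)\<^sup>2) (b t) x \<le> T" and T0: "T \<ge> 0"
  obtains C where "\<And>t. t \<in> {0<..t0} \<Longrightarrow> C-lipschitz_on UNIV (velocity a b \<nu> t)"
proof -
  obtain M where M: "M > 0" "\<And>t. t \<in> {0..1} \<Longrightarrow> \<bar>a t\<bar> \<le> M" "\<And>t. t \<in> {0..1} \<Longrightarrow> \<bar>b t\<bar> \<le> M"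
    "\<And>t. t \<in> {0..1} \<Longrightarrow> \<bar>b' t\<bar> \<le> M" "\<And>t. t \<in> {0<..<1} \<Longrightarrow> \<bar>a t * a' t\<bar> \<le> M"
    using schedule_bounds by blast
  obtain D where D: "D > 0" "\<And>t. t \<in> {0<..t0} \<Longrightarrow> \<bar>a' t\<bar> \<le> D"
    using a'_bounded_early[OF t0] by blast
  have "continuous_on {0..t0} a" using t0 by (intro continuous_on_subset[OF a_cont]) auto
  moreover have "\<And>t. t \<in> {0..t0} \<Longrightarrow> a t > 0" using t0 by (intro a_positive) auto
  ultimately obtain m where m: "m > 0" "\<And>t. t \<in> {0..t0} \<Longrightarrow> m \<le> a t"
    using bounded_below_on_compact_interval by blast
  have "(D / m + (M + D / m * M) * (M / m\<^sup>2 * (T + 1)))-lipschitz_on UNIV (velocity a b \<nu> t)"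
    if t: "t \<in> {0<..t0}" for t
  proof -
    have t': "t \<in> {0<..<1}" "t \<in> {0..1}" "t \<in> {0..t0}" using t t0 by auto
    interpret noisy_observation \<nu> "a t" "b t" by (rule noisy_observation_schedule[OF N t'(1)])
    have at: "0 < a t" "m \<le> a t" using a_positive[of t] t' m by auto
    have bt: "0 < b t" "b t \<le> M" using b_positive[of t] t' M(3)[of t] by auto
    have id: "1-lipschitz_on UNIV (\<lambda>y::real^'n. y)" by (rule lipschitz_onI) auto
    have "(1 * (b t / (a t)\<^sup>2) * (T + 1))-lipschitz_on UNIV (\<lambda>x. \<integral>y. y \<partial>post x)"
      \<comment> \<open>The slack \<open>e\<close> is 1 here: no small variance has to compensate
        for \<open>1 / a\<^sup>2\<close>.\<close>
      by (rule post_integral_lipschitz[OF id T[OF t]]) (use T0 in auto)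
    then have ml: "(1 * (b t / (a t)\<^sup>2) * (T + 1))-lipschitz_on UNIV mean"
      by (simp add: mean_def[abs_def])
    have p: "\<bar>a' t / a t\<bar> \<le> D / m"
      unfolding abs_divide abs_of_pos[OF at(1)] using D(1)
      by (intro frac_le D(2)[OF t] m(1) at(2)) simp
    have "\<bar>a' t / a t * b t\<bar> \<le> D / m * M"
      unfolding abs_mult[of _ "b t"] by (rule mult_mono[OF p M(3)[OF t'(2)]]) (use D(1) m(1) in simp_all)
    then have r: "\<bar>b' t - a' t / a t * b t\<bar> \<le> M + D / m * M"
      using M(4)[OF t'(2)] by linarith
    have k: "1 * (b t / (a t)\<^sup>2) * (T + 1) \<le> M / m\<^sup>2 * (T + 1)"
    proof (rule mult_right_mono)
      have "b t / (a t)\<^sup>2 \<le> M / m\<^sup>2"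
        using m(1) M(1) by (intro frac_le bt(2) power_mono at(2)) simp_all
      then show "1 * (b t / (a t)\<^sup>2) \<le> M / m\<^sup>2" by simp
    qed (use T0 in simp)
    show ?thesis
      by (rule lipschitz_affine_combination[OF ml p r k])
        (simp add: velocity_eq[OF N t'(1)] algebra_simps)
  qed
  then show thesis by (rule that)
qed

end

section \<open>Targets with a potential\<close>

context schedule
begin

text \<open>Near time 1 the quotient \<open>a' / a\<close> is not integrable. Expressing the posterior mean
  through the posterior expectation of \<open>\<nabla>U\<close> removes it and leaves \<open>a * a'\<close>, which is bounded
  because \<open>a\<^sup>2\<close> is continuously differentiable.\<close>

lemma velocity_lipschitz_late:
  fixes \<nu> :: "(real ^ 'n) measure"
  assumes N: "borel_probability \<nu>" "integrable \<nu> (\<lambda>y. (norm y)\<^sup>2)"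
    and U: "\<nu> = density lborel (\<lambda>y. ennreal (exp (- U y)))" "quad_bounds \<kappa> \<beta> U G"
      "l-lipschitz_on UNIV G" "U \<in> borel_measurable borel"
  obtains C t0 where "t0 < 1" "\<And>t. t \<in> {t0<..<1} \<Longrightarrow> C-lipschitz_on UNIV (velocity a b \<nu> t)"
proof -
  obtain M where M: "M > 0" "\<And>t. t \<in> {0..1} \<Longrightarrow> \<bar>a t\<bar> \<le> M" "\<And>t. t \<in> {0..1} \<Longrightarrow> \<bar>b t\<bar> \<le> M"
    "\<And>t. t \<in> {0..1} \<Longrightarrow> \<bar>b' t\<bar> \<le> M" "\<And>t. t \<in> {0<..<1} \<Longrightarrow> \<bar>a t * a' t\<bar> \<le> M"
    using schedule_bounds by blast
  \<comment> \<open>Positivity of \<open>h\<close> says that half of the likelihood curvature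
    \<open>b\<^sup>2 / a\<^sup>2\<close> outweighs \<open>\<bar>\<kappa>\<bar>\<close>, so the other
    half remains even for negative \<open>\<kappa>\<close>.\<close>
  define h where "h t = (b t)\<^sup>2 / 2 - \<bar>\<kappa>\<bar> * (a t)\<^sup>2" for t
  have "continuous_on {0..1} h" unfolding h_def by (intro continuous_intros a_cont b_cont) auto
  moreover have h1: "h 1 = 1 / 2" by (simp add: h_def a_1 b_1)
  ultimately obtain d where d: "d > 0" "\<And>t. t \<in> {0..1} \<Longrightarrow> dist t 1 < d \<Longrightarrow> dist (h t) (h 1) < 1 / 2"
    unfolding continuous_on_iff by (metis atLeastAtMost_iff half_gt_zero_iff order_refl zero_le_one zero_less_one)
  \<comment> \<open>The bound \<open>1 / 2\<close> keeps \<open>t0\<close> away from time 0, where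
    \<open>b\<close> may vanish, because the argument divides by \<open>b\<close>.\<close>
  define t0 where "t0 = max (1 / 2) (1 - d)"
  have t0: "t0 < 1" "1 / 2 \<le> t0" using d by (auto simp: t0_def)
  have h_pos: "h t > 0" if "t \<in> {t0<..<1}" for t
  proof -
    have "dist (h t) (h 1) < 1 / 2"
      using that t0 by (intro d(2)) (auto simp: t0_def dist_real_def)
    then show ?thesis unfolding h1 dist_real_def by linarith
  qed
  have "continuous_on {t0..1} b" using t0 by (intro continuous_on_subset[OF b_cont]) auto
  moreover have "\<And>t. t \<in> {t0..1} \<Longrightarrow> b t > 0" using t0 by (intro b_positive) auto
  ultimately obtain m where m: "m > 0" "\<And>t. t \<in> {t0..1} \<Longrightarrow> m \<le> b t"
    using bounded_below_on_compact_interval by blast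
  have l0: "0 \<le> l" by (rule lipschitz_on_nonneg[OF U(3)])
  have "(M / m + (M / m + M\<^sup>2 * M / m\<^sup>2) * (4 * l * CARD('n) / m))-lipschitz_on UNIV (velocity a b \<nu> t)"
    if t: "t \<in> {t0<..<1}" for t
  proof -
    have t': "t \<in> {0<..<1}" "t \<in> {0..1}" "t \<in> {t0..1}" using t t0 by auto
    interpret noisy_observation \<nu> "a t" "b t" by (rule noisy_observation_schedule[OF N t'(1)])
    interpret potential_posterior \<nu> "(a t)\<^sup>2" "b t" U G \<kappa> \<beta> l
      by (intro potential_posterior.intro potential_posterior_axioms.intro posterior_axioms U)
    have at: "0 < a t" "a t \<le> M" using a_positive[of t] t' M(2)[of t] by auto
    have bt: "0 < b t" "m \<le> b t" using b_positive[of t] t' m(2)[of t] by auto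
    \<comment> \<open>The dimension divided by the remaining curvature
      \<open>(b t)\<^sup>2 / (2 * (a t)\<^sup>2)\<close>.\<close>
    define T where "T = 2 * CARD('n) * (a t)\<^sup>2 / (b t)\<^sup>2"
    have T: "0 < T" using at bt by (simp add: T_def)
    have "- \<kappa> * (a t)\<^sup>2 \<le> \<bar>\<kappa>\<bar> * (a t)\<^sup>2" by (intro mult_right_mono) auto
    then have "(b t)\<^sup>2 / 2 \<le> \<kappa> * (a t)\<^sup>2 + (b t)\<^sup>2"
      using h_pos[OF t] by (simp add: h_def)
    then have K: "(b t)\<^sup>2 / (2 * (a t)\<^sup>2) \<le> \<kappa> + (b t)\<^sup>2 / (a t)\<^sup>2"
      using at by (simp add: field_simps)
    have K0: "0 < (b t)\<^sup>2 / (2 * (a t)\<^sup>2)" using at bt by simp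
    have varT: "var x \<le> T" for x
    proof -
      have "var x \<le> DIM(real ^ 'n) / (\<kappa> + (b t)\<^sup>2 / (a t)\<^sup>2)"
        using K K0 by (intro var_le_of_convex) linarith
      also have "\<dots> \<le> CARD('n) / ((b t)\<^sup>2 / (2 * (a t)\<^sup>2))"
        using K K0 by (intro frac_le) auto
      finally show ?thesis by (simp add: T_def mult_ac)
    qed
    \<comment> \<open>The slack is \<open>T\<close> itself, so the constant is proportional to
      \<open>T\<close> and the factor \<open>(a t)\<^sup>2\<close> in \<open>T\<close> cancels the
      denominator exactly.\<close>
    have Gl: "(l * (b t / (a t)\<^sup>2) * (T + T))-lipschitz_on UNIV (\<lambda>x. integral\<^sup>L (post x) G)"
      by (rule post_integral_lipschitz[OF U(3) varT T]) (use T in simp)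
    have k: "l * (b t / (a t)\<^sup>2) * (T + T) \<le> 4 * l * CARD('n) / m"
    proof -
      have "l * (b t / (a t)\<^sup>2) * (T + T) = 4 * l * CARD('n) / b t"
        using at bt by (simp add: T_def field_simps power2_eq_square)
      also have "\<dots> \<le> 4 * l * CARD('n) / m" using bt m(1) l0 by (intro divide_left_mono) auto
      finally show ?thesis .
    qed
    have p: "\<bar>b' t / b t\<bar> \<le> M / m"
      unfolding abs_divide abs_of_pos[OF bt(1)] using M(1)
      by (intro frac_le M(4)[OF t'(2)] m(1) bt(2)) simp
    have r: "\<bar>a t * a' t / b t - (a t)\<^sup>2 * b' t / (b t)\<^sup>2\<bar> \<le> M / m + M\<^sup>2 * M / m\<^sup>2"
    proof -
      have "\<bar>a t * a' t / b t\<bar> \<le> M / m"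
        unfolding abs_divide abs_of_pos[OF bt(1)] using M(1)
        by (intro frac_le M(5)[OF t'(1)] m(1) bt(2)) simp
      moreover have "\<bar>(a t)\<^sup>2 * b' t / (b t)\<^sup>2\<bar> \<le> M\<^sup>2 * M / m\<^sup>2"
      proof -
        have "\<bar>(a t)\<^sup>2 * b' t\<bar> \<le> M\<^sup>2 * M"
          unfolding abs_mult using at M(1) by (intro mult_mono M(4)[OF t'(2)]) (auto intro: power_mono)
        moreover have "m\<^sup>2 \<le> (b t)\<^sup>2" using m(1) bt by (intro power_mono) auto
        ultimately show ?thesis
          unfolding abs_divide using m(1) M(1) by (intro frac_le) auto
      qed
      ultimately show ?thesis by linarith
    qed
    have vel: "velocity a b \<nu> t x = (b' t / b t) *\<^sub>R x
        + (a t * a' t / b t - (a t)\<^sup>2 * b' t / (b t)\<^sup>2) *\<^sub>R integral\<^sup>L (post x) G" for x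
    proof -
      define e where "e = integral\<^sup>L (post x) G"
      have res: "x - b t *\<^sub>R mean x = ((a t)\<^sup>2 / b t) *\<^sub>R e"
        using at bt by (simp add: e_def integral_G_post)
      have mean: "mean x = (1 / b t) *\<^sub>R x - ((a t)\<^sup>2 / (b t)\<^sup>2) *\<^sub>R e"
      proof -
        have "mean x = (1 / b t) *\<^sub>R (x - (x - b t *\<^sub>R mean x))" using bt by simp
        also have "\<dots> = (1 / b t) *\<^sub>R x - ((a t)\<^sup>2 / (b t)\<^sup>2) *\<^sub>R e"
          unfolding res by (simp add: scaleR_diff_right power2_eq_square)
        finally show ?thesis .
      qed
      have "velocity a b \<nu> t x = (a' t / a t) *\<^sub>R (((a t)\<^sup>2 / b t) *\<^sub>R e)
          + b' t *\<^sub>R ((1 / b t) *\<^sub>R x - ((a t)\<^sup>2 / (b t)\<^sup>2) *\<^sub>R e)"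
        unfolding velocity_eq[OF N t'(1)] by (subst res, subst mean, rule refl)
      moreover have "a' t / a t * ((a t)\<^sup>2 / b t) = a t * a' t / b t"
        using at by (simp add: power2_eq_square)
      ultimately show ?thesis
        unfolding e_def[symmetric] by (simp add: scaleR_diff_right scaleR_diff_left mult_ac)
    qed
    show ?thesis by (rule lipschitz_affine_combination[OF Gl p r k vel])
  qed
  with t0(1) show thesis by (rule that)
qed

lemma velocity_lipschitz_join:
  assumes "t0 < 1" "\<And>t. t \<in> {0<..t0} \<Longrightarrow> C1-lipschitz_on UNIV (velocity a b \<nu> t)"
    "\<And>t. t \<in> {t0<..<1} \<Longrightarrow> C2-lipschitz_on UNIV (velocity a b \<nu> t)"
  shows "\<exists>C. \<forall>t\<in>{0<..<1}. C-lipschitz_on UNIV (velocity a b \<nu> t)"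
proof (intro exI ballI)
  fix t :: real assume "t \<in> {0<..<1}"
  then show "(max C1 C2)-lipschitz_on UNIV (velocity a b \<nu> t)"
    using assms(2)[of t] assms(3)[of t] by (cases "t \<le> t0") (auto intro: lipschitz_on_le)
qed

end

text \<open>The two curvature conditions each come with a potential of their own. Both are
  continuous and represent the same density, so they coincide, and with them their gradients and the
  actions of their Hessians.\<close>

lemma potential_of_target:
  fixes \<nu> :: "(real ^ 'n) measure"
  assumes "semi_log_convex \<beta> \<nu>" "semi_log_concave \<kappa> \<nu>" "measure_support \<nu> = UNIV"
  obtains U G l where "\<nu> = density lborel (\<lambda>y. ennreal (exp (- U y)))" "quad_bounds \<kappa> \<beta> U G"
    "l-lipschitz_on UNIV G" "continuous_on UNIV U"
proof -
  obtain U H G where U: "\<nu> = density lborel (\<lambda>y. ennreal (exp (- U y)))"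
    "\<And>x. (U has_derivative (\<lambda>h. G x \<bullet> h)) (at x)" "\<And>x. (G has_derivative (\<lambda>h. H x *v h)) (at x)"
    "\<And>x. loewner_le (H x) (mat \<beta>)"
    using assms(1,3) unfolding semi_log_convex_def C2_with_hessian_def by auto
  obtain U2 H2 G2 where U2: "\<nu> = density lborel (\<lambda>y. ennreal (exp (- U2 y)))"
    "\<And>x. (U2 has_derivative (\<lambda>h. G2 x \<bullet> h)) (at x)" "\<And>x. (G2 has_derivative (\<lambda>h. H2 x *v h)) (at x)"
    "\<And>x. loewner_le (mat \<kappa>) (H2 x)"
    using assms(2,3) unfolding semi_log_concave_def C2_with_hessian_def by auto
  have cont: "continuous_on UNIV U" "continuous_on UNIV U2"
    using U(2) U2(2) by (auto intro!: continuous_at_imp_continuous_on has_derivative_continuous)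
  then have [measurable]: "U \<in> borel_measurable borel" "U2 \<in> borel_measurable borel"
    by (auto intro: borel_measurable_continuous_onI)
  have "AE y in lborel. ennreal (exp (- U y)) = ennreal (exp (- U2 y))"
    using U(1) U2(1) by (intro sigma_finite_measure.density_unique[OF sigma_finite_lborel]) auto
  then have "AE y in lborel. U y = U2 y" by eventually_elim simp
  from continuous_AE_lborel_eq[OF cont this] have UU: "U2 = U" by simp
  have "G2 x = G x" for x
    using has_derivative_unique[OF U(2)[of x] U2(2)[of x, unfolded UU]]
    by (metis vector_eq_rdot inner_commute)
  then have GG: "G2 = G" by auto
  have HH: "H2 x *v h = H x *v h" for x h
    using has_derivative_unique[OF U(3)[of x] U2(3)[of x, unfolded GG]] by metis
  have lo: "loewner_le (mat \<kappa>) (H x)" for x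
    using U2(4)[of x] by (simp add: loewner_le_def HH)
  have qb: "quad_bounds \<kappa> \<beta> U G" by (rule quad_bounds_from_hessian[OF U(2,3) lo U(4)])
  obtain l where "l-lipschitz_on UNIV G" using quad_bounds_lipschitz[OF qb] .
  with U(1) qb cont(1) show thesis by (intro that)
qed

text \<open>Comparing densities gives \<open>U x = (norm x)\<^sup>2 / 2 - ln c - ln (f x)\<close>,
  so \<open>G y - y\<close> is formally the gradient of \<open>- ln f\<close>. No derivative of
  \<open>ln f\<close> is taken: the increments of both sides over a short step in the direction of
  \<open>G y - y\<close> are compared instead.\<close>

lemma gradient_of_log_lipschitz:
  fixes \<nu> :: "(real ^ 'n) measure"
  assumes U: "\<nu> = density lborel (\<lambda>y. ennreal (exp (- U y)))" "quad_bounds \<kappa> \<beta> U G" "continuous_on UNIV U"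
    and N: "borel_probability \<nu>" and f: "log_lipschitz L f"
    and ac: "absolutely_continuous std_gaussian \<nu>"
    and RN: "AE x in std_gaussian. RN_deriv std_gaussian \<nu> x = ennreal (f x)"
  shows "norm (G y - y) \<le> L"
proof -
  interpret S: prob_space "std_gaussian :: (real ^ 'n) measure" by (rule prob_space_gaussian) simp
  define c where "c = gaussian_constant 1 CARD('n)"
  have c: "c > 0" unfolding c_def by (rule gaussian_constant_pos) simp
  have f_pos: "f x > 0" and ln_f: "L-lipschitz_on UNIV (\<lambda>x. ln (f x))" for x
    using f by (auto simp: log_lipschitz_def)
  have "continuous_on UNIV (\<lambda>x. exp (ln (f x)))"
    by (intro continuous_intros lipschitz_on_continuous_on[OF ln_f])
  then have f_cont: "continuous_on UNIV f" using f_pos by simp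
  have [measurable]: "f \<in> borel_measurable borel" "U \<in> borel_measurable borel"
    using f_cont U(3) by (auto intro: borel_measurable_continuous_onI)
  have "\<nu> = density std_gaussian (RN_deriv std_gaussian \<nu>)"
    using S.density_RN_deriv[OF ac] N by (simp add: borel_probability_def)
  also have "\<dots> = density std_gaussian (\<lambda>x. ennreal (f x))"
    by (rule density_cong) (use RN in auto)
  also have "\<dots> = density lborel (\<lambda>x. ennreal (c * exp (- (norm x)\<^sup>2 / 2) * f x))"
    unfolding gaussian_eq using c f_pos
    by (subst density_density_eq) (auto simp: c_def[symmetric] ennreal_mult'[symmetric] less_imp_le)
  finally have "AE x in lborel. ennreal (exp (- U x)) = ennreal (c * exp (- (norm x)\<^sup>2 / 2) * f x)"
    unfolding U(1) by (intro sigma_finite_measure.density_unique[OF sigma_finite_lborel]) auto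
  then have "AE x in lborel. exp (- U x) = c * exp (- (norm x)\<^sup>2 / 2) * f x"
    by eventually_elim (use c f_pos in \<open>simp add: less_imp_le\<close>)
  then have eq: "(\<lambda>x. exp (- U x)) = (\<lambda>x. c * exp (- (norm x)\<^sup>2 / 2) * f x)"
    by (intro continuous_AE_lborel_eq continuous_intros U(3) f_cont) auto
  have U_eq: "U x = (norm x)\<^sup>2 / 2 - ln c - ln (f x)" for x
  proof -
    have "- U x = ln (c * exp (- (norm x)\<^sup>2 / 2) * f x)" using fun_cong[OF eq, of x] by (metis ln_exp)
    then show ?thesis using c f_pos[of x] by (simp add: ln_mult)
  qed
  define w where "w = G y - y"
  \<comment> \<open>The step is \<open>s *\<^sub>R w\<close>. The first-order terms, divided by
    \<open>s\<close>, leave the left side; the second-order terms leave an error linear in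
    \<open>s\<close>, whose coefficient is enlarged to a nonnegative one.\<close>
  have bound: "(norm w)\<^sup>2 - L * norm w \<le> s * (\<bar>\<kappa> - 1\<bar> * (norm w)\<^sup>2)" if s: "s > 0" for s
  proof -
    have "U y + G y \<bullet> (s *\<^sub>R w) + \<kappa> / 2 * (norm (s *\<^sub>R w))\<^sup>2 \<le> U (y + s *\<^sub>R w)"
      using U(2) unfolding quad_bounds_def by blast
    moreover have "(norm (y + s *\<^sub>R w))\<^sup>2 = (norm y)\<^sup>2 + 2 * s * (y \<bullet> w) + s\<^sup>2 * (norm w)\<^sup>2"
      unfolding power2_norm_eq_inner inner_add_left inner_add_right inner_scaleR_left inner_scaleR_right
        inner_commute[of w y] by (simp add: algebra_simps power2_eq_square)
    moreover have "ln (f y) - ln (f (y + s *\<^sub>R w)) \<le> L * (s * norm w)"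
      using lipschitz_onD[OF ln_f, of y "y + s *\<^sub>R w"] s by (simp add: dist_norm)
    moreover have "s * (G y \<bullet> w) = s * (norm w)\<^sup>2 + s * (y \<bullet> w)"
    proof -
      have "(norm w)\<^sup>2 = G y \<bullet> w - y \<bullet> w"
        unfolding power2_norm_eq_inner by (subst (1) w_def) (rule inner_diff_left)
      then have "G y \<bullet> w = (norm w)\<^sup>2 + y \<bullet> w" by linarith
      then show ?thesis by (simp only: distrib_left)
    qed
    ultimately have "s * (norm w)\<^sup>2 + \<kappa> / 2 * (s\<^sup>2 * (norm w)\<^sup>2) \<le> s\<^sup>2 * (norm w)\<^sup>2 / 2 + L * (s * norm w)"
      unfolding U_eq by (simp add: power_mult_distrib add_divide_distrib mult.assoc)
    then have "s * ((norm w)\<^sup>2 - L * norm w) \<le> s * (s * ((1 - \<kappa>) / 2 * (norm w)\<^sup>2))"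
      by (simp add: algebra_simps power2_eq_square)
    then have "(norm w)\<^sup>2 - L * norm w \<le> s * ((1 - \<kappa>) / 2 * (norm w)\<^sup>2)" using s by simp
    also have "\<dots> \<le> s * (\<bar>\<kappa> - 1\<bar> * (norm w)\<^sup>2)" 
    proof (intro mult_left_mono mult_right_mono)
      show "(1 - \<kappa>) / 2 \<le> \<bar>\<kappa> - 1\<bar>"
        by (cases "\<kappa> \<le> 1") (auto simp: abs_if)
    qed (use s in simp_all)
    finally show ?thesis .
  qed
  have "(norm w)\<^sup>2 - L * norm w \<le> 0"
  proof (rule field_le_epsilon)
    fix e :: real assume e: "e > 0"
    \<comment> \<open>The step size \<open>e / (D + 1)\<close> makes the error at most
      \<open>e\<close>; adding 1 covers \<open>D = 0\<close>.\<close>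
    define D where "D = \<bar>\<kappa> - 1\<bar> * (norm w)\<^sup>2"
    have D: "D \<ge> 0" by (simp add: D_def)
    have "(norm w)\<^sup>2 - L * norm w \<le> e / (D + 1) * D"
    proof -
      have "0 < e / (D + 1)" using e D by simp
      from bound[OF this] show ?thesis unfolding D_def[symmetric] .
    qed
    also have "\<dots> \<le> e" using e D by (simp add: field_simps)
    finally show "(norm w)\<^sup>2 - L * norm w \<le> 0 + e" by simp
  qed
  then have "norm w * norm w \<le> L * norm w" by (simp add: power2_eq_square)
  moreover have "0 \<le> L" by (rule lipschitz_on_nonneg[OF ln_f])
  ultimately show ?thesis by (cases "w = 0") (auto simp: w_def[symmetric])
qed

text \<open>The late estimate holds for either sign of \<open>\<kappa>\<close>. The two kinds of
  target differ only in the source of the variance bound \<open>T\<close> that the early estimate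
  consumes: convexity alone, or closeness to the Gaussian.\<close>

lemma (in schedule) velocity_lipschitz_potential:
  fixes \<nu> :: "(real ^ 'n) measure"
  assumes N: "borel_probability \<nu>" "integrable \<nu> (\<lambda>y. (norm y)\<^sup>2)"
    and target: "strongly_log_concave_target \<nu> \<or> log_lipschitz_target \<nu>"
  shows "\<exists>C. \<forall>t\<in>{0<..<1}. C-lipschitz_on UNIV (velocity a b \<nu> t)"
proof -
  obtain \<beta> \<kappa> where bk: "semi_log_convex \<beta> \<nu>" "semi_log_concave \<kappa> \<nu>" "measure_support \<nu> = UNIV"
    and cases: "\<kappa> > 0 \<or> (\<exists>L f. log_lipschitz L f \<and> absolutely_continuous std_gaussian \<nu> \<and>
        (AE x in std_gaussian. RN_deriv std_gaussian \<nu> x = ennreal (f x)))"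
    using target unfolding strongly_log_concave_target_def log_lipschitz_target_def by metis
  obtain U G l where U: "\<nu> = density lborel (\<lambda>y. ennreal (exp (- U y)))" "quad_bounds \<kappa> \<beta> U G"
    "l-lipschitz_on UNIV G" "continuous_on UNIV U"
    using potential_of_target[OF bk] .
  have U_meas: "U \<in> borel_measurable borel" using U(4) by (rule borel_measurable_continuous_onI)
  have P: "potential_posterior \<nu> ((a t)\<^sup>2) (b t) U G \<kappa> \<beta> l" if "t \<in> {0<..<1}" for t
  proof -
    interpret noisy_observation \<nu> "a t" "b t" by (rule noisy_observation_schedule[OF N that])
    show ?thesis by (intro potential_posterior.intro potential_posterior_axioms.intro posterior_axioms U U_meas)
  qed
  have "\<exists>T\<ge>0. \<forall>t\<in>{0<..<1}. \<forall>x. posterior.var \<nu> ((a t)\<^sup>2) (b t) x \<le> T"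
    using cases
  proof
    assume \<kappa>: "\<kappa> > 0"
    have "posterior.var \<nu> ((a t)\<^sup>2) (b t) x \<le> CARD('n) / \<kappa>" if t: "t \<in> {0<..<1}" for t x
    proof -
      interpret potential_posterior \<nu> "(a t)\<^sup>2" "b t" U G \<kappa> \<beta> l by (rule P[OF t])
      have K: "\<kappa> \<le> \<kappa> + (b t)\<^sup>2 / (a t)\<^sup>2" by simp
      have "var x \<le> DIM(real ^ 'n) / (\<kappa> + (b t)\<^sup>2 / (a t)\<^sup>2)"
        using \<kappa> K by (intro var_le_of_convex) linarith
      also have "\<dots> \<le> CARD('n) / \<kappa>" using \<kappa> K by (intro frac_le) auto
      finally show ?thesis .
    qed
    then show ?thesis using \<kappa> by (intro exI[of _ "CARD('n) / \<kappa>"]) auto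
  next
    assume "\<exists>L f. log_lipschitz L f \<and> absolutely_continuous std_gaussian \<nu> \<and>
        (AE x in std_gaussian. RN_deriv std_gaussian \<nu> x = ennreal (f x))"
    then obtain L where L: "\<And>y. norm (G y - y) \<le> L"
      using gradient_of_log_lipschitz[OF U(1,2,4) N(1)] by metis
    have "posterior.var \<nu> ((a t)\<^sup>2) (b t) x \<le> 2 * CARD('n) + L\<^sup>2" if t: "t \<in> {0<..<1}" for t x
    proof -
      interpret potential_posterior \<nu> "(a t)\<^sup>2" "b t" U G \<kappa> \<beta> l by (rule P[OF t])
      show ?thesis using var_le_of_log_lipschitz[OF L, of x] by simp
    qed
    then show ?thesis by (intro exI[of _ "2 * CARD('n) + L\<^sup>2"]) auto
  qed
  then obtain T where T: "T \<ge> 0" "\<And>t x. t \<in> {0<..<1} \<Longrightarrow> posterior.var \<nu> ((a t)\<^sup>2) (b t) x \<le> T" by blast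
  obtain C2 t0 where late: "t0 < 1" "\<And>t. t \<in> {t0<..<1} \<Longrightarrow> C2-lipschitz_on UNIV (velocity a b \<nu> t)"
    using velocity_lipschitz_late[OF N U(1,2,3) U_meas] by metis
  have "posterior.var \<nu> ((a t)\<^sup>2) (b t) x \<le> T" if "t \<in> {0<..t0}" for t x
    using that late(1) by (intro T(2)) auto
  then obtain C1 where early: "\<And>t. t \<in> {0<..t0} \<Longrightarrow> C1-lipschitz_on UNIV (velocity a b \<nu> t)"
    using velocity_lipschitz_early[OF N late(1) _ T(1)] by metis
  show ?thesis by (rule velocity_lipschitz_join[OF late(1) early late(2)])
qed

section \<open>Gaussian mixtures\<close>

text \<open>The complement of the support is the union of all null open sets, an uncountable union
  in general. The Lindelof property extracts a countable subfamily with the same union, which is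
  therefore null.\<close>

lemma AE_in_closed_of_support:
  fixes \<rho> :: "(real ^ 'n) measure"
  assumes sets: "sets \<rho> = sets borel" and supp: "measure_support \<rho> \<subseteq> S" and S: "closed S"
  shows "AE y in \<rho>. y \<in> S"
proof -
  define F where "F = {V. open V \<and> emeasure \<rho> V = 0}"
  obtain F' where F': "F' \<subseteq> F" "countable F'" "\<Union>F' = \<Union>F"
    using Lindelof[of F] by (auto simp: F_def)
  have "\<Union>F' \<in> null_sets \<rho>"
  proof -
    have "V \<in> null_sets \<rho>" if "V \<in> F'" for V
    proof (rule null_setsI)
      show "emeasure \<rho> V = 0" using that F'(1) unfolding F_def by blast
      show "V \<in> sets \<rho>" unfolding sets using that F'(1) by (intro borel_open) (auto simp: F_def)
    qed
    from null_sets_UN'[OF F'(2), of "\<lambda>V. V", OF this] show ?thesis by simp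
  qed
  moreover have "- S \<subseteq> \<Union>F"
  proof
    fix y assume "y \<in> - S"
    then have "y \<notin> measure_support \<rho>" using supp by blast
    then obtain V where "open V" "y \<in> V" "\<not> emeasure \<rho> V > 0"
      unfolding measure_support_def by blast
    then show "y \<in> \<Union>F" unfolding F_def zero_less_iff_neq_zero by blast
  qed
  ultimately show ?thesis
    unfolding F'(3)[symmetric] by (intro AE_I'[of "\<Union>F'"]) blast+
qed

lemma integral_odd_gaussian:
  assumes \<tau>: "\<tau> > 0"
  shows "integrable lborel (\<lambda>w::real^'n. exp (- (norm w)\<^sup>2 / \<tau>) *\<^sub>R w)"
    and "(\<integral>w. exp (- (norm w)\<^sup>2 / \<tau>) *\<^sub>R w \<partial>(lborel :: (real^'n) measure)) = 0"
proof -
  let ?f = "\<lambda>w::real^'n. exp (- (norm w)\<^sup>2 / \<tau>) *\<^sub>R w"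
  show i: "integrable lborel ?f"
  proof (rule Bochner_Integration.integrable_bound)
    show "integrable lborel (\<lambda>w::real^'n. exp (- (norm w)\<^sup>2 / \<tau>) + (norm w)\<^sup>2 * exp (- (norm w)\<^sup>2 / \<tau>))"
      by (intro Bochner_Integration.integrable_add integrable_exp_norm_sq integrable_sq_exp_norm_sq \<tau>)
    show "AE w in lborel. norm (?f w) \<le> norm (exp (- (norm w)\<^sup>2 / \<tau>) + (norm w)\<^sup>2 * exp (- (norm w)\<^sup>2 / \<tau>))"
    proof (rule AE_I2)
      fix w :: "real ^ 'n"
      have "norm w \<le> 1 + (norm w)\<^sup>2"
      proof -
        have "0 \<le> (norm w - 1)\<^sup>2 + (norm w)\<^sup>2 + 1" by simp
        then show ?thesis by (simp add: power2_eq_square algebra_simps)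
      qed
      then have "exp (- (norm w)\<^sup>2 / \<tau>) * norm w \<le> exp (- (norm w)\<^sup>2 / \<tau>) * (1 + (norm w)\<^sup>2)"
        by (rule mult_left_mono) simp
      then show "norm (?f w) \<le> norm (exp (- (norm w)\<^sup>2 / \<tau>) + (norm w)\<^sup>2 * exp (- (norm w)\<^sup>2 / \<tau>))"
        by (simp add: algebra_simps)
    qed
  qed auto
  have "integral\<^sup>L lborel ?f = (\<integral>w. ?f (0 + (-1) *\<^sub>R w) \<partial>lborel)"
    using lborel_integral_affine(2)[OF i, of "-1" 0] by simp
  also have "\<dots> = - integral\<^sup>L lborel ?f" by simp
  finally show "integral\<^sup>L lborel ?f = 0"
    by (simp add: eq_neg_iff_add_eq_0 flip: scaleR_2)
qed

lemma integral_shifted_gaussian: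
  fixes u v :: "real ^ 'n"
  assumes \<tau>: "\<tau> > 0"
  shows "(\<integral>w. exp (- (norm (w - v))\<^sup>2 / \<tau>) *\<^sub>R (w + u) \<partial>lborel) =
      (\<integral>w. exp (- (norm w)\<^sup>2 / \<tau>) \<partial>(lborel :: (real ^ 'n) measure)) *\<^sub>R (v + u)"
    and "(\<integral>w. exp (- (norm (w - v))\<^sup>2 / \<tau>) \<partial>lborel) =
      (\<integral>w. exp (- (norm w)\<^sup>2 / \<tau>) \<partial>(lborel :: (real ^ 'n) measure))"
proof -
  have g: "integrable lborel (\<lambda>w::real^'n. exp (- (norm w)\<^sup>2 / \<tau>))"
    by (rule integrable_exp_norm_sq[OF \<tau>])
  show "(\<integral>w. exp (- (norm (w - v))\<^sup>2 / \<tau>) \<partial>lborel) =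
      (\<integral>w. exp (- (norm w)\<^sup>2 / \<tau>) \<partial>(lborel :: (real ^ 'n) measure))"
    using lborel_integral_affine(2)[OF g, of 1 "- v"] by simp
  let ?f = "\<lambda>w::real^'n. exp (- (norm w)\<^sup>2 / \<tau>) *\<^sub>R (w + (v + u))"
  have i: "integrable lborel ?f"
    unfolding scaleR_add_right using integral_odd_gaussian(1)[OF \<tau>] g by auto
  have "(\<integral>w. exp (- (norm (w - v))\<^sup>2 / \<tau>) *\<^sub>R (w + u) \<partial>lborel) = integral\<^sup>L lborel ?f"
    using lborel_integral_affine(2)[OF i, of 1 "- v"] by simp
  also have "\<dots> = (\<integral>w. exp (- (norm w)\<^sup>2 / \<tau>) *\<^sub>R w \<partial>lborel) + (\<integral>w. exp (- (norm w)\<^sup>2 / \<tau>) \<partial>(lborel :: (real ^ 'n) measure)) *\<^sub>R (v + u)"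
    using integral_odd_gaussian(1)[OF \<tau>] g
    by (subst scaleR_add_right, subst Bochner_Integration.integral_add) auto
  finally show "(\<integral>w. exp (- (norm (w - v))\<^sup>2 / \<tau>) *\<^sub>R (w + u) \<partial>lborel) =
      (\<integral>w. exp (- (norm w)\<^sup>2 / \<tau>) \<partial>(lborel :: (real ^ 'n) measure)) *\<^sub>R (v + u)"
    by (simp only: integral_odd_gaussian(2)[OF \<tau>] add_0)
qed

text \<open>Gaussian conditioning: if \<open>x = a z + b w\<close> with \<open>w\<close> of variance
  \<open>s\<^sup>2\<close> per coordinate, then \<open>q\<close> is the variance of
  \<open>x\<close>, and given \<open>x\<close> the component \<open>w\<close> has mean
  \<open>(b * s\<^sup>2 / q) *\<^sub>R x\<close> and variance
  \<open>a\<^sup>2 * s\<^sup>2 / q\<close>.\<close>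

lemma complete_square:
  fixes x w :: "'a::real_inner"
  assumes "a > 0" "s > 0" "b > (0::real)"
  defines "q \<equiv> a\<^sup>2 + s\<^sup>2 * b\<^sup>2"
  shows "(norm (x - b *\<^sub>R w))\<^sup>2 / (2 * a\<^sup>2) + (norm w)\<^sup>2 / (2 * s\<^sup>2) =
    (norm x)\<^sup>2 / (2 * q) + (norm (w - (b * s\<^sup>2 / q) *\<^sub>R x))\<^sup>2 / (2 * (a\<^sup>2 * s\<^sup>2 / q))"
proof -
  have q: "q > 0" using assms by (simp add: q_def add_pos_nonneg)
  define X Y Z where "X = x \<bullet> x" and "Y = x \<bullet> w" and "Z = w \<bullet> w"
  define D T where "D = b * s\<^sup>2 / q" and "T = a\<^sup>2 * s\<^sup>2 / q"
  have 1: "(norm (x - b *\<^sub>R w))\<^sup>2 = X - 2 * b * Y + b\<^sup>2 * Z"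
    unfolding power2_norm_eq_inner X_def Y_def Z_def
    by (simp add: inner_diff inner_commute power2_eq_square algebra_simps)
  have 2: "(norm (w - D *\<^sub>R x))\<^sup>2 = Z - 2 * D * Y + D\<^sup>2 * X"
    unfolding power2_norm_eq_inner X_def Y_def Z_def
    by (simp add: inner_diff inner_commute power2_eq_square algebra_simps)
  have 3: "(norm w)\<^sup>2 = Z" "(norm x)\<^sup>2 = X" by (simp_all add: Z_def X_def power2_norm_eq_inner)
  have "2 * b * Y / (2 * a\<^sup>2) = 2 * D * Y / (2 * T)" using assms q by (simp add: D_def T_def)
  moreover have "b\<^sup>2 * Z / (2 * a\<^sup>2) + Z / (2 * s\<^sup>2) = Z / (2 * T)"
    using assms(1-3) q unfolding T_def by (simp add: q_def field_simps)
  moreover have "X / (2 * a\<^sup>2) = X / (2 * q) + D\<^sup>2 * X / (2 * T)"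
  proof -
    have "D\<^sup>2 / (2 * T) = b\<^sup>2 * s\<^sup>2 / (2 * a\<^sup>2 * q)"
      using assms(1-3) q unfolding D_def T_def by (simp add: field_simps power2_eq_square)
    moreover have "1 / (2 * a\<^sup>2) = 1 / (2 * q) + b\<^sup>2 * s\<^sup>2 / (2 * a\<^sup>2 * q)"
    proof -
      have "1 / (2 * q) + b\<^sup>2 * s\<^sup>2 / (2 * a\<^sup>2 * q) = (a\<^sup>2 + s\<^sup>2 * b\<^sup>2) / (2 * a\<^sup>2 * q)"
        using assms(1-3) q by (simp add: field_simps)
      also have "\<dots> = 1 / (2 * a\<^sup>2)" unfolding q_def[symmetric] using q by simp
      finally show ?thesis ..
    qed
    ultimately have "1 / (2 * a\<^sup>2) = 1 / (2 * q) + D\<^sup>2 / (2 * T)" by simp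
    from arg_cong[OF this, of "\<lambda>u. u * X"] show ?thesis by (simp add: distrib_right)
  qed
  ultimately show ?thesis
    unfolding D_def[symmetric] T_def[symmetric] 1 2 3 add_divide_distrib diff_divide_distrib by linarith
qed

text \<open>A sample is \<open>w + u\<close> with \<open>w\<close> Gaussian and \<open>u\<close> of
  law \<open>\<rho>\<close>. Completing the square factors the weight into
  \<open>R.kern x u\<close>, free of \<open>w\<close>, and a Gaussian in \<open>w\<close> of mass
  independent of \<open>u\<close>, centred at \<open>d *\<^sub>R (x - b *\<^sub>R u)\<close>.
  Integrating out \<open>w\<close> replaces the sample by
  \<open>d *\<^sub>R x + (1 - d * b) *\<^sub>R u\<close>, where
  \<open>1 - d * b = a\<^sup>2 / q\<close>.\<close>

lemma mixture_mean:
  fixes \<rho> \<nu> :: "(real ^ 'n) measure"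
  assumes \<nu>: "noisy_observation \<nu> a b" and conv: "\<nu> = (gaussian s \<star> \<rho>)" and s: "s > 0"
  defines "q \<equiv> a\<^sup>2 + s\<^sup>2 * b\<^sup>2"
  assumes \<rho>: "posterior \<rho> q b"
  shows "posterior.mean \<nu> (a\<^sup>2) b x = (1 / q) *\<^sub>R ((b * s\<^sup>2) *\<^sub>R x + a\<^sup>2 *\<^sub>R posterior.mean \<rho> q b x)"
proof -
  interpret N: noisy_observation \<nu> a b by (rule \<nu>)
  interpret R: posterior \<rho> q b by (rule \<rho>)
  interpret Rp: prob_space \<rho> by (rule R.prob)
  interpret S: prob_space "gaussian s :: (real ^ 'n) measure" by (rule prob_space_gaussian[OF s])
  interpret SR: pair_prob_space "gaussian s :: (real ^ 'n) measure" \<rho> ..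
  have a: "a > 0" and b: "b > 0" by (rule N.a_pos, rule N.b_pos)
  have sR [measurable_cong]: "sets \<rho> = sets borel" by (rule R.sets_M)
  define c where "c = gaussian_constant s CARD('n)"
  have c: "c > 0" unfolding c_def by (rule gaussian_constant_pos[OF s])
  define \<tau> where "\<tau> = 2 * (a\<^sup>2 * s\<^sup>2 / q)"
  have q: "q > 0" by (rule R.q_pos)
  have \<tau>: "\<tau> > 0" using a s q by (simp add: \<tau>_def)
  define I where "I = (\<integral>w. exp (- (norm w)\<^sup>2 / \<tau>) \<partial>(lborel :: (real ^ 'n) measure))"
  define d where "d = b * s\<^sup>2 / q"
  have kern: "c * exp (- (norm w)\<^sup>2 / (2 * s\<^sup>2)) * N.kern x (w + u) =
      c * R.kern x u * exp (- (norm (w - d *\<^sub>R (x - b *\<^sub>R u)))\<^sup>2 / \<tau>)" for w u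
  proof -
    have "exp (- (norm w)\<^sup>2 / (2 * s\<^sup>2)) * N.kern x (w + u) =
        exp (- ((norm ((x - b *\<^sub>R u) - b *\<^sub>R w))\<^sup>2 / (2 * a\<^sup>2) + (norm w)\<^sup>2 / (2 * s\<^sup>2)))"
      by (simp add: N.kern_def algebra_simps flip: exp_add)
    also have "\<dots> = exp (- ((norm (x - b *\<^sub>R u))\<^sup>2 / (2 * q) + (norm (w - d *\<^sub>R (x - b *\<^sub>R u)))\<^sup>2 / \<tau>))"
      unfolding complete_square[OF a s b] d_def \<tau>_def q_def ..
    also have "\<dots> = R.kern x u * exp (- (norm (w - d *\<^sub>R (x - b *\<^sub>R u)))\<^sup>2 / \<tau>)"
      by (simp add: R.kern_def flip: exp_add)
    finally show ?thesis by simp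
  qed
  have gauss_int: "integral\<^sup>L (gaussian s) f = (\<integral>w. (c * exp (- (norm w)\<^sup>2 / (2 * s\<^sup>2))) *\<^sub>R f w \<partial>lborel)"
    if [measurable]: "f \<in> borel_measurable borel"
    for f :: "real ^ 'n \<Rightarrow> 'b::{banach, second_countable_topology}"
    unfolding gaussian_eq c_def using gaussian_constant_pos[OF s, of "CARD('n)"]
    by (subst integral_density) (auto intro!: AE_I2 mult_nonneg_nonneg)
  have iter: "integral\<^sup>L \<nu> f = (\<integral>u. (\<integral>w. f (w + u) \<partial>gaussian s) \<partial>\<rho>)"
    if [measurable]: "f \<in> borel_measurable borel" and "integrable \<nu> f"
    for f :: "real ^ 'n \<Rightarrow> 'b::{banach, second_countable_topology}"
  proof -
    have "integrable (gaussian s \<Otimes>\<^sub>M \<rho>) (\<lambda>(w, u). f (w + u))"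
      using that(2) unfolding conv convolution_def
      by (subst (asm) integrable_distr_eq) (auto simp: split_beta')
    from SR.integral_snd[OF this]
    have "(\<integral>u. (\<integral>w. f (w + u) \<partial>gaussian s) \<partial>\<rho>) = (\<integral>(w, u). f (w + u) \<partial>(gaussian s \<Otimes>\<^sub>M \<rho>))" .
    also have "\<dots> = integral\<^sup>L \<nu> f"
      unfolding conv convolution_def by (subst integral_distr) (auto simp: split_beta')
    finally show ?thesis ..
  qed
  have mass: "N.mass x = c * I * R.mass x"
  proof -
    have "N.mass x = (\<integral>u. (\<integral>w. N.kern x (w + u) \<partial>gaussian s) \<partial>\<rho>)"
      unfolding N.mass_def by (rule iter) (simp_all add: N.integrable_kern)
    also have "\<dots> = (\<integral>u. c * R.kern x u * I \<partial>\<rho>)"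
    proof (rule Bochner_Integration.integral_cong)
      fix u
      have "(\<integral>w. N.kern x (w + u) \<partial>gaussian s) =
          (\<integral>w. c * R.kern x u * exp (- (norm (w - d *\<^sub>R (x - b *\<^sub>R u)))\<^sup>2 / \<tau>) \<partial>lborel)"
        by (subst gauss_int, measurable) (simp only: real_scaleR_def kern)
      then show "(\<integral>w. N.kern x (w + u) \<partial>gaussian s) = c * R.kern x u * I"
        by (simp only: integral_mult_right_zero integral_shifted_gaussian(2)[OF \<tau>] I_def)
    qed simp
    finally show ?thesis by (simp add: R.mass_def mult_ac)
  qed
  have "N.mass x *\<^sub>R N.mean x = (\<integral>y. N.kern x y *\<^sub>R y \<partial>\<nu>)"
    unfolding N.mean_def by (subst N.integral_post') auto
  also have "\<dots> = (\<integral>u. (\<integral>w. N.kern x (w + u) *\<^sub>R (w + u) \<partial>gaussian s) \<partial>\<rho>)"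
    by (rule iter) (auto intro!: N.integrable_kern_growth[of _ 1 1] N.lin_le_quad)
  also have "\<dots> = (\<integral>u. (c * I) *\<^sub>R (R.kern x u *\<^sub>R (d *\<^sub>R x) + (a\<^sup>2 / q) *\<^sub>R (R.kern x u *\<^sub>R u)) \<partial>\<rho>)"
  proof (rule Bochner_Integration.integral_cong)
    fix u
    have "1 - d * b = a\<^sup>2 / q" using q by (simp add: d_def q_def field_simps power2_eq_square)
    then have du: "d *\<^sub>R (x - b *\<^sub>R u) + u = d *\<^sub>R x + (a\<^sup>2 / q) *\<^sub>R u"
      by (simp add: algebra_simps flip: scaleR_add_left)
    have "(\<integral>w. N.kern x (w + u) *\<^sub>R (w + u) \<partial>gaussian s) =
        (\<integral>w. (c * R.kern x u) *\<^sub>R (exp (- (norm (w - d *\<^sub>R (x - b *\<^sub>R u)))\<^sup>2 / \<tau>) *\<^sub>R (w + u)) \<partial>lborel)"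
      by (subst gauss_int, measurable) (simp only: scaleR_scaleR kern)
    also have "\<dots> = (c * R.kern x u) *\<^sub>R (I *\<^sub>R (d *\<^sub>R (x - b *\<^sub>R u) + u))"
      by (simp only: integral_scaleR_right integral_shifted_gaussian(1)[OF \<tau>] I_def)
    finally show "(\<integral>w. N.kern x (w + u) *\<^sub>R (w + u) \<partial>gaussian s) =
        (c * I) *\<^sub>R (R.kern x u *\<^sub>R (d *\<^sub>R x) + (a\<^sup>2 / q) *\<^sub>R (R.kern x u *\<^sub>R u))"
      unfolding du by (simp add: scaleR_add_right mult_ac)
  qed simp
  also have "\<dots> = (c * I) *\<^sub>R (R.mass x *\<^sub>R (d *\<^sub>R x) + (a\<^sup>2 / q) *\<^sub>R (\<integral>u. R.kern x u *\<^sub>R u \<partial>\<rho>))"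
  proof -
    have "integrable \<rho> (\<lambda>u. R.kern x u *\<^sub>R u)"
      by (rule R.integrable_kern_growth[of _ 1 1]) (auto intro: R.lin_le_quad)
    then show ?thesis using R.integrable_kern[of x] by (simp add: R.mass_def del: scaleR_scaleR)
  qed
  also have "(\<integral>u. R.kern x u *\<^sub>R u \<partial>\<rho>) = R.mass x *\<^sub>R R.mean x"
    unfolding R.mean_def by (subst R.integral_post') auto
  also have "(c * I) *\<^sub>R (R.mass x *\<^sub>R (d *\<^sub>R x) + (a\<^sup>2 / q) *\<^sub>R (R.mass x *\<^sub>R R.mean x)) =
      N.mass x *\<^sub>R (d *\<^sub>R x + (a\<^sup>2 / q) *\<^sub>R R.mean x)"
    unfolding mass by (simp add: scaleR_add_right mult_ac)
  finally have "N.mean x = d *\<^sub>R x + (a\<^sup>2 / q) *\<^sub>R R.mean x"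
    using N.mass_nz[of x] by simp
  then show ?thesis by (simp add: d_def scaleR_add_right)
qed

context schedule
begin

text \<open>No split of the time interval is required. The posterior of \<open>\<rho>\<close> has a
  density with respect to \<open>\<rho>\<close> and so stays in the ball, which bounds its variance
  by \<open>R\<^sup>2\<close> at all times; the remaining singular factor \<open>a' / a\<close> is
  absorbed in the formula for the velocity.\<close>

lemma velocity_lipschitz_mixture:
  fixes \<nu> :: "(real ^ 'n) measure"
  assumes N: "borel_probability \<nu>" "integrable \<nu> (\<lambda>y. (norm y)\<^sup>2)"
    and target: "gaussian_mixture_target \<nu>"
  shows "\<exists>C. \<forall>t\<in>{0<..<1}. C-lipschitz_on UNIV (velocity a b \<nu> t)"
proof -
  obtain s \<rho> c R where s: "s > 0" and \<rho>: "borel_probability \<rho>"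
    and supp: "measure_support \<rho> \<subseteq> cball c R" and conv: "\<nu> = (gaussian s \<star> \<rho>)"
    using target unfolding gaussian_mixture_target_def by blast
  have \<rho>_prob: "prob_space \<rho>" and \<rho>_sets: "sets \<rho> = sets borel"
    using \<rho> by (auto simp only: borel_probability_def)
  have AE_ball: "AE y in \<rho>. y \<in> cball c R"
    by (rule AE_in_closed_of_support[OF \<rho>_sets supp]) simp
  have \<rho>_sq: "integrable \<rho> (\<lambda>y. (norm y)\<^sup>2)"
  proof (rule finite_measure.integrable_const_bound[of _ _ "(norm c + R)\<^sup>2"])
    show "finite_measure \<rho>" using \<rho>_prob by (rule prob_space.finite_measure)
    show "AE y in \<rho>. norm ((norm y)\<^sup>2) \<le> (norm c + R)\<^sup>2"
      using AE_ball
    proof eventually_elim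
      case (elim y)
      then have "norm y \<le> norm c + R"
        using norm_triangle_sub[of y c] by (simp add: dist_norm norm_minus_commute)
      then show ?case by (simp add: power_mono)
    qed
    show "(\<lambda>y. (norm y)\<^sup>2) \<in> borel_measurable \<rho>"
      unfolding measurable_cong_sets[OF \<rho>_sets refl] by measurable
  qed
  define q where "q t = (a t)\<^sup>2 + s\<^sup>2 * (b t)\<^sup>2" for t
  have "continuous_on {0..1} q" unfolding q_def by (intro continuous_intros a_cont b_cont)
  moreover have "q t > 0" if "t \<in> {0..1}" for t
  proof (cases "t = 1")
    case True
    then show ?thesis using s by (simp add: q_def a_1 b_1)
  next
    case False
    then have "a t > 0" using that by (intro a_positive) auto
    then show ?thesis by (simp add: q_def add_pos_nonneg)
  qed
  ultimately obtain q0 where q0: "q0 > 0" "\<And>t. t \<in> {0..1} \<Longrightarrow> q0 \<le> q t"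
    using bounded_below_on_compact_interval by blast
  obtain M where M: "M > 0" "\<And>t. t \<in> {0..1} \<Longrightarrow> \<bar>a t\<bar> \<le> M" "\<And>t. t \<in> {0..1} \<Longrightarrow> \<bar>b t\<bar> \<le> M"
    "\<And>t. t \<in> {0..1} \<Longrightarrow> \<bar>b' t\<bar> \<le> M" "\<And>t. t \<in> {0<..<1} \<Longrightarrow> \<bar>a t * a' t\<bar> \<le> M"
    using schedule_bounds by blast
  have "((M + M * M * s\<^sup>2) / q0 + ((M * M + M * M\<^sup>2) / q0) * (M / q0 * (R\<^sup>2 + 1)))-lipschitz_on UNIV (velocity a b \<nu> t)"
    if t: "t \<in> {0<..<1}" for t
  proof -
    have t': "t \<in> {0..1}" using t by auto
    have at: "0 < a t" using t by (intro a_positive) auto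
    have bt: "0 < b t" "b t \<le> M" using t M(3)[OF t'] b_positive[of t] by auto
    have qt: "q0 \<le> q t" "0 < q t" using q0 t' by (auto intro: less_le_trans)
    interpret R: posterior \<rho> "q t" "b t"
      by (intro posterior.intro \<rho>_prob \<rho>_sets \<rho>_sq qt bt)
    have N_obs: "noisy_observation \<nu> (a t) (b t)" by (rule noisy_observation_schedule[OF N t])
    have var: "R.var x \<le> R\<^sup>2" for x
    proof -
      have "AE y in R.post x. y \<in> cball c R"
        unfolding R.post_def using AE_ball
        by (subst AE_density) (auto simp: measurable_cong_sets[OF \<rho>_sets refl])
      then have "AE y in R.post x. (norm (y - c))\<^sup>2 \<le> R\<^sup>2"
        by eventually_elim (auto simp: dist_norm norm_minus_commute intro: power_mono)
      then have "(\<integral>y. (norm (y - c))\<^sup>2 \<partial>R.post x) \<le> (\<integral>y. R\<^sup>2 \<partial>R.post x)"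
        using R.prob_space_post[of x]
        by (intro integral_mono_AE R.integrable_sq_diff_post)
          (auto simp: prob_space.finite_measure finite_measure.integrable_const)
      also have "\<dots> = R\<^sup>2" using R.prob_space_post[of x] by (simp add: prob_space.prob_space)
      finally show ?thesis using R.var_le[of x c] by linarith
    qed
    have id: "1-lipschitz_on UNIV (\<lambda>y::real^'n. y)" by (rule lipschitz_onI) auto
    have "(1 * (b t / q t) * (R\<^sup>2 + 1))-lipschitz_on UNIV (\<lambda>x. \<integral>y. y \<partial>R.post x)"
      by (rule R.post_integral_lipschitz[OF id var]) simp_all
    then have ml: "(1 * (b t / q t) * (R\<^sup>2 + 1))-lipschitz_on UNIV R.mean"
      by (simp add: R.mean_def[abs_def])
    have k: "1 * (b t / q t) * (R\<^sup>2 + 1) \<le> M / q0 * (R\<^sup>2 + 1)"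
    proof (rule mult_right_mono)
      show "1 * (b t / q t) \<le> M / q0" using M(1) q0(1) qt bt by (simp only: mult_1) (intro frac_le; simp)
    qed simp
    have p: "\<bar>(a t * a' t + b' t * b t * s\<^sup>2) / q t\<bar> \<le> (M + M * M * s\<^sup>2) / q0"
      unfolding abs_divide abs_of_pos[OF qt(2)]
    proof (intro frac_le q0(1) qt(1))
      have "\<bar>b' t * b t * s\<^sup>2\<bar> \<le> M * M * s\<^sup>2"
        unfolding abs_mult using M(1) by (intro mult_mono M(3,4)[OF t']) auto
      then show "\<bar>a t * a' t + b' t * b t * s\<^sup>2\<bar> \<le> M + M * M * s\<^sup>2" using M(5)[OF t] by linarith
    qed (use M(1) in simp)
    have r: "\<bar>(- (a t * a' t * b t) + b' t * (a t)\<^sup>2) / q t\<bar> \<le> (M * M + M * M\<^sup>2) / q0"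
      unfolding abs_divide abs_of_pos[OF qt(2)]
    proof (intro frac_le q0(1) qt(1))
      have "\<bar>a t * a' t * b t\<bar> \<le> M * M"
        unfolding abs_mult[of _ "b t"] using M(1) by (intro mult_mono M(3)[OF t'] M(5)[OF t]) auto
      moreover have "\<bar>b' t * (a t)\<^sup>2\<bar> \<le> M * M\<^sup>2"
        unfolding abs_mult abs_power2 using M(1) M(2)[OF t'] at
        by (intro mult_mono M(4)[OF t'] power_mono) auto
      ultimately show "\<bar>- (a t * a' t * b t) + b' t * (a t)\<^sup>2\<bar> \<le> M * M + M * M\<^sup>2" by linarith
    qed (use M(1) in simp)
    have vel: "velocity a b \<nu> t x = ((a t * a' t + b' t * b t * s\<^sup>2) / q t) *\<^sub>R x +
        ((- (a t * a' t * b t) + b' t * (a t)\<^sup>2) / q t) *\<^sub>R R.mean x" for x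
    proof -
      define m where "m = R.mean x"
      have mean: "posterior.mean \<nu> ((a t)\<^sup>2) (b t) x = (1 / q t) *\<^sub>R ((b t * s\<^sup>2) *\<^sub>R x + (a t)\<^sup>2 *\<^sub>R m)"
        unfolding q_def m_def
        using mixture_mean[OF N_obs conv s] R.posterior_axioms by (simp add: q_def)
      \<comment> \<open>The residual of the target is \<open>(a t)\<^sup>2 / q t\<close> times that
        of the mixing measure. This factor turns \<open>a' / a\<close> into
        \<open>a * a' / q\<close>, which is bounded.\<close>
      have "q t *\<^sub>R x - b t *\<^sub>R ((b t * s\<^sup>2) *\<^sub>R x + (a t)\<^sup>2 *\<^sub>R m) = (a t)\<^sup>2 *\<^sub>R (x - b t *\<^sub>R m)"
        by (simp add: q_def algebra_simps power2_eq_square)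
      then have "(1 / q t) *\<^sub>R (q t *\<^sub>R x - b t *\<^sub>R ((b t * s\<^sup>2) *\<^sub>R x + (a t)\<^sup>2 *\<^sub>R m)) = (1 / q t) *\<^sub>R ((a t)\<^sup>2 *\<^sub>R (x - b t *\<^sub>R m))"
        by simp
      then have res: "x - b t *\<^sub>R ((1 / q t) *\<^sub>R ((b t * s\<^sup>2) *\<^sub>R x + (a t)\<^sup>2 *\<^sub>R m)) = ((a t)\<^sup>2 / q t) *\<^sub>R (x - b t *\<^sub>R m)"
        using qt(2) by (simp add: scaleR_diff_right mult.commute)
      show ?thesis
        unfolding velocity_eq[OF N t] mean res m_def[symmetric] using at qt(2)
        by (simp add: algebra_simps add_divide_distrib diff_divide_distrib power2_eq_square)
    qed
    show ?thesis by (rule lipschitz_affine_combination[OF ml p r k vel])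
  qed
  then show ?thesis by blast
qed

end

section \<open>Composition of transport maps\<close>

lemma velocity_lipschitz:
  assumes "interpolation_schedule a b" "admissible_target \<nu>"
  obtains C where "\<And>t. t \<in> {0<..<1} \<Longrightarrow> C-lipschitz_on UNIV (velocity a b \<nu> t)"
proof -
  interpret schedule a b by (rule schedule.intro) (rule assms(1))
  have "\<exists>C. \<forall>t\<in>{0<..<1}. C-lipschitz_on UNIV (velocity a b \<nu> t)"
    using assms(2) velocity_lipschitz_potential[of \<nu>] velocity_lipschitz_mixture[of \<nu>]
    unfolding admissible_target_def by blast
  then show thesis using that by blast
qed

theorem corollary35:
  fixes a b :: "real \<Rightarrow> real"
    and \<nu>1 \<nu>2 :: "(real ^ 'n) measure"
    and X1 X1rev X2 X2rev :: "real \<Rightarrow> real ^ 'n \<Rightarrow> real ^ 'n"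
  assumes "interpolation_schedule a b"
    and "admissible_target \<nu>1"
    and "admissible_target \<nu>2"
    and "gaussian_interpolation_flow a b \<nu>1 X1"
    and "time_reversed_flow a b \<nu>1 X1rev"
    and "gaussian_interpolation_flow a b \<nu>2 X2"
    and "time_reversed_flow a b \<nu>2 X2rev"
  shows "lipschitz_map (X1 1) \<and> lipschitz_map (X1rev 1) \<and>
         lipschitz_map (X2 1) \<and> lipschitz_map (X2rev 1) \<and>
         X1 1 \<circ> X2rev 1 \<circ> X2 1 \<circ> X1rev 1 = id"
proof -
  obtain C1 where C1: "\<And>t. t \<in> {0<..<1} \<Longrightarrow> C1-lipschitz_on UNIV (velocity a b \<nu>1 t)"
    using velocity_lipschitz[OF assms(1,2)] by blast
  obtain C2 where C2: "\<And>t. t \<in> {0<..<1} \<Longrightarrow> C2-lipschitz_on UNIV (velocity a b \<nu>2 t)"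
    using velocity_lipschitz[OF assms(1,3)] by blast
  \<comment> \<open>In the composition the inner pair \<open>X2rev 1 \<circ> X2 1\<close> cancels
    first and the outer pair then meets, so the two targets use opposite inversion laws.\<close>
  have "X1 1 (X1rev 1 x) = x" for x by (rule flow_map_properties(3)[OF assms(4,5)]) (rule C1)
  moreover have "X2rev 1 (X2 1 x) = x" for x by (rule flow_map_properties(4)[OF assms(6,7)]) (rule C2)
  ultimately have "X1 1 \<circ> X2rev 1 \<circ> X2 1 \<circ> X1rev 1 = id"
    by (intro ext) simp
  moreover have "lipschitz_map (X1 1)" by (rule flow_map_properties(1)[OF assms(4,5)]) (rule C1)
  moreover have "lipschitz_map (X1rev 1)" by (rule flow_map_properties(2)[OF assms(4,5)]) (rule C1)
  moreover have "lipschitz_map (X2 1)" by (rule flow_map_properties(1)[OF assms(6,7)]) (rule C2)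
  moreover have "lipschitz_map (X2rev 1)" by (rule flow_map_properties(2)[OF assms(6,7)]) (rule C2)
  ultimately show ?thesis by blast
qed

end
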